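(* Let $r\ge 1$, let $d_1,\dots,d_r>0$ and $s_1,\dots,s_r>0$ be integers, put $d=d_1s_1+\dots+d_rs_r$, and let $k$ be a field with $\mathrm{char}\,k=0$ or $\mathrm{char}\,k>d$. For $1\le i\le r$ let $\varphi_i:V_i\to k$ be a nondegenerate form of degree $d_i$ over $k$. Let $V=V_1\oplus\dots\oplus V_r$ and let $\varphi:V\to k$ be the form of degree $d$ given by $$\varphi(u_1+\dots+u_r)=\varphi_1(u_1)^{s_1}\cdots\varphi_r(u_r)^{s_r}\qquad(u_i\in V_i).$$ (i) If there is an $i_0$, $1\le i_0\le r$, such that $s_{i_0}=1$ and $D_l(\varphi_{i_0})=l^\times$ for each field extension $l$ of $k$, then $D_l(\varphi)=l^\times$ for each field extension $l$ of $k$, and $\varphi$ is multiplicative and Jordan multiplicative. (ii) If there is an $i_0$, $1\le i_0\le r$, such that $s_{i_0}=1$ and $G_l(\varphi_{i_0})=l^\times$ for each field extension $l$ of $k$, then $G_l(\varphi)=l^\times$ for each field extension $l$ of $k$, and $\varphi$ is strongly multiplicative. (iii) If every $\varphi_i$ is strongly multiplicative, then so is $\varphi$. (iv) If every $\varphi_i$ is multiplicative, then so is $\varphi$. (v) If every $\varphi_i$ is strongly Jordan multiplicative, then so is $\varphi$. (vi) If every $\varphi_i$ is Jordan multiplicative, then so is $\varphi$.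
   Context: A form of degree $d$ on a finite-dimensional $k$-vector space $V$ is a map $\varphi:V\to k$ which in coordinates is given by a homogeneous polynomial of degree $d$ over $k$; it corresponds to a unique symmetric $d$-linear form $\theta$ with $\varphi(v)=\theta(v,\dots,v)$, and it is nondegenerate if $v=0$ is the only vector with $\theta(v,v_2,\dots,v_d)=0$ for all $v_i\in V$. Two forms of degree $d$ are isomorphic ($\cong$) if they correspond to each other under a bijective linear map of the underlying spaces. For a field extension $l/k$, $\varphi_l$ is the form obtained by extension of scalars, $D_l(\varphi)=\{a\in l^\times \mid \varphi_l(x)=a \text{ for some } x\in V\otimes_k l\}$, $G_l(\varphi)=\{a\in l^\times\mid a\varphi_l\cong\varphi_l\}$. Let $n=\dim V$, identify $\varphi$ with a homogeneous polynomial in $n$ variables via a basis, let $X=(x_1,\dots,x_n)$, $Y=(y_1,\dots,y_n)$ be independent indeterminates, $K=k(X)$, $L=k(X,Y)$. Then $\varphi$ is: multiplicative if $\varphi(X)\varphi(Y)=\varphi(z_1,\dots,z_n)$ for suitable $z_1,\dots,z_n\in L$; strongly multiplicative if $\varphi(X)\varphi_K\cong\varphi_K$ over $K$; Jordan multiplicative if $\varphi(X)^2\varphi(Y)=\varphi(z_1,\dots,z_n)$ for suitable $z_1,\dots,z_n\in L$; strongly Jordan multiplicative if $\varphi(X)^2\varphi_K\cong\varphi_K$ over $K$.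
   Formalization: In part (i) it is additionally assumed that every V_i is nonzero; if some V_j = 0, then the form φ_j = 0 is vacuously nondegenerate, φ = 0 and D_l(φ) is empty, so (i) as stated would fail. *)

theory Defs
  imports
    "HOL-Library.Poly_Mapping"
    "HOL-Computational_Algebra.Fraction_Field"
    "HOL-Algebra.Algebraic_Closure_Type"
    "HOL-Algebra.Generated_Fields"
begin

section \<open>Polynomials, field extensions and rational function fields\<close>

type_synonym 'k mpoly = "(nat \<Rightarrow>\<^sub>0 nat) \<Rightarrow>\<^sub>0 'k"
type_synonym ('k, 'v) scaling = "'k \<Rightarrow> 'v \<Rightarrow> 'v"
type_synonym 'k ratfun = "'k mpoly fract"

definition homogeneous :: "nat \<Rightarrow> nat \<Rightarrow> 'k::zero mpoly \<Rightarrow> bool" where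
  "homogeneous n d p \<longleftrightarrow>
     (\<forall>m \<in> Poly_Mapping.keys p. Poly_Mapping.keys m \<subseteq> {..<n} \<and>
        (\<Sum>i\<in>Poly_Mapping.keys m. Poly_Mapping.lookup m i) = d)"

text \<open>Field extensions of \<open>'k\<close> are records, not types, because the statement quantifies over
  them inside hypotheses; a pair \<open>(h, L)\<close> consists of a field \<open>L\<close> and an embedding \<open>h\<close> into it.\<close>

definition field_extension ::
    "('k::field \<Rightarrow> 'l) \<Rightarrow> 'l ring \<Rightarrow> bool" where
  "field_extension h L \<longleftrightarrow> field L \<and> h \<in> ring_hom ring_of_type_algebra L"

definition eval_over :: "('k::zero \<Rightarrow> 'l) \<Rightarrow> 'l ring \<Rightarrow> 'k mpoly \<Rightarrow> (nat \<Rightarrow> 'l) \<Rightarrow> 'l" where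
  "eval_over h L p x =
     (\<Oplus>\<^bsub>L\<^esub>m\<in>Poly_Mapping.keys p. h (Poly_Mapping.lookup p m) \<otimes>\<^bsub>L\<^esub>
        (\<Otimes>\<^bsub>L\<^esub>i\<in>Poly_Mapping.keys m. x i [^]\<^bsub>L\<^esub> Poly_Mapping.lookup m i))"

definition const_ratfun :: "'k::field \<Rightarrow> 'k ratfun" where
  "const_ratfun c = Fract (Poly_Mapping.single 0 c) 1"

definition var_ratfun :: "nat \<Rightarrow> 'k::field ratfun" where
  "var_ratfun i = Fract (Poly_Mapping.single (Poly_Mapping.single i 1) 1) 1"

text \<open>The rational function field in the first \<open>m\<close> of the countably many indeterminates.\<close>

definition ratfun_field :: "nat \<Rightarrow> 'k::field ratfun ring" where
  "ratfun_field m = ring_of_type_algebra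
     \<lparr>carrier := generate_field ring_of_type_algebra (range const_ratfun \<union> var_ratfun ` {..<m})\<rparr>"

definition vecs :: "'l ring \<Rightarrow> nat \<Rightarrow> (nat \<Rightarrow> 'l) set" where
  "vecs L n = {..<n} \<rightarrow>\<^sub>E carrier L"

definition isomorphic_over ::
    "'l ring \<Rightarrow> nat \<Rightarrow> ((nat \<Rightarrow> 'l) \<Rightarrow> 'l) \<Rightarrow> ((nat \<Rightarrow> 'l) \<Rightarrow> 'l) \<Rightarrow> bool" where
  "isomorphic_over L n f g \<longleftrightarrow>
     (\<exists>T. bij_betw T (vecs L n) (vecs L n) \<and>
        (\<forall>c\<in>carrier L. \<forall>x\<in>vecs L n. \<forall>y\<in>vecs L n.
           T (\<lambda>i\<in>{..<n}. c \<otimes>\<^bsub>L\<^esub> x i \<oplus>\<^bsub>L\<^esub> y i) = (\<lambda>i\<in>{..<n}. c \<otimes>\<^bsub>L\<^esub> T x i \<oplus>\<^bsub>L\<^esub> T y i)) \<and>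
        (\<forall>x\<in>vecs L n. f (T x) = g x))"


section \<open>Forms of degree d on finite-dimensional vector spaces\<close>

definition is_basis ::
    "('k::field, 'v::ab_group_add) scaling \<Rightarrow>
      'v set \<Rightarrow> nat \<Rightarrow> (nat \<Rightarrow> 'v) \<Rightarrow> bool" where
  "is_basis scale V n b \<longleftrightarrow>
     inj_on b {..<n} \<and> \<not> module.dependent scale (b ` {..<n}) \<and> module.span scale (b ` {..<n}) = V"

text \<open>The homogeneous polynomial \<open>p\<close> describes \<open>\<phi>\<close> in the coordinates given by the basis \<open>b\<close>.\<close>

definition coordinates ::
    "('k::field, 'v::ab_group_add) scaling \<Rightarrow>
      nat \<Rightarrow> 'v set \<Rightarrow> ('v \<Rightarrow> 'k) \<Rightarrow> nat \<Rightarrow> (nat \<Rightarrow> 'v) \<Rightarrow> 'k mpoly \<Rightarrow> bool" where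
  "coordinates scale d V \<phi> n b p \<longleftrightarrow> is_basis scale V n b \<and> homogeneous n d p \<and>
     (\<forall>x. \<phi> (\<Sum>i<n. scale (x i) (b i)) = eval_over id ring_of_type_algebra p x)"

definition is_form ::
    "('k::field, 'v::ab_group_add) scaling \<Rightarrow>
      nat \<Rightarrow> 'v set \<Rightarrow> ('v \<Rightarrow> 'k) \<Rightarrow> bool" where
  "is_form scale d V \<phi> \<longleftrightarrow> (\<exists>n b p. coordinates scale d V \<phi> n b p)"

text \<open>A \<open>d\<close>-linear form takes a list of \<open>d\<close> vectors of \<open>V\<close>.\<close>

definition symmetric_multilinear ::
    "('k::field, 'v::ab_group_add) scaling \<Rightarrow>
      nat \<Rightarrow> 'v set \<Rightarrow> ('v list \<Rightarrow> 'k) \<Rightarrow> bool" where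
  "symmetric_multilinear scale d V \<theta> \<longleftrightarrow>
     (\<forall>vs ws. length vs = d \<and> set vs \<subseteq> V \<and> mset ws = mset vs \<longrightarrow> \<theta> ws = \<theta> vs) \<and>
     (\<forall>vs j c u v. length vs = d \<and> set vs \<subseteq> V \<and> j < d \<and> u \<in> V \<and> v \<in> V \<longrightarrow>
        \<theta> (vs[j := scale c u + v]) = c * \<theta> (vs[j := u]) + \<theta> (vs[j := v]))"

text \<open>The form \<open>\<theta>\<close> is unique if the characteristic is 0 or larger than \<open>d\<close>.\<close>

definition nondegenerate ::
    "('k::field, 'v::ab_group_add) scaling \<Rightarrow>
      nat \<Rightarrow> 'v set \<Rightarrow> ('v \<Rightarrow> 'k) \<Rightarrow> bool" where
  "nondegenerate scale d V \<phi> \<longleftrightarrow>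
     (\<exists>\<theta>. symmetric_multilinear scale d V \<theta> \<and> (\<forall>v\<in>V. \<phi> v = \<theta> (replicate d v)) \<and>
        (\<forall>v\<in>V. (\<forall>vs. length vs = d - 1 \<and> set vs \<subseteq> V \<longrightarrow> \<theta> (v # vs) = 0) \<longrightarrow> v = 0))"

text \<open>The remaining notions refer to \<open>\<phi>\<close> through its polynomial in some basis of \<open>V\<close>. They do not
  depend on the basis: a change of basis is a linear substitution with coefficients in \<open>'k\<close>.
  The scalar extension of \<open>\<phi>\<close> to \<open>L\<close> is \<open>eval_over h L p\<close> on \<open>vecs L n\<close>.\<close>

definition D_over ::
    "('k::field, 'v::ab_group_add) scaling \<Rightarrow>
      ('k \<Rightarrow> 'l) \<Rightarrow> 'l ring \<Rightarrow> nat \<Rightarrow> 'v set \<Rightarrow> ('v \<Rightarrow> 'k) \<Rightarrow> 'l set" where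
  "D_over scale h L d V \<phi> = {a \<in> Units L. \<exists>n b p. coordinates scale d V \<phi> n b p \<and>
     (\<exists>x\<in>vecs L n. eval_over h L p x = a)}"

definition G_over ::
    "('k::field, 'v::ab_group_add) scaling \<Rightarrow>
      ('k \<Rightarrow> 'l) \<Rightarrow> 'l ring \<Rightarrow> nat \<Rightarrow> 'v set \<Rightarrow> ('v \<Rightarrow> 'k) \<Rightarrow> 'l set" where
  "G_over scale h L d V \<phi> = {a \<in> Units L. \<exists>n b p. coordinates scale d V \<phi> n b p \<and>
     isomorphic_over L n (\<lambda>x. a \<otimes>\<^bsub>L\<^esub> eval_over h L p x) (eval_over h L p)}"

text \<open>In \<open>ratfun_field (2 * n)\<close> the tuple \<open>xs\<close> consists of the indeterminates \<open>0, \<dots>, n - 1\<close>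
  and \<open>ys\<close> of the indeterminates \<open>n, \<dots>, 2 * n - 1\<close>.\<close>

definition multiplicative ::
    "('k::field, 'v::ab_group_add) scaling \<Rightarrow>
      nat \<Rightarrow> 'v set \<Rightarrow> ('v \<Rightarrow> 'k) \<Rightarrow> bool" where
  "multiplicative scale d V \<phi> \<longleftrightarrow> (\<exists>n b p. coordinates scale d V \<phi> n b p \<and>
     (let L = ratfun_field (2 * n); \<phi>L = eval_over const_ratfun L p;
          xs = (\<lambda>i\<in>{..<n}. var_ratfun i); ys = (\<lambda>i\<in>{..<n}. var_ratfun (n + i))
      in \<exists>z\<in>vecs L n. \<phi>L xs \<otimes>\<^bsub>L\<^esub> \<phi>L ys = \<phi>L z))"

definition jordan_multiplicative ::
    "('k::field, 'v::ab_group_add) scaling \<Rightarrow>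
      nat \<Rightarrow> 'v set \<Rightarrow> ('v \<Rightarrow> 'k) \<Rightarrow> bool" where
  "jordan_multiplicative scale d V \<phi> \<longleftrightarrow> (\<exists>n b p. coordinates scale d V \<phi> n b p \<and>
     (let L = ratfun_field (2 * n); \<phi>L = eval_over const_ratfun L p;
          xs = (\<lambda>i\<in>{..<n}. var_ratfun i); ys = (\<lambda>i\<in>{..<n}. var_ratfun (n + i))
      in \<exists>z\<in>vecs L n. \<phi>L xs [^]\<^bsub>L\<^esub> (2::nat) \<otimes>\<^bsub>L\<^esub> \<phi>L ys = \<phi>L z))"

definition strongly_multiplicative ::
    "('k::field, 'v::ab_group_add) scaling \<Rightarrow>
      nat \<Rightarrow> 'v set \<Rightarrow> ('v \<Rightarrow> 'k) \<Rightarrow> bool" where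
  "strongly_multiplicative scale d V \<phi> \<longleftrightarrow> (\<exists>n b p. coordinates scale d V \<phi> n b p \<and>
     (let K = ratfun_field n; \<phi>K = eval_over const_ratfun K p; xs = (\<lambda>i\<in>{..<n}. var_ratfun i)
      in isomorphic_over K n (\<lambda>x. \<phi>K xs \<otimes>\<^bsub>K\<^esub> \<phi>K x) \<phi>K))"

definition strongly_jordan_multiplicative ::
    "('k::field, 'v::ab_group_add) scaling \<Rightarrow>
      nat \<Rightarrow> 'v set \<Rightarrow> ('v \<Rightarrow> 'k) \<Rightarrow> bool" where
  "strongly_jordan_multiplicative scale d V \<phi> \<longleftrightarrow> (\<exists>n b p. coordinates scale d V \<phi> n b p \<and>
     (let K = ratfun_field n; \<phi>K = eval_over const_ratfun K p; xs = (\<lambda>i\<in>{..<n}. var_ratfun i)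
      in isomorphic_over K n (\<lambda>x. \<phi>K xs [^]\<^bsub>K\<^esub> (2::nat) \<otimes>\<^bsub>K\<^esub> \<phi>K x) \<phi>K))"

text \<open>\<open>V\<close> is the internal direct sum of the subspaces \<open>W 1, \<dots>, W r\<close>.\<close>

definition direct_sum ::
    "('k::field, 'v::ab_group_add) scaling \<Rightarrow>
      nat \<Rightarrow> (nat \<Rightarrow> 'v set) \<Rightarrow> 'v set \<Rightarrow> bool" where
  "direct_sum scale r W V \<longleftrightarrow> (\<forall>i\<in>{1..r}. module.subspace scale (W i)) \<and>
     V = {\<Sum>i\<in>{1..r}. u i | u. \<forall>i\<in>{1..r}. u i \<in> W i} \<and>
     (\<forall>u. (\<forall>i\<in>{1..r}. u i \<in> W i) \<and> (\<Sum>i\<in>{1..r}. u i) = 0 \<longrightarrow> (\<forall>i\<in>{1..r}. u i = 0))"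

end

theory Submission
  imports Defs
begin

text \<open>
  Write \<open>n\<^sub>i\<close> for the dimension of the \<open>i\<close>-th summand. In a basis of \<open>V\<close> adapted to the direct sum,
  \<open>\<phi>\<close> is the product of the powers \<open>\<phi>\<^sub>i ^ s\<^sub>i\<close>, each in its own block of \<open>n\<^sub>i\<close> variables
  (\<open>coordinates_join\<close>), and this remains true over every extension field (\<open>eval_prod_poly\<close>). So
  all six assertions can be proved block by block.

  In (i) and (ii) the block of \<open>i\<^sub>0\<close> enters with exponent 1 and absorbs an arbitrary unit. For
  values, the other blocks are fixed at vectors over \<open>k\<close> where the \<open>\<phi>\<^sub>i\<close> do not vanish; these
  exist by polarization, because \<open>\<phi>\<^sub>i\<close> is nondegenerate on a nonzero space
  (\<open>nondegenerate_nonzero_value\<close>, \<open>D_over_direct_sum\<close>). For similarity factors, the isomorphism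
  of \<open>\<phi>\<^sub>i\<close> with its multiple for \<open>i = i\<^sub>0\<close> is extended by the identity (\<open>G_over_direct_sum\<close>).
  Put \<open>e = 1\<close> for the multiplicative and \<open>e = 2\<close> for the Jordan multiplicative property.
  Multiplicativity is then the special case of the extension field \<open>k(X, Y)\<close> or \<open>k(X)\<close> and of the
  element \<open>\<phi>(X)\<^sup>e \<phi>(Y)\<close> or \<open>\<phi>(X)\<close>.
  The hypotheses speak about extension fields in the type \<open>'u\<close>, so they are applied to a copy of
  the rational function field in that type (\<open>ratfun_field_copy\<close>).

  In (iii) to (vi), renaming indeterminates embeds the rational function field of the \<open>i\<close>-th summand into that of
  \<open>V\<close> and sends the generic point of the summand to the \<open>i\<close>-th block of the generic point of \<open>V\<close>
  (\<open>rename_ratfun\<close>). Hence \<open>\<phi>\<^sub>i(X\<^sub>i)\<^sup>e \<phi>\<^sub>i(Y\<^sub>i) = \<phi>\<^sub>i(z\<^sub>i)\<close> holds for the blocks, and the product of the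
  \<open>s\<^sub>i\<close>-th powers is the assertion on \<open>\<phi>\<close>. In the strong versions the isomorphisms of the summands
  are first extended to the larger field (\<open>isomorphic_over_rename\<close>) and then put together to a
  block diagonal one (\<open>isomorphic_over_prod_poly\<close>).

  The characteristic matters for the polarization, and because identities between values have to be
  turned into identities between polynomials. This happens when an isomorphism is extended to
  a larger field, and when two bases of the same space are compared: \<open>coordinates\<close> determines the
  polynomial only by its values over \<open>k\<close>, but its values over extension fields are needed
  (\<open>coordinates_change\<close>). A homogeneous polynomial of degree \<open>d\<close> is determined by its values on
  \<open>S\<^sup>n\<close> as soon as \<open>S\<close> has more than \<open>d\<close> elements, and \<open>0, \<dots>, d\<close> are distinct in \<open>k\<close>.
\<close>

section \<open>Evaluation of polynomials\<close>

abbreviation type_ring :: "'a::comm_ring_1 ring" where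
  "type_ring \<equiv> ring_of_type_algebra"

lemma type_ring_simps [simp]:
  "carrier type_ring = UNIV" "x \<otimes>\<^bsub>type_ring\<^esub> y = x * y" "\<one>\<^bsub>type_ring\<^esub> = 1"
  "\<zero>\<^bsub>type_ring\<^esub> = 0" "x \<oplus>\<^bsub>type_ring\<^esub> y = x + y"
  by (auto simp: ring_of_type_algebra_def)

lemma cring_type_ring [simp, intro]: "cring (type_ring :: 'a::comm_ring_1 ring)"
  by (rule cring_from_type_algebra)

lemma field_type_ring [simp, intro]: "field (type_ring :: 'a::field ring)"
  by (rule field_from_type_algebra)

lemma finsum_type_ring [simp]:
  fixes f :: "'b \<Rightarrow> 'a::comm_ring_1"
  shows "finsum type_ring f A = sum f A"
proof -
  interpret cring "type_ring :: 'a ring" ..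
  show ?thesis
    by (induct A rule: infinite_finite_induct) auto
qed

lemma finprod_type_ring [simp]:
  fixes f :: "'b \<Rightarrow> 'a::comm_ring_1"
  shows "finprod type_ring f A = prod f A"
proof -
  interpret cring "type_ring :: 'a ring" ..
  show ?thesis
    by (induct A rule: infinite_finite_induct) auto
qed

lemma pow_type_ring [simp]:
  fixes x :: "'a::comm_ring_1"
  shows "x [^]\<^bsub>type_ring\<^esub> (n::nat) = x ^ n"
proof -
  interpret cring "type_ring :: 'a ring" ..
  show ?thesis
    by (induct n) auto
qed

lemma ring_hom_type_ring_iff:
  "h \<in> ring_hom type_ring L \<longleftrightarrow> (\<forall>x. h x \<in> carrier L) \<and> h 1 = \<one>\<^bsub>L\<^esub> \<and>
     (\<forall>x y. h (x * y) = h x \<otimes>\<^bsub>L\<^esub> h y) \<and> (\<forall>x y. h (x + y) = h x \<oplus>\<^bsub>L\<^esub> h y)"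
  by (auto simp: ring_hom_def)

text \<open>Every polynomial is a sum of terms, so additive statements need to be checked on terms only.\<close>

lemma mpoly_induct [case_names single add]:
  assumes "\<And>m c. P (Poly_Mapping.single m c)" and "\<And>p q. P p \<Longrightarrow> P q \<Longrightarrow> P (p + q)"
  shows "P (p :: 'm \<Rightarrow>\<^sub>0 'k::comm_ring_1)"
proof -
  have "P (\<Sum>m\<in>A. Poly_Mapping.single m (Poly_Mapping.lookup p m))" if "finite A" for A
    using that
  proof (induct A)
    case empty
    then show ?case using assms(1)[of _ 0] by simp
  qed (simp add: assms)
  moreover have "(\<Sum>m\<in>Poly_Mapping.keys p. Poly_Mapping.single m (Poly_Mapping.lookup p m)) = p"
    by (rule poly_mapping_eqI) (auto simp: lookup_sum lookup_single when_def in_keys_iff)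
  ultimately show ?thesis by (metis finite_keys)
qed

definition monomial_value :: "'l ring \<Rightarrow> (nat \<Rightarrow> 'l) \<Rightarrow> (nat \<Rightarrow>\<^sub>0 nat) \<Rightarrow> 'l" where
  "monomial_value L x m =
     (\<Otimes>\<^bsub>L\<^esub>i\<in>Poly_Mapping.keys m. x i [^]\<^bsub>L\<^esub> Poly_Mapping.lookup m i)"

lemma eval_over_monomial_value:
  "eval_over h L p x = (\<Oplus>\<^bsub>L\<^esub>m\<in>Poly_Mapping.keys p.
     h (Poly_Mapping.lookup p m) \<otimes>\<^bsub>L\<^esub> monomial_value L x m)"
  unfolding eval_over_def monomial_value_def ..

text \<open>Evaluation at a point all of whose coordinates lie in the carrier is the ring homomorphism
  that the universal property of the polynomial ring provides. Since the index set of the sum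
  depends on the polynomial, additivity is read off after enlarging the index sets.\<close>

locale mpoly_eval = ring_hom_cring "type_ring :: 'k::comm_ring_1 ring" L h
  for L :: "'l ring" and h +
  fixes x :: "nat \<Rightarrow> 'l"
  assumes x_closed [simp]: "x i \<in> carrier L"
begin

lemma h_closed [simp]: "h c \<in> carrier L"
  by (rule hom_closed) simp

lemma h_add: "h (a + b) = h a \<oplus>\<^bsub>L\<^esub> h b"
  using hom_add[of a b] by simp

lemma h_mult: "h (a * b) = h a \<otimes>\<^bsub>L\<^esub> h b"
  using hom_mult[of a b] by simp

lemma h_zero [simp]: "h 0 = \<zero>\<^bsub>L\<^esub>" and h_one [simp]: "h 1 = \<one>\<^bsub>L\<^esub>"
  using hom_zero hom_one by simp_all

lemma monomial_value_closed [simp]: "monomial_value L x m \<in> carrier L"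
  unfolding monomial_value_def by (auto intro: S.finprod_closed)

lemma monomial_value_superset:
  assumes "finite A" "Poly_Mapping.keys m \<subseteq> A"
  shows "monomial_value L x m = (\<Otimes>\<^bsub>L\<^esub>i\<in>A. x i [^]\<^bsub>L\<^esub> Poly_Mapping.lookup m i)"
  unfolding monomial_value_def
  by (rule S.finprod_mono_neutral_cong_left) (use assms in \<open>auto simp: in_keys_iff\<close>)

lemma monomial_value_add:
  "monomial_value L x (m + m') = monomial_value L x m \<otimes>\<^bsub>L\<^esub> monomial_value L x m'"
proof -
  let ?A = "Poly_Mapping.keys m \<union> Poly_Mapping.keys m'"
  have "Poly_Mapping.keys (m + m') \<subseteq> ?A" by (rule Poly_Mapping.keys_add)
  then show ?thesis
    by (simp add: monomial_value_superset[of ?A] lookup_add S.nat_pow_mult[symmetric]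
        S.finprod_multf Pi_def)
qed

lemma eval_superset:
  assumes "finite A" "Poly_Mapping.keys p \<subseteq> A"
  shows "eval_over h L p x =
    (\<Oplus>\<^bsub>L\<^esub>m\<in>A. h (Poly_Mapping.lookup p m) \<otimes>\<^bsub>L\<^esub> monomial_value L x m)"
  unfolding eval_over_monomial_value
  by (rule S.add.finprod_mono_neutral_cong_left) (use assms in \<open>auto simp: in_keys_iff\<close>)

lemma eval_closed [simp]: "eval_over h L p x \<in> carrier L"
  unfolding eval_over_monomial_value by (auto intro: S.finsum_closed)

lemma eval_single:
  "eval_over h L (Poly_Mapping.single m c) x = h c \<otimes>\<^bsub>L\<^esub> monomial_value L x m"
  by (simp add: eval_superset[of "{m}"])

lemma eval_add: "eval_over h L (p + q) x = eval_over h L p x \<oplus>\<^bsub>L\<^esub> eval_over h L q x"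
proof -
  let ?A = "Poly_Mapping.keys p \<union> Poly_Mapping.keys q"
  have "Poly_Mapping.keys (p + q) \<subseteq> ?A" by (rule Poly_Mapping.keys_add)
  then show ?thesis
    by (simp add: eval_superset[of ?A] lookup_add h_add S.l_distr S.finsum_addf Pi_def)
qed

lemma eval_mult: "eval_over h L (p * q) x = eval_over h L p x \<otimes>\<^bsub>L\<^esub> eval_over h L q x"
proof (induct p rule: mpoly_induct)
  case (single m c)
  show ?case
  proof (induct q rule: mpoly_induct)
    case (single m' c')
    show ?case
      by (simp add: mult_single eval_single monomial_value_add h_mult S.m_ac)
  qed (simp add: distrib_left eval_add S.r_distr)
qed (simp add: distrib_right eval_add S.l_distr)

lemma eval_const [simp]: "eval_over h L (Poly_Mapping.single 0 c) x = h c"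
  by (simp add: eval_single monomial_value_def)

lemma eval_var [simp]: "eval_over h L (Poly_Mapping.single (Poly_Mapping.single i 1) 1) x = x i"
  by (simp add: eval_single monomial_value_def)

lemma eval_one [simp]: "eval_over h L 1 x = \<one>\<^bsub>L\<^esub>"
  using eval_const[of 1] by simp

lemma eval_ring_hom: "(\<lambda>p. eval_over h L p x) \<in> ring_hom type_ring L"
  by (simp add: ring_hom_type_ring_iff eval_add eval_mult)

sublocale eval: ring_hom_cring "type_ring :: 'k mpoly ring" L "\<lambda>p. eval_over h L p x"
proof -
  interpret P: cring "type_ring :: 'k mpoly ring" ..
  show "ring_hom_cring (type_ring :: 'k mpoly ring) L (\<lambda>p. eval_over h L p x)"
    by unfold_locales (rule eval_ring_hom)
qed

end

lemma mpoly_evalI: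
  assumes "cring L" "h \<in> ring_hom type_ring L" "\<And>i. x i \<in> carrier L"
  shows "mpoly_eval L h x"
proof -
  interpret L: cring L by fact
  interpret K: cring type_ring by (rule cring_type_ring)
  show ?thesis by unfold_locales (use assms in auto)
qed

lemma homogeneous_varD:
  "homogeneous n d p \<Longrightarrow> m \<in> Poly_Mapping.keys p \<Longrightarrow> i \<in> Poly_Mapping.keys m \<Longrightarrow> i < n"
  by (auto simp: homogeneous_def)

text \<open>The values of a point beyond the \<open>n\<close> variables are irrelevant. This reconciles the elements of
  \<open>vecs L n\<close>, which are undefined there, with the totally defined points of \<open>mpoly_eval\<close>.\<close>

lemma eval_over_cong:
  assumes L: "cring L" and h: "h \<in> ring_hom type_ring L" and p: "homogeneous n d p"
    and x: "\<And>i. i < n \<Longrightarrow> x i = y i" and y: "\<And>i. i < n \<Longrightarrow> y i \<in> carrier L"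
  shows "eval_over h L p x = eval_over h L p y"
proof -
  interpret L: cring L by fact
  have h': "h c \<in> carrier L" for c using h by (simp add: ring_hom_type_ring_iff)
  have mem: "monomial_value L y m \<in> carrier L" if "m \<in> Poly_Mapping.keys p" for m
    unfolding monomial_value_def
    by (rule L.finprod_closed) (use homogeneous_varD[OF p that] y in auto)
  have eq: "monomial_value L x m = monomial_value L y m" if "m \<in> Poly_Mapping.keys p" for m
    unfolding monomial_value_def
    by (rule L.finprod_cong') (use homogeneous_varD[OF p that] x y in auto)
  show ?thesis unfolding eval_over_monomial_value
    by (rule L.finsum_cong') (use mem eq h' in auto)
qed

lemma eval_over_closed:
  assumes "cring L" "h \<in> ring_hom type_ring L" and p: "homogeneous n d p"
    and x: "\<And>i. i < n \<Longrightarrow> x i \<in> carrier L"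
  shows "eval_over h L p x \<in> carrier L"
proof -
  interpret L: cring L by fact
  interpret mpoly_eval L h "\<lambda>i. if i < n then x i else \<zero>\<^bsub>L\<^esub>"
    by (rule mpoly_evalI) (use assms in auto)
  have "eval_over h L p x = eval_over h L p (\<lambda>i. if i < n then x i else \<zero>\<^bsub>L\<^esub>)"
    by (rule eval_over_cong) (use assms in auto)
  then show ?thesis by simp
qed

text \<open>Homomorphisms commute with evaluation. The lemma covers the inclusion of a subfield, the
  transport of structure between carrier types, renaming of variables and, with \<open>g\<close> itself an
  evaluation homomorphism, substitution of polynomials into polynomials.\<close>

lemma eval_over_natural:
  assumes L: "cring L" and L': "cring L'" and g: "g \<in> ring_hom L L'"
    and h: "h \<in> ring_hom type_ring L" and p: "homogeneous n d p"
    and x: "\<And>i. i < n \<Longrightarrow> x i \<in> carrier L"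
  shows "g (eval_over h L p x) = eval_over (\<lambda>c. g (h c)) L' p (\<lambda>i. g (x i))"
proof -
  interpret L: cring L by fact
  interpret L': cring L' by fact
  interpret g: ring_hom_cring L L' g by unfold_locales fact
  have h': "h c \<in> carrier L" for c using h by (simp add: ring_hom_type_ring_iff)
  have mem: "monomial_value L x m \<in> carrier L" if "m \<in> Poly_Mapping.keys p" for m
    unfolding monomial_value_def
    by (rule L.finprod_closed) (use homogeneous_varD[OF p that] x in auto)
  have pow: "g (x i [^]\<^bsub>L\<^esub> (k::nat)) = g (x i) [^]\<^bsub>L'\<^esub> k" if "i < n" for i k
    using x[OF that] by (induct k) auto
  have eq: "g (monomial_value L x m) = monomial_value L' (\<lambda>i. g (x i)) m"
    if "m \<in> Poly_Mapping.keys p" for m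
  proof -
    have "g (monomial_value L x m) =
        (\<Otimes>\<^bsub>L'\<^esub>i\<in>Poly_Mapping.keys m. (g \<circ> (\<lambda>i. x i [^]\<^bsub>L\<^esub> Poly_Mapping.lookup m i)) i)"
      unfolding monomial_value_def
      by (rule g.hom_finprod) (use homogeneous_varD[OF p that] x in auto)
    also have "\<dots> = monomial_value L' (\<lambda>i. g (x i)) m"
      unfolding monomial_value_def
      by (rule L'.finprod_cong') (use homogeneous_varD[OF p that] x pow in auto)
    finally show ?thesis .
  qed
  have "g (eval_over h L p x) = (\<Oplus>\<^bsub>L'\<^esub>m\<in>Poly_Mapping.keys p.
      (g \<circ> (\<lambda>m. h (Poly_Mapping.lookup p m) \<otimes>\<^bsub>L\<^esub> monomial_value L x m)) m)"
    unfolding eval_over_monomial_value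
    by (rule g.hom_finsum) (use mem h' in auto)
  also have "\<dots> = (\<Oplus>\<^bsub>L'\<^esub>m\<in>Poly_Mapping.keys p. g (h (Poly_Mapping.lookup p m)) \<otimes>\<^bsub>L'\<^esub>
      monomial_value L' (\<lambda>i. g (x i)) m)"
    by (rule L'.finsum_cong') (use mem h' eq in \<open>auto simp flip: eq\<close>)
  finally show ?thesis unfolding eval_over_monomial_value .
qed

text \<open>The simplifier rewrites the exponent 1 to \<open>Suc 0\<close>, so this form is needed as well.\<close>

lemmas (in mpoly_eval) eval_var_Suc [simp] = eval_var[unfolded One_nat_def]

lemma a_inv_type_ring [simp]: "\<ominus>\<^bsub>type_ring\<^esub> x = - (x :: 'a::comm_ring_1)"
proof -
  interpret cring "type_ring :: 'a ring" ..
  show ?thesis using minus_equality[of "- x" x] by simp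
qed

lemma a_minus_type_ring [simp]: "x \<ominus>\<^bsub>type_ring\<^esub> y = x - (y :: 'a::comm_ring_1)"
  by (simp add: a_minus_def)

section \<open>Homogeneous polynomials\<close>

abbreviation Const :: "'a::comm_ring_1 \<Rightarrow> 'a mpoly" where
  "Const c \<equiv> Poly_Mapping.single 0 c"

abbreviation Var :: "nat \<Rightarrow> 'a::comm_ring_1 mpoly" where
  "Var i \<equiv> Poly_Mapping.single (Poly_Mapping.single i 1) 1"

lemma Const_hom: "Const \<in> ring_hom type_ring type_ring"
  by (simp add: ring_hom_type_ring_iff mult_single single_add)

lemma eval_over_type_ring:
  "eval_over h type_ring p x = (\<Sum>m\<in>Poly_Mapping.keys p. h (Poly_Mapping.lookup p m) *
     (\<Prod>i\<in>Poly_Mapping.keys m. x i ^ Poly_Mapping.lookup m i))"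
  by (simp add: eval_over_def)

text \<open>Summing exponents over a range that is the same for all monomials makes degrees additive.\<close>

lemma homogeneous_iff:
  "homogeneous n d p \<longleftrightarrow> (\<forall>m\<in>Poly_Mapping.keys p. Poly_Mapping.keys m \<subseteq> {..<n} \<and>
     (\<Sum>i<n. Poly_Mapping.lookup m i) = d)"
proof -
  have "(\<Sum>i\<in>Poly_Mapping.keys m. Poly_Mapping.lookup m i) = (\<Sum>i<n. Poly_Mapping.lookup m i)"
    if "Poly_Mapping.keys m \<subseteq> {..<n}" for m :: "nat \<Rightarrow>\<^sub>0 nat"
    by (rule sum.mono_neutral_left) (use that in \<open>auto simp: in_keys_iff\<close>)
  then show ?thesis unfolding homogeneous_def by auto
qed

lemma homogeneous_0 [simp]: "homogeneous n d 0"
  by (simp add: homogeneous_def)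

lemma homogeneous_add: "homogeneous n d p \<Longrightarrow> homogeneous n d q \<Longrightarrow> homogeneous n d (p + q)"
  using Poly_Mapping.keys_add[of p q] by (auto simp: homogeneous_iff)

lemma homogeneous_sum:
  "(\<And>i. i \<in> A \<Longrightarrow> homogeneous n d (f i)) \<Longrightarrow> homogeneous n d (\<Sum>i\<in>A. f i)"
  by (induct A rule: infinite_finite_induct) (auto intro: homogeneous_add)

lemma homogeneous_minus:
  fixes p q :: "'a::comm_ring_1 mpoly"
  assumes "homogeneous n d p" "homogeneous n d q"
  shows "homogeneous n d (p - q)"
proof -
  have "Poly_Mapping.keys (p - q) \<subseteq> Poly_Mapping.keys p \<union> Poly_Mapping.keys q"
    by (auto simp: in_keys_iff lookup_minus)
  with assms show ?thesis by (auto simp: homogeneous_iff)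
qed

lemma homogeneous_mult:
  assumes "homogeneous n d p" "homogeneous n e q"
  shows "homogeneous n (d + e) (p * q)"
  unfolding homogeneous_iff
proof
  fix m assume "m \<in> Poly_Mapping.keys (p * q)"
  then obtain a b where m: "m = a + b" "a \<in> Poly_Mapping.keys p" "b \<in> Poly_Mapping.keys q"
    using Poly_Mapping.keys_mult[of p q] by blast
  have "Poly_Mapping.keys m \<subseteq> Poly_Mapping.keys a \<union> Poly_Mapping.keys b"
    unfolding m by (rule Poly_Mapping.keys_add)
  moreover have "Poly_Mapping.keys a \<subseteq> {..<n}" "Poly_Mapping.keys b \<subseteq> {..<n}"
      "(\<Sum>i<n. Poly_Mapping.lookup a i) = d" "(\<Sum>i<n. Poly_Mapping.lookup b i) = e"
    using assms m by (auto simp: homogeneous_iff)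
  ultimately show "Poly_Mapping.keys m \<subseteq> {..<n} \<and> (\<Sum>i<n. Poly_Mapping.lookup m i) = d + e"
    by (auto simp: m(1) lookup_add sum.distrib)
qed

lemma homogeneous_Const [simp]: "homogeneous n 0 (Const c)"
  by (simp add: homogeneous_def)

lemma homogeneous_1 [simp]: "homogeneous n 0 (1 :: 'a::comm_semiring_1 mpoly)"
  by (simp add: homogeneous_def)

lemma homogeneous_Var [simp]: "i < n \<Longrightarrow> homogeneous n 1 (Var i)"
  by (simp add: homogeneous_def)

lemmas homogeneous_Var_Suc [simp] = homogeneous_Var[unfolded One_nat_def]

lemma homogeneous_Const_mult: "homogeneous n d p \<Longrightarrow> homogeneous n d (Const c * p)"
  using homogeneous_mult[OF homogeneous_Const] by fastforce

lemma homogeneous_power: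
  fixes p :: "'a::comm_semiring_1 mpoly"
  shows "homogeneous n d p \<Longrightarrow> homogeneous n (d * k) (p ^ k)"
  by (induct k) (auto dest: homogeneous_mult)

lemma homogeneous_prod:
  fixes f :: "'b \<Rightarrow> 'a::comm_semiring_1 mpoly"
  shows
  "(\<And>i. i \<in> A \<Longrightarrow> homogeneous n (e i) (f i)) \<Longrightarrow> homogeneous n (sum e A) (prod f A)"
  by (induct A rule: infinite_finite_induct) (auto intro: homogeneous_mult)

lemma homogeneous_eval_over:
  fixes p :: "'k::comm_ring_1 mpoly" and g :: "'k \<Rightarrow> 'a::comm_ring_1"
  assumes p: "homogeneous n d p" and q: "\<And>i. i < n \<Longrightarrow> homogeneous n' 1 (q i)"
  shows "homogeneous n' d (eval_over (\<lambda>a. Const (g a)) type_ring p q)"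
  unfolding eval_over_type_ring
proof (rule homogeneous_sum, rule homogeneous_Const_mult)
  fix m assume m: "m \<in> Poly_Mapping.keys p"
  have "homogeneous n' (1 * Poly_Mapping.lookup m i) (q i ^ Poly_Mapping.lookup m i)"
    if "i \<in> Poly_Mapping.keys m" for i
    by (rule homogeneous_power, rule q) (use homogeneous_varD[OF p m that] in auto)
  then have "homogeneous n' (\<Sum>i\<in>Poly_Mapping.keys m. Poly_Mapping.lookup m i)
      (\<Prod>i\<in>Poly_Mapping.keys m. q i ^ Poly_Mapping.lookup m i)"
    by (intro homogeneous_prod) auto
  then show "homogeneous n' d (\<Prod>i\<in>Poly_Mapping.keys m. q i ^ Poly_Mapping.lookup m i)"
    using p m by (simp add: homogeneous_def)
qed


section \<open>Polynomial identities over small sets of points\<close>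

text \<open>A polynomial whose exponents are smaller than \<open>card S\<close> and that vanishes on \<open>S\<^sup>n\<close> is zero:
  freeze all variables but the last, conclude that each coefficient of the resulting univariate
  polynomial vanishes, and apply induction to these coefficients. The monomials are arbitrary
  functions, distinguished by their first \<open>n\<close> values, so that the induction can keep the index set.\<close>

lemma coefficients_zero_if_vanishes:
  fixes c :: "(nat \<Rightarrow> nat) \<Rightarrow> 'a::field"
  assumes "finite A" "inj_on (\<lambda>a. restrict a {..<n}) A"
    and "\<And>a i. a \<in> A \<Longrightarrow> i < n \<Longrightarrow> a i \<le> D" and S: "D < card S"
    and "\<And>x. (\<And>i. x i \<in> S) \<Longrightarrow> (\<Sum>a\<in>A. c a * (\<Prod>i<n. x i ^ a i)) = 0"
    and "a \<in> A"
  shows "c a = 0"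
  using assms
proof (induct n arbitrary: A a)
  case 0
  have A: "A = {a}"
    using 0(2,6) by (auto simp: inj_on_def)
  from S obtain s where "s \<in> S" by fastforce
  then show ?case using 0(5)[of "\<lambda>_. s"] A by simp
next
  case (Suc n)
  let ?A = "{b \<in> A. b n = a n}"
  have inj: "inj_on (\<lambda>a. restrict a {..<n}) ?A"
  proof (rule inj_onI)
    fix b b' assume b: "b \<in> ?A" "b' \<in> ?A" "restrict b {..<n} = restrict b' {..<n}"
    then have "b i = b' i" if "i < n" for i
      using that by (metis lessThan_iff restrict_apply')
    with b have "b i = b' i" if "i < Suc n" for i
      using that by (cases "i = n") auto
    then have "restrict b {..<Suc n} = restrict b' {..<Suc n}"
      by (auto simp: restrict_def)
    then show "b = b'" using inj_onD[OF Suc(3)] b by blast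
  qed
  have zero: "(\<Sum>b\<in>?A. c b * (\<Prod>i<n. x i ^ b i)) = 0" if x: "\<And>i. x i \<in> S" for x
  proof -
    \<comment> \<open>the polynomial with the first \<open>n\<close> variables frozen at \<open>x\<close>\<close>
    define P where "P = (\<Sum>b\<in>A. monom (c b * (\<Prod>i<n. x i ^ b i)) (b n))"
    have "poly P t = 0" if "t \<in> S" for t
    proof -
      have "poly P t = (\<Sum>b\<in>A. c b * (\<Prod>i<Suc n. (x(n := t)) i ^ b i))"
        by (simp add: P_def poly_sum poly_monom mult.assoc)
      also have "\<dots> = 0"
        by (rule Suc(6)) (use x that in auto)
      finally show ?thesis .
    qed
    moreover have "degree P \<le> D"
      unfolding P_def by (intro degree_sum_le order.trans[OF degree_monom_le] Suc(2) Suc(4)) auto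
    moreover have "card S \<le> degree P" if "P \<noteq> 0"
      using card_mono[OF poly_roots_finite[OF that], of S] card_poly_roots_bound[OF that]
        \<open>\<And>t. t \<in> S \<Longrightarrow> poly P t = 0\<close> by fastforce
    ultimately have "P = 0" using S by fastforce
    then have "coeff P (a n) = 0" by simp
    moreover have "coeff P (a n) = (\<Sum>b\<in>A. if b n = a n then c b * (\<Prod>i<n. x i ^ b i) else 0)"
      by (simp add: P_def coeff_sum)
    ultimately show ?thesis
      using Suc(2) by (simp add: sum.inter_filter)
  qed
  show ?case
    by (rule Suc(1)[OF _ inj _ S zero]) (use Suc in auto)
qed

lemma homogeneous_eq_0_if_vanishes:
  fixes p :: "'a::field mpoly"
  assumes p: "homogeneous n d p" and S: "d < card S"
    and zero: "\<And>x. (\<And>i. x i \<in> S) \<Longrightarrow> eval_over id type_ring p x = 0"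
  shows "p = 0"
proof (rule ccontr)
  assume "p \<noteq> 0"
  then obtain m where m: "m \<in> Poly_Mapping.keys p"
    by (metis all_not_in_conv in_keys_iff lookup_zero poly_mapping_eqI)
  let ?A = "Poly_Mapping.lookup ` Poly_Mapping.keys p"
  let ?c = "\<lambda>a. Poly_Mapping.lookup p (Abs_poly_mapping a)"
  have keys: "Poly_Mapping.keys m \<subseteq> {..<n}" and deg: "(\<Sum>i<n. Poly_Mapping.lookup m i) = d"
    if "m \<in> Poly_Mapping.keys p" for m
    using p that by (auto simp: homogeneous_iff)
  have "?c (Poly_Mapping.lookup m) = 0"
  proof (rule coefficients_zero_if_vanishes[where c = ?c and a = "Poly_Mapping.lookup m"
        and A = ?A and n = n and D = d and S = S])
    show "inj_on (\<lambda>a. restrict a {..<n}) ?A"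
    proof (rule inj_onI, clarify)
      fix m m' assume m: "m \<in> Poly_Mapping.keys p" "m' \<in> Poly_Mapping.keys p"
        and eq: "restrict (Poly_Mapping.lookup m) {..<n} = restrict (Poly_Mapping.lookup m') {..<n}"
      have "Poly_Mapping.lookup m i = Poly_Mapping.lookup m' i" for i
      proof (cases "i < n")
        case True
        then show ?thesis using fun_cong[OF eq, of i] by simp
      next
        case False
        then have "i \<notin> Poly_Mapping.keys m" "i \<notin> Poly_Mapping.keys m'"
          using keys[OF m(1)] keys[OF m(2)] by auto
        then show ?thesis by (simp add: in_keys_iff)
      qed
      then show "Poly_Mapping.lookup m = Poly_Mapping.lookup m'" by (rule ext)
    qed
    show "a i \<le> d" if "a \<in> ?A" "i < n" for a i
    proof -
      obtain m where "m \<in> Poly_Mapping.keys p" "a = Poly_Mapping.lookup m"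
        using \<open>a \<in> ?A\<close> by auto
      then show ?thesis using deg[of m] member_le_sum[of i "{..<n}" a] \<open>i < n\<close> by simp
    qed
    show "(\<Sum>a\<in>?A. ?c a * (\<Prod>i<n. x i ^ a i)) = 0" if "\<And>i. x i \<in> S" for x
    proof -
      have "inj_on Poly_Mapping.lookup (Poly_Mapping.keys p)"
        by (simp add: inj_on_def lookup_inject)
      then have "(\<Sum>a\<in>?A. ?c a * (\<Prod>i<n. x i ^ a i)) =
          (\<Sum>m\<in>Poly_Mapping.keys p. Poly_Mapping.lookup p m * (\<Prod>i<n. x i ^ Poly_Mapping.lookup m i))"
        by (simp add: sum.reindex lookup_inverse)
      also have "\<dots> = eval_over id type_ring p x"
        unfolding eval_over_type_ring id_apply
      proof (rule sum.cong[OF refl])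
        fix m assume "m \<in> Poly_Mapping.keys p"
        then have "(\<Prod>i\<in>Poly_Mapping.keys m. x i ^ Poly_Mapping.lookup m i) =
            (\<Prod>i<n. x i ^ Poly_Mapping.lookup m i)"
          using keys by (intro prod.mono_neutral_left) (auto simp: in_keys_iff)
        then show "Poly_Mapping.lookup p m * (\<Prod>i<n. x i ^ Poly_Mapping.lookup m i) =
          Poly_Mapping.lookup p m * (\<Prod>i\<in>Poly_Mapping.keys m. x i ^ Poly_Mapping.lookup m i)" by simp
      qed
      finally show ?thesis using zero that by simp
    qed
  qed (use m S in auto)
  then show False using m by (simp add: lookup_inverse in_keys_iff)
qed

text \<open>The identity says that the polynomial \<open>c p(M x) - q(x)\<close> over the field \<open>'a\<close> vanishes on \<open>S\<^sup>n\<close>.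
  It is therefore the zero polynomial, and its image under \<open>\<sigma>\<close> vanishes everywhere. The embedding
  \<open>g\<close> is there because the coefficients of \<open>p\<close> and \<open>q\<close> lie in \<open>k\<close> whereas \<open>M\<close> and \<open>c\<close> may live in a
  larger field such as \<open>k(X)\<close>.\<close>

lemma linear_substitution_identity_transfer:
  fixes p q :: "'k::field mpoly" and g :: "'k \<Rightarrow> 'a::field" and \<sigma> :: "'a \<Rightarrow> 'l"
  assumes p: "homogeneous n' d p" and q: "homogeneous n d q"
    and g: "g \<in> ring_hom type_ring type_ring"
    and L: "cring L" and \<sigma>: "\<sigma> \<in> ring_hom type_ring L"
    and S: "d < card S"
    and id: "\<And>x. (\<And>j. x j \<in> S) \<Longrightarrow>
      c * eval_over g type_ring p (\<lambda>i. \<Sum>j<n. M i j * x j) = eval_over g type_ring q x"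
    and y: "\<And>j. j < n \<Longrightarrow> y j \<in> carrier L"
  shows "\<sigma> c \<otimes>\<^bsub>L\<^esub> eval_over (\<lambda>a. \<sigma> (g a)) L p (\<lambda>i. \<Oplus>\<^bsub>L\<^esub>j\<in>{..<n}. \<sigma> (M i j) \<otimes>\<^bsub>L\<^esub> y j) =
    eval_over (\<lambda>a. \<sigma> (g a)) L q y"
proof -
  let ?lin = "\<lambda>i. \<Sum>j<n. Const (M i j) * Var j"
  let ?g = "\<lambda>a. Const (g a)"
  have g': "?g \<in> ring_hom type_ring type_ring"
    using ring_hom_trans[OF g Const_hom] by (simp add: comp_def)
  define P where "P = Const c * eval_over ?g type_ring p ?lin - eval_over ?g type_ring q Var"
  have eval_P: "eval_over \<tau> R P z =
      \<tau> c \<otimes>\<^bsub>R\<^esub> eval_over (\<lambda>a. \<tau> (g a)) R p (\<lambda>i. \<Oplus>\<^bsub>R\<^esub>j\<in>{..<n}. \<tau> (M i j) \<otimes>\<^bsub>R\<^esub> z j)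
      \<ominus>\<^bsub>R\<^esub> eval_over (\<lambda>a. \<tau> (g a)) R q z"
    if R: "cring R" and \<tau>: "\<tau> \<in> ring_hom type_ring R" and z: "\<And>j. z j \<in> carrier R"
    for R :: "'r ring" and \<tau> z
  proof -
    interpret R: cring R by fact
    interpret E: mpoly_eval R \<tau> z by (rule mpoly_evalI) fact+
    have lin: "eval_over \<tau> R (?lin i) z = (\<Oplus>\<^bsub>R\<^esub>j\<in>{..<n}. \<tau> (M i j) \<otimes>\<^bsub>R\<^esub> z j)" for i
    proof -
      have "eval_over \<tau> R (finsum type_ring (\<lambda>j. Const (M i j) * Var j) {..<n}) z =
          (\<Oplus>\<^bsub>R\<^esub>j\<in>{..<n}. ((\<lambda>p. eval_over \<tau> R p z) \<circ> (\<lambda>j. Const (M i j) * Var j)) j)"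
        by (rule E.eval.hom_finsum) auto
      also have "\<dots> = (\<Oplus>\<^bsub>R\<^esub>j\<in>{..<n}. \<tau> (M i j) \<otimes>\<^bsub>R\<^esub> z j)"
        by (rule R.finsum_cong') (auto simp: E.eval_mult)
      finally show ?thesis by simp
    qed
    have "eval_over \<tau> R (eval_over ?g type_ring p ?lin) z =
        eval_over (\<lambda>a. \<tau> (g a)) R p (\<lambda>i. \<Oplus>\<^bsub>R\<^esub>j\<in>{..<n}. \<tau> (M i j) \<otimes>\<^bsub>R\<^esub> z j)"
      using eval_over_natural[OF cring_type_ring R E.eval_ring_hom g' p, of ?lin] lin by simp
    moreover have "eval_over \<tau> R (eval_over ?g type_ring q Var) z = eval_over (\<lambda>a. \<tau> (g a)) R q z"
      using eval_over_natural[OF cring_type_ring R E.eval_ring_hom g' q, of Var] E.eval_var by simp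
    moreover have "eval_over \<tau> R (a - b) z = eval_over \<tau> R a z \<ominus>\<^bsub>R\<^esub> eval_over \<tau> R b z" for a b
      using E.eval_add[of a "- b"] E.eval.hom_a_inv[of b] by (simp add: a_minus_def)
    ultimately show ?thesis by (simp add: P_def E.eval_mult)
  qed
  have "P = 0"
  proof (rule homogeneous_eq_0_if_vanishes[OF _ S])
    show "homogeneous n d P"
      unfolding P_def
      by (intro homogeneous_minus homogeneous_Const_mult homogeneous_eval_over[OF p]
          homogeneous_eval_over[OF q] homogeneous_sum) auto
    show "eval_over id type_ring P x = 0" if "\<And>i. x i \<in> S" for x
      using id[of x] that
      by (simp add: eval_P[OF cring_type_ring id_ring_hom])
  qed
  let ?y = "\<lambda>j. if j < n then y j else \<zero>\<^bsub>L\<^esub>"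
  interpret L: cring L by fact
  interpret E: mpoly_eval L \<sigma> ?y by (rule mpoly_evalI) (use L \<sigma> y in auto)
  have \<sigma>g: "(\<lambda>a. \<sigma> (g a)) \<in> ring_hom type_ring L"
    using ring_hom_trans[OF g \<sigma>] by (simp add: comp_def)
  have \<sigma>c: "\<sigma> a \<in> carrier L" for a using \<sigma> by (simp add: ring_hom_type_ring_iff)
  have lin: "(\<Oplus>\<^bsub>L\<^esub>j\<in>{..<n}. \<sigma> (M i j) \<otimes>\<^bsub>L\<^esub> ?y j) = (\<Oplus>\<^bsub>L\<^esub>j\<in>{..<n}. \<sigma> (M i j) \<otimes>\<^bsub>L\<^esub> y j)" for i
    by (rule L.finsum_cong') (use y \<sigma>c in auto)
  have lin': "(\<Oplus>\<^bsub>L\<^esub>j\<in>{..<n}. \<sigma> (M i j) \<otimes>\<^bsub>L\<^esub> y j) \<in> carrier L" for i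
    by (rule L.finsum_closed) (use y \<sigma>c in auto)
  have "eval_over \<sigma> L P ?y = \<zero>\<^bsub>L\<^esub>" using \<open>P = 0\<close> E.eval.hom_zero by simp
  then have "\<sigma> c \<otimes>\<^bsub>L\<^esub> eval_over (\<lambda>a. \<sigma> (g a)) L p (\<lambda>i. \<Oplus>\<^bsub>L\<^esub>j\<in>{..<n}. \<sigma> (M i j) \<otimes>\<^bsub>L\<^esub> ?y j) =
      eval_over (\<lambda>a. \<sigma> (g a)) L q ?y"
    using eval_P[OF L \<sigma>, of ?y] y \<sigma>c eval_over_closed[OF L \<sigma>g q, of ?y]
      eval_over_closed[OF L \<sigma>g p, of "\<lambda>i. \<Oplus>\<^bsub>L\<^esub>j\<in>{..<n}. \<sigma> (M i j) \<otimes>\<^bsub>L\<^esub> ?y j"] lin lin'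
    by (simp add: L.r_right_minus_eq)
  moreover have "eval_over (\<lambda>a. \<sigma> (g a)) L q ?y = eval_over (\<lambda>a. \<sigma> (g a)) L q y"
    by (rule eval_over_cong[OF L \<sigma>g q]) (use y in auto)
  ultimately show ?thesis by (simp add: lin)
qed

section \<open>Linear isomorphisms and matrices\<close>

text \<open>\<open>n\<close> columns and \<open>n'\<close> rows; the result is undefined outside \<open>{..<n'}\<close>, as are the elements
  of \<open>vecs L n'\<close>.\<close>

definition mat_apply ::
    "'l ring \<Rightarrow> nat \<Rightarrow> nat \<Rightarrow> (nat \<Rightarrow> nat \<Rightarrow> 'l) \<Rightarrow> (nat \<Rightarrow> 'l) \<Rightarrow> nat \<Rightarrow> 'l" where
  "mat_apply L n n' M x = (\<lambda>i\<in>{..<n'}. \<Oplus>\<^bsub>L\<^esub>j\<in>{..<n}. M i j \<otimes>\<^bsub>L\<^esub> x j)"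

text \<open>\<open>M\<close> has \<open>n'\<close> rows and \<open>n\<close> columns. Keeping \<open>n\<close> and \<open>n'\<close> apart makes it possible to compare two
  bases without knowing that they have the same size.\<close>

definition left_inverse_matrix ::
    "'l ring \<Rightarrow> nat \<Rightarrow> nat \<Rightarrow> (nat \<Rightarrow> nat \<Rightarrow> 'l) \<Rightarrow> (nat \<Rightarrow> nat \<Rightarrow> 'l) \<Rightarrow> bool" where
  "left_inverse_matrix L n n' N M \<longleftrightarrow>
     (\<forall>i<n'. \<forall>j<n. M i j \<in> carrier L) \<and> (\<forall>i<n. \<forall>j<n'. N i j \<in> carrier L) \<and>
     (\<forall>i<n. \<forall>l<n. (\<Oplus>\<^bsub>L\<^esub>j\<in>{..<n'}. N i j \<otimes>\<^bsub>L\<^esub> M j l) = (if i = l then \<one>\<^bsub>L\<^esub> else \<zero>\<^bsub>L\<^esub>))"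

definition linear_over ::
    "'l ring \<Rightarrow> nat \<Rightarrow> nat \<Rightarrow> ((nat \<Rightarrow> 'l) \<Rightarrow> nat \<Rightarrow> 'l) \<Rightarrow> bool" where
  "linear_over L n n' T \<longleftrightarrow> T \<in> vecs L n \<rightarrow> vecs L n' \<and>
     (\<forall>c\<in>carrier L. \<forall>x\<in>vecs L n. \<forall>y\<in>vecs L n.
        T (\<lambda>i\<in>{..<n}. c \<otimes>\<^bsub>L\<^esub> x i \<oplus>\<^bsub>L\<^esub> y i) = (\<lambda>i\<in>{..<n'}. c \<otimes>\<^bsub>L\<^esub> T x i \<oplus>\<^bsub>L\<^esub> T y i))"

definition inverse_linear ::
    "'l ring \<Rightarrow> nat \<Rightarrow> nat \<Rightarrow> ((nat \<Rightarrow> 'l) \<Rightarrow> nat \<Rightarrow> 'l) \<Rightarrow> ((nat \<Rightarrow> 'l) \<Rightarrow> nat \<Rightarrow> 'l) \<Rightarrow> bool" where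
  "inverse_linear L n n' T T' \<longleftrightarrow> linear_over L n n' T \<and> linear_over L n' n T' \<and>
     (\<forall>x\<in>vecs L n. T' (T x) = x) \<and> (\<forall>y\<in>vecs L n'. T (T' y) = y)"

lemma vecs_closed: "x \<in> vecs L n \<Longrightarrow> i < n \<Longrightarrow> x i \<in> carrier L"
  by (auto simp: vecs_def)

lemma restrict_vecs [simp]: "(\<lambda>i\<in>{..<n}. x i) \<in> vecs L n \<longleftrightarrow> (\<forall>i<n. x i \<in> carrier L)"
  by (auto simp: vecs_def PiE_iff)

lemma vecs_eqI: "x \<in> vecs L n \<Longrightarrow> y \<in> vecs L n \<Longrightarrow> (\<And>i. i < n \<Longrightarrow> x i = y i) \<Longrightarrow> x = y"
  by (auto simp: vecs_def intro: PiE_ext)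

lemma restrict_vecs_id: "x \<in> vecs L n \<Longrightarrow> (\<lambda>i\<in>{..<n}. x i) = x"
  by (auto simp: vecs_def)

lemma inverse_linear_sym: "inverse_linear L n n' T T' \<Longrightarrow> inverse_linear L n' n T' T"
  by (auto simp: inverse_linear_def)

lemma linear_over_comp:
  assumes "linear_over L n n' T" "linear_over L n' n'' U"
  shows "linear_over L n n'' (\<lambda>x. U (T x))"
  using assms unfolding linear_over_def by (auto simp: Pi_iff)

lemma inverse_linear_comp:
  assumes "inverse_linear L n n' T T'" "inverse_linear L n' n'' U U'"
  shows "inverse_linear L n n'' (\<lambda>x. U (T x)) (\<lambda>y. T' (U' y))"
  using assms unfolding inverse_linear_def
  by (auto intro: linear_over_comp) (auto simp: linear_over_def Pi_iff)

lemma inverse_linear_id: "inverse_linear L n n (\<lambda>x. x) (\<lambda>x. x)"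
  by (auto simp: inverse_linear_def linear_over_def)

text \<open>An explicit linear inverse is easier to compose and to extend to other fields than bijectivity.\<close>

lemma isomorphic_over_iff:
  assumes L: "cring L"
  shows "isomorphic_over L n f g \<longleftrightarrow>
    (\<exists>T T'. inverse_linear L n n T T' \<and> (\<forall>x\<in>vecs L n. f (T x) = g x))"
proof
  interpret L: cring L by fact
  assume "isomorphic_over L n f g"
  then obtain T where bij: "bij_betw T (vecs L n) (vecs L n)"
    and lin: "\<And>c x y. c \<in> carrier L \<Longrightarrow> x \<in> vecs L n \<Longrightarrow> y \<in> vecs L n \<Longrightarrow>
       T (\<lambda>i\<in>{..<n}. c \<otimes>\<^bsub>L\<^esub> x i \<oplus>\<^bsub>L\<^esub> y i) = (\<lambda>i\<in>{..<n}. c \<otimes>\<^bsub>L\<^esub> T x i \<oplus>\<^bsub>L\<^esub> T y i)"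
    and fg: "\<And>x. x \<in> vecs L n \<Longrightarrow> f (T x) = g x"
    unfolding isomorphic_over_def by blast
  define T' where "T' = inv_into (vecs L n) T"
  have T: "T x \<in> vecs L n" if "x \<in> vecs L n" for x
    using bij that by (auto simp: bij_betw_def)
  have T': "T' x \<in> vecs L n" "T (T' x) = x" if "x \<in> vecs L n" for x
    using bij that unfolding T'_def by (auto simp: bij_betw_def inv_into_into f_inv_into_f)
  have T'T: "T' (T x) = x" if "x \<in> vecs L n" for x
    using bij that unfolding T'_def by (simp add: bij_betw_def)
  have "T' (\<lambda>i\<in>{..<n}. c \<otimes>\<^bsub>L\<^esub> x i \<oplus>\<^bsub>L\<^esub> y i) = (\<lambda>i\<in>{..<n}. c \<otimes>\<^bsub>L\<^esub> T' x i \<oplus>\<^bsub>L\<^esub> T' y i)"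
    if "c \<in> carrier L" "x \<in> vecs L n" "y \<in> vecs L n" for c x y
  proof -
    let ?z = "\<lambda>i\<in>{..<n}. c \<otimes>\<^bsub>L\<^esub> T' x i \<oplus>\<^bsub>L\<^esub> T' y i"
    have "T ?z = (\<lambda>i\<in>{..<n}. c \<otimes>\<^bsub>L\<^esub> x i \<oplus>\<^bsub>L\<^esub> y i)"
      using lin[of c "T' x" "T' y"] T' that by simp
    moreover have "?z \<in> vecs L n"
      using T'(1)[OF that(2)] T'(1)[OF that(3)] that(1) by (auto dest: vecs_closed)
    ultimately show ?thesis using T'T[of ?z] by simp
  qed
  then have "inverse_linear L n n T T'"
    using T T' T'T lin by (auto simp: inverse_linear_def linear_over_def)
  then show "\<exists>T T'. inverse_linear L n n T T' \<and> (\<forall>x\<in>vecs L n. f (T x) = g x)"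
    using fg by blast
next
  assume "\<exists>T T'. inverse_linear L n n T T' \<and> (\<forall>x\<in>vecs L n. f (T x) = g x)"
  then obtain T T' where T: "inverse_linear L n n T T'" "\<forall>x\<in>vecs L n. f (T x) = g x" by blast
  then have "bij_betw T (vecs L n) (vecs L n)"
    by (intro bij_betw_byWitness[where f' = T']) (auto simp: inverse_linear_def linear_over_def)
  then show "isomorphic_over L n f g"
    using T unfolding isomorphic_over_def inverse_linear_def linear_over_def by blast
qed

text \<open>\<open>vecs\<close> and \<open>isomorphic_over\<close> take ring records without further fields; the locale fixes this
  record type.\<close>

locale plain_cring = cring R for R :: "'a ring" (structure)
begin

lemma finsum_swap:
  assumes "finite A" "finite B" "\<And>i j. i \<in> A \<Longrightarrow> j \<in> B \<Longrightarrow> f i j \<in> carrier R"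
  shows "(\<Oplus>i\<in>A. \<Oplus>j\<in>B. f i j) = (\<Oplus>j\<in>B. \<Oplus>i\<in>A. f i j)"
  using assms(1,3)
proof (induct A)
  case empty
  then show ?case using assms(2) by simp
next
  case (insert a A)
  have c: "f a \<in> B \<rightarrow> carrier R" "(\<lambda>j. \<Oplus>i\<in>A. f i j) \<in> B \<rightarrow> carrier R"
    using insert by (auto intro!: finsum_closed)
  have "(\<Oplus>i\<in>insert a A. \<Oplus>j\<in>B. f i j) = (\<Oplus>j\<in>B. f a j) \<oplus> (\<Oplus>j\<in>B. \<Oplus>i\<in>A. f i j)"
    using insert by (subst finsum_insert) (auto intro!: finsum_closed)
  also have "\<dots> = (\<Oplus>j\<in>B. f a j \<oplus> (\<Oplus>i\<in>A. f i j))"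
    using finsum_addf[OF c] by simp
  also have "\<dots> = (\<Oplus>j\<in>B. \<Oplus>i\<in>insert a A. f i j)"
    by (rule finsum_cong') (use insert in \<open>auto intro!: finsum_closed finsum_insert[symmetric]\<close>)
  finally show ?case .
qed

lemma finsum_delta:
  fixes l n :: nat
  assumes "l < n" "\<And>j. j < n \<Longrightarrow> x j \<in> carrier R"
  shows "(\<Oplus>j\<in>{..<n}. (if l = j then \<one> else \<zero>) \<otimes> x j) = x l"
proof -
  have "(\<Oplus>j\<in>{..<n}. (if l = j then \<one> else \<zero>) \<otimes> x j) = (\<Oplus>j\<in>{..<n}. if l = j then x j else \<zero>)"
    by (rule finsum_cong') (use assms in auto)
  also have "\<dots> = x l"
    by (rule finsum_singleton) (use assms in auto)
  finally show ?thesis .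
qed

lemma mat_apply_closed:
  assumes "\<And>i j. i < n' \<Longrightarrow> j < n \<Longrightarrow> M i j \<in> carrier R" "\<And>j. j < n \<Longrightarrow> x j \<in> carrier R"
  shows "mat_apply R n n' M x \<in> vecs R n'"
  using assms by (auto simp: mat_apply_def intro!: finsum_closed)

lemma mat_apply_linear:
  assumes M: "\<And>i j. i < n' \<Longrightarrow> j < n \<Longrightarrow> M i j \<in> carrier R"
  shows "linear_over R n n' (mat_apply R n n' M)"
proof -
  have "(\<Oplus>j\<in>{..<n}. M i j \<otimes> restrict (\<lambda>i. c \<otimes> x i \<oplus> y i) {..<n} j) =
      c \<otimes> (\<Oplus>j\<in>{..<n}. M i j \<otimes> x j) \<oplus> (\<Oplus>j\<in>{..<n}. M i j \<otimes> y j)"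
    if i: "i < n'" and c: "c \<in> carrier R" and x: "x \<in> vecs R n" and y: "y \<in> vecs R n" for i c x y
  proof -
    note closed = M[OF i] c vecs_closed[OF x] vecs_closed[OF y]
    have "(\<Oplus>j\<in>{..<n}. M i j \<otimes> restrict (\<lambda>i. c \<otimes> x i \<oplus> y i) {..<n} j) =
        (\<Oplus>j\<in>{..<n}. c \<otimes> (M i j \<otimes> x j) \<oplus> M i j \<otimes> y j)"
      by (rule finsum_cong') (use closed in \<open>auto simp: r_distr m_lcomm\<close>)
    also have "\<dots> = (\<Oplus>j\<in>{..<n}. c \<otimes> (M i j \<otimes> x j)) \<oplus> (\<Oplus>j\<in>{..<n}. M i j \<otimes> y j)"
      by (rule finsum_addf) (use closed in auto)
    also have "(\<Oplus>j\<in>{..<n}. c \<otimes> (M i j \<otimes> x j)) = c \<otimes> (\<Oplus>j\<in>{..<n}. M i j \<otimes> x j)"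
      by (rule finsum_rdistr[symmetric]) (use closed in auto)
    finally show ?thesis .
  qed
  then show ?thesis
    using M by (auto simp: linear_over_def vecs_closed intro!: mat_apply_closed)
      (auto simp: mat_apply_def restrict_def fun_eq_iff)
qed

lemma mat_apply_left_inverse:
  assumes "left_inverse_matrix R n n' N M" and x: "x \<in> vecs R n"
  shows "mat_apply R n' n N (mat_apply R n n' M x) = x"
proof (rule vecs_eqI)
  have M: "\<And>i j. i < n' \<Longrightarrow> j < n \<Longrightarrow> M i j \<in> carrier R"
    and N: "\<And>i j. i < n \<Longrightarrow> j < n' \<Longrightarrow> N i j \<in> carrier R"
    and NM: "\<And>i l. i < n \<Longrightarrow> l < n \<Longrightarrow> (\<Oplus>j\<in>{..<n'}. N i j \<otimes> M j l) = (if i = l then \<one> else \<zero>)"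
    using assms by (auto simp: left_inverse_matrix_def)
  note xc = vecs_closed[OF x]
  have y: "mat_apply R n n' M x \<in> vecs R n'" using M xc by (intro mat_apply_closed)
  show "mat_apply R n' n N (mat_apply R n n' M x) \<in> vecs R n"
    using N vecs_closed[OF y] by (intro mat_apply_closed)
  show "mat_apply R n' n N (mat_apply R n n' M x) i = x i" if i: "i < n" for i
  proof -
    have "mat_apply R n' n N (mat_apply R n n' M x) i =
        (\<Oplus>j\<in>{..<n'}. N i j \<otimes> mat_apply R n n' M x j)"
      using i by (simp add: mat_apply_def)
    also have "\<dots> = (\<Oplus>j\<in>{..<n'}. \<Oplus>l\<in>{..<n}. N i j \<otimes> (M j l \<otimes> x l))"
    proof (rule finsum_cong')
      fix j assume "j \<in> {..<n'}"
      then show "N i j \<otimes> mat_apply R n n' M x j = (\<Oplus>l\<in>{..<n}. N i j \<otimes> (M j l \<otimes> x l))"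
        using N[OF i, of j] M[of j] xc by (simp add: mat_apply_def finsum_rdistr Pi_def)
    qed (use N[OF i] M xc in \<open>auto intro!: finsum_closed\<close>)
    also have "\<dots> = (\<Oplus>l\<in>{..<n}. \<Oplus>j\<in>{..<n'}. N i j \<otimes> (M j l \<otimes> x l))"
      by (rule finsum_swap) (use N[OF i] M xc in auto)
    also have "\<dots> = (\<Oplus>l\<in>{..<n}. (if i = l then \<one> else \<zero>) \<otimes> x l)"
    proof (rule finsum_cong')
      fix l assume "l \<in> {..<n}"
      then have l: "l < n" by simp
      have "(\<Oplus>j\<in>{..<n'}. N i j \<otimes> (M j l \<otimes> x l)) = (\<Oplus>j\<in>{..<n'}. N i j \<otimes> M j l \<otimes> x l)"
        by (rule finsum_cong') (use N[OF i] M l xc in \<open>auto simp: m_assoc\<close>)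
      also have "\<dots> = (\<Oplus>j\<in>{..<n'}. N i j \<otimes> M j l) \<otimes> x l"
        by (rule finsum_ldistr[symmetric]) (use N[OF i] M l xc in auto)
      finally show "(\<Oplus>j\<in>{..<n'}. N i j \<otimes> (M j l \<otimes> x l)) = (if i = l then \<one> else \<zero>) \<otimes> x l"
        using NM[OF i l] by simp
    qed (use xc in auto)
    also have "\<dots> = x i"
      by (rule finsum_delta) (use i xc in auto)
    finally show ?thesis .
  qed
qed (fact x)

lemma inverse_matrices_inverse_linear:
  assumes "left_inverse_matrix R n n' N M" "left_inverse_matrix R n' n M N"
  shows "inverse_linear R n n' (mat_apply R n n' M) (mat_apply R n' n N)"
  using assms mat_apply_left_inverse[OF assms(1)] mat_apply_left_inverse[OF assms(2)]
  unfolding inverse_linear_def by (auto intro!: mat_apply_linear simp: left_inverse_matrix_def)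

text \<open>A vector is built up from the zero vector by adding one coordinate at a time; linearity is only
  given in the combined form \<open>c x + y\<close>, so \<open>T 0 = 0\<close> comes from \<open>T 0 = 1 T 0 + T 0\<close>.\<close>

lemma linear_over_mat_apply:
  assumes T: "linear_over R n n' T" and x: "x \<in> vecs R n"
  defines "M \<equiv> \<lambda>i j. T (\<lambda>l\<in>{..<n}. if l = j then \<one> else \<zero>) i"
  shows "T x = mat_apply R n n' M x"
proof -
  have Tc: "T x \<in> vecs R n'" if "x \<in> vecs R n" for x
    using T that by (auto simp: linear_over_def)
  have lin: "T (\<lambda>i\<in>{..<n}. c \<otimes> x i \<oplus> y i) i = c \<otimes> T x i \<oplus> T y i"
    if "c \<in> carrier R" "x \<in> vecs R n" "y \<in> vecs R n" "i < n'" for c x y i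
    using T that unfolding linear_over_def by simp
  have Mc: "M i j \<in> carrier R" if "i < n'" for i j
    unfolding M_def by (rule vecs_closed[OF Tc that]) auto
  note xc = vecs_closed[OF x]
  have "T (\<lambda>i\<in>{..<n}. if i < k then x i else \<zero>) i = (\<Oplus>j\<in>{..<k}. M i j \<otimes> x j)"
    if "k \<le> n" "i < n'" for k i
    using that(1)
  proof (induct k)
    case 0
    let ?z = "(\<lambda>i\<in>{..<n}. \<zero>) :: nat \<Rightarrow> 'a"
    have z: "?z \<in> vecs R n" by simp
    have "(\<lambda>i\<in>{..<n}. \<one> \<otimes> ?z i \<oplus> ?z i) = ?z" by (auto simp: restrict_def)
    then have "T ?z i = T ?z i \<oplus> T ?z i"
      using lin[OF _ z z that(2), of \<one>] vecs_closed[OF Tc[OF z] that(2)] by simp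
    then have "T ?z i = \<zero>"
      using vecs_closed[OF Tc[OF z] that(2)] by (metis add.l_cancel_one')
    then show ?case by (simp del: restrict_apply add: restrict_def)
  next
    case (Suc k)
    let ?e = "\<lambda>l\<in>{..<n}. if l = k then \<one> else \<zero>"
    let ?v = "\<lambda>i\<in>{..<n}. if i < k then x i else \<zero>"
    have "(\<lambda>i\<in>{..<n}. if i < Suc k then x i else \<zero>) = (\<lambda>i\<in>{..<n}. x k \<otimes> ?e i \<oplus> ?v i)"
      using Suc(2) xc by (auto simp: restrict_def less_Suc_eq)
    then have "T (\<lambda>i\<in>{..<n}. if i < Suc k then x i else \<zero>) i = x k \<otimes> T ?e i \<oplus> T ?v i"
      using lin[of "x k" ?e ?v i] xc Suc(2) that(2) by simp
    also have "T ?e i = M i k" by (simp only: M_def)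
    also have "T ?v i = (\<Oplus>j\<in>{..<k}. M i j \<otimes> x j)"
      by (rule Suc(1)) (use Suc(2) in simp)
    also have "x k \<otimes> M i k = M i k \<otimes> x k"
      using Suc(2) xc Mc[OF that(2), of k] by (simp add: m_comm)
    also have "M i k \<otimes> x k \<oplus> (\<Oplus>j\<in>{..<k}. M i j \<otimes> x j) = (\<Oplus>j\<in>{..<Suc k}. M i j \<otimes> x j)"
      unfolding lessThan_Suc
      by (rule finsum_insert[symmetric]) (use Suc(2) xc Mc[OF that(2)] in auto)
    finally show ?case .
  qed
  from this[of n] have "T x i = (\<Oplus>j\<in>{..<n}. M i j \<otimes> x j)" if "i < n'" for i
    using that restrict_vecs_id[OF x] by (simp cong: restrict_cong)
  then show ?thesis
    by (intro vecs_eqI[of _ R n'])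
      (use Tc[OF x] Mc xc in \<open>auto simp: mat_apply_def intro!: finsum_closed\<close>)
qed

lemma inverse_linear_matrices:
  assumes "inverse_linear R n n' T T'"
  obtains M N where "left_inverse_matrix R n n' N M" "left_inverse_matrix R n' n M N"
    "\<And>x. x \<in> vecs R n \<Longrightarrow> T x = mat_apply R n n' M x"
proof -
  have half: "left_inverse_matrix R n n' (\<lambda>i j. T' (\<lambda>l\<in>{..<n'}. if l = j then \<one> else \<zero>) i)
      (\<lambda>i j. T (\<lambda>l\<in>{..<n}. if l = j then \<one> else \<zero>) i)"
    (is "left_inverse_matrix R n n' ?N ?M")
    if "inverse_linear R n n' T T'" for n n' T T'
  proof -
    from that have T: "linear_over R n n' T" and T': "linear_over R n' n T'"
      and T'T: "\<And>x. x \<in> vecs R n \<Longrightarrow> T' (T x) = x"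
      by (auto simp: inverse_linear_def)
    have e: "(\<lambda>l\<in>{..<m}. if l = j then \<one> else \<zero>) \<in> vecs R m" for m j by simp
    have Tc: "T (\<lambda>l\<in>{..<n}. if l = j then \<one> else \<zero>) \<in> vecs R n'"
      and T'c: "T' (\<lambda>l\<in>{..<n'}. if l = j then \<one> else \<zero>) \<in> vecs R n" for j
      using T T' e unfolding linear_over_def by (metis (no_types, lifting) Pi_mem)+
    have "(\<Oplus>j\<in>{..<n'}. ?N i j \<otimes> ?M j l) = (if i = l then \<one> else \<zero>)" if "i < n" for i l
    proof -
      have "(\<Oplus>j\<in>{..<n'}. ?N i j \<otimes> ?M j l) = T' (T (\<lambda>k\<in>{..<n}. if k = l then \<one> else \<zero>)) i"
        using linear_over_mat_apply[OF T' Tc] that by (simp add: mat_apply_def)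
      then show ?thesis using T'T[OF e] that by simp
    qed
    then show ?thesis
      using vecs_closed[OF Tc] vecs_closed[OF T'c] by (auto simp: left_inverse_matrix_def)
  qed
  show thesis
    using that[OF half[OF assms] half[OF inverse_linear_sym[OF assms]]] linear_over_mat_apply assms
    by (auto simp: inverse_linear_def)
qed

end

text \<open>This is the reason for working with matrices: unlike a bijection, an inverse pair of matrices can
  be moved along a ring homomorphism.\<close>

lemma left_inverse_matrix_hom:
  assumes L: "cring L" and K: "cring K" and \<sigma>: "\<sigma> \<in> ring_hom L K"
    and NM: "left_inverse_matrix L n n' N M"
  shows "left_inverse_matrix K n n' (\<lambda>i j. \<sigma> (N i j)) (\<lambda>i j. \<sigma> (M i j))"
proof -
  interpret L: cring L by fact
  interpret K: cring K by fact
  interpret \<sigma>: ring_hom_cring L K \<sigma> by unfold_locales fact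
  have M: "\<And>i j. i < n' \<Longrightarrow> j < n \<Longrightarrow> M i j \<in> carrier L"
    and N: "\<And>i j. i < n \<Longrightarrow> j < n' \<Longrightarrow> N i j \<in> carrier L"
    and id: "\<And>i l. i < n \<Longrightarrow> l < n \<Longrightarrow>
      (\<Oplus>\<^bsub>L\<^esub>j\<in>{..<n'}. N i j \<otimes>\<^bsub>L\<^esub> M j l) = (if i = l then \<one>\<^bsub>L\<^esub> else \<zero>\<^bsub>L\<^esub>)"
    using NM by (auto simp: left_inverse_matrix_def)
  have "(\<Oplus>\<^bsub>K\<^esub>j\<in>{..<n'}. \<sigma> (N i j) \<otimes>\<^bsub>K\<^esub> \<sigma> (M j l)) = \<sigma> (\<Oplus>\<^bsub>L\<^esub>j\<in>{..<n'}. N i j \<otimes>\<^bsub>L\<^esub> M j l)"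
    if "i < n" "l < n" for i l
    by (subst \<sigma>.hom_finsum) (use M N that in \<open>auto intro!: K.finsum_cong'\<close>)
  then show ?thesis using M N id by (auto simp: left_inverse_matrix_def)
qed

lemma mat_apply_hom:
  assumes L: "cring L" and K: "cring K" and \<sigma>: "\<sigma> \<in> ring_hom L K"
    and M: "\<And>i j. i < n' \<Longrightarrow> j < n \<Longrightarrow> M i j \<in> carrier L"
    and x: "\<And>j. j < n \<Longrightarrow> x j \<in> carrier L" and i: "i < n'"
  shows "\<sigma> (mat_apply L n n' M x i) = mat_apply K n n' (\<lambda>i j. \<sigma> (M i j)) (\<lambda>j. \<sigma> (x j)) i"
proof -
  interpret L: cring L by fact
  interpret K: cring K by fact
  interpret \<sigma>: ring_hom_cring L K \<sigma> by unfold_locales fact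
  have "\<sigma> (\<Oplus>\<^bsub>L\<^esub>j\<in>{..<n}. M i j \<otimes>\<^bsub>L\<^esub> x j) =
      (\<Oplus>\<^bsub>K\<^esub>j\<in>{..<n}. (\<sigma> \<circ> (\<lambda>j. M i j \<otimes>\<^bsub>L\<^esub> x j)) j)"
    by (rule \<sigma>.hom_finsum) (use M[OF i] x in auto)
  also have "\<dots> = (\<Oplus>\<^bsub>K\<^esub>j\<in>{..<n}. \<sigma> (M i j) \<otimes>\<^bsub>K\<^esub> \<sigma> (x j))"
    by (rule K.finsum_cong') (use M[OF i] x in auto)
  finally show ?thesis using i by (simp add: mat_apply_def)
qed

section \<open>Coordinates\<close>

text \<open>The condition in terms of coordinate vectors replaces the library notions for sets of vectors;
  injectivity is part of the uniqueness of coordinates.\<close>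

lemma is_basis_iff:
  fixes scale :: "'k::field \<Rightarrow> 'v::ab_group_add \<Rightarrow> 'v"
  assumes "vector_space scale"
  shows "is_basis scale V n b \<longleftrightarrow>
    (\<forall>x. (\<Sum>i<n. scale (x i) (b i)) = 0 \<longrightarrow> (\<forall>i<n. x i = 0)) \<and>
    V = range (\<lambda>x. \<Sum>i<n. scale (x i) (b i))"
proof -
  interpret vector_space scale by fact
  let ?s = "\<lambda>x. \<Sum>i<n. scale (x i) (b i)"
  have inj: "inj_on b {..<n}" if *: "\<And>x i. ?s x = 0 \<Longrightarrow> i < n \<Longrightarrow> x i = 0"
  proof (rule inj_onI, rule ccontr)
    fix i j assume ij: "i \<in> {..<n}" "j \<in> {..<n}" "b i = b j" "i \<noteq> j"
    \<comment> \<open>the relation \<open>b i - b j = 0\<close> would be nontrivial\<close>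
    let ?x = "\<lambda>k. (if k = i then 1 else 0) - (if k = j then 1 else 0)"
    have "?s ?x = (\<Sum>k<n. if k = i then b k else 0) - (\<Sum>k<n. if k = j then b k else 0)"
      unfolding sum_subtractf[symmetric] by (rule sum.cong) (auto simp: scale_left_diff_distrib)
    also have "\<dots> = 0" using ij by simp
    finally show False using *[of ?x i] ij by simp
  qed
  have sum: "(\<Sum>v\<in>b ` {..<n}. scale (u v) v) = ?s (\<lambda>i. u (b i))" if "inj_on b {..<n}" for u
    using that by (simp add: sum.reindex)
  have sum': "?s x = (\<Sum>v\<in>b ` {..<n}. scale (x (inv_into {..<n} b v)) v)"
    if "inj_on b {..<n}" for x
    using that by (simp add: sum.reindex)
  have span: "span (b ` {..<n}) = range ?s" if inj: "inj_on b {..<n}"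
    unfolding span_finite[OF finite_imageI[OF finite_lessThan]]
  proof (intro equalityI subsetI; elim rangeE)
    fix v u assume "v = (\<Sum>v\<in>b ` {..<n}. scale (u v) v)"
    then show "v \<in> range ?s" by (simp only: sum[OF inj]) (rule rangeI)
  next
    fix v x assume "v = ?s x"
    then show "v \<in> range (\<lambda>u. \<Sum>v\<in>b ` {..<n}. scale (u v) v)"
      by (simp only: sum'[OF inj]) (rule rangeI)
  qed
  have dep: "dependent (b ` {..<n}) \<longleftrightarrow> (\<exists>x. ?s x = 0 \<and> (\<exists>i<n. x i \<noteq> 0))"
    if inj: "inj_on b {..<n}"
  proof
    assume "dependent (b ` {..<n})"
    then obtain u v where "v \<in> b ` {..<n}" "u v \<noteq> 0" "(\<Sum>v\<in>b ` {..<n}. scale (u v) v) = 0"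
      by (auto simp: dependent_finite)
    then show "\<exists>x. ?s x = 0 \<and> (\<exists>i<n. x i \<noteq> 0)"
      using sum[OF inj, of u] by (intro exI[of _ "\<lambda>i. u (b i)"]) auto
  next
    assume "\<exists>x. ?s x = 0 \<and> (\<exists>i<n. x i \<noteq> 0)"
    then obtain x i where "?s x = 0" "i < n" "x i \<noteq> 0" by blast
    then show "dependent (b ` {..<n})"
      using sum'[OF inj, of x] inj
      by (auto simp: dependent_finite intro!: exI[of _ "\<lambda>v. x (inv_into {..<n} b v)"])
  qed
  show ?thesis unfolding is_basis_def using inj span dep by blast
qed

lemma sum_scale_linear_combination:
  fixes scale :: "'k::field \<Rightarrow> 'v::ab_group_add \<Rightarrow> 'v"
  assumes "vector_space scale" and b': "\<And>j. j < n' \<Longrightarrow> b' j = (\<Sum>i<n. scale (M i j) (b i))"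
  shows "(\<Sum>j<n'. scale (x j) (b' j)) = (\<Sum>i<n. scale (\<Sum>j<n'. M i j * x j) (b i))"
proof -
  interpret vector_space scale by fact
  have "(\<Sum>j<n'. scale (x j) (b' j)) = (\<Sum>j<n'. \<Sum>i<n. scale (M i j * x j) (b i))"
    by (rule sum.cong) (auto simp: b' scale_sum_right mult.commute)
  also have "\<dots> = (\<Sum>i<n. \<Sum>j<n'. scale (M i j * x j) (b i))"
    by (rule sum.swap)
  finally show ?thesis by (simp add: scale_sum_left)
qed

lemma basis_expand:
  fixes scale :: "'k::field \<Rightarrow> 'v::ab_group_add \<Rightarrow> 'v"
  assumes "vector_space scale" "is_basis scale V n b" "is_basis scale V n' b'"
  obtains M where "\<And>j. j < n' \<Longrightarrow> b' j = (\<Sum>i<n. scale (M i j) (b i))"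
proof -
  interpret vector_space scale by fact
  have "\<exists>x. b' j = (\<Sum>i<n. scale (x i) (b i))" if "j < n'" for j
  proof -
    have "(\<Sum>i<n'. scale (if i = j then 1 else 0) (b' i)) = (\<Sum>i<n'. if i = j then b' i else 0)"
      by (rule sum.cong) auto
    then have "b' j = (\<Sum>i<n'. scale (if i = j then 1 else 0) (b' i))" using that by simp
    then have "b' j \<in> V" using assms(3) by (auto simp: is_basis_iff[OF assms(1)])
    then show ?thesis using assms(2) by (auto simp: is_basis_iff[OF assms(1)])
  qed
  then have "\<exists>f. \<forall>j. j < n' \<longrightarrow> b' j = (\<Sum>i<n. scale (f j i) (b i))"
    by (intro choice) blast
  then obtain f where "\<forall>j. j < n' \<longrightarrow> b' j = (\<Sum>i<n. scale (f j i) (b i))" ..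
  then show thesis using that[of "\<lambda>i j. f j i"] by blast
qed

lemma change_of_basis_left_inverse:
  fixes scale :: "'k::field \<Rightarrow> 'v::ab_group_add \<Rightarrow> 'v"
  assumes vs: "vector_space scale" and b': "is_basis scale V n' b'"
    and M: "\<And>j. j < n' \<Longrightarrow> b' j = (\<Sum>i<n. scale (M i j) (b i))"
    and N: "\<And>j. j < n \<Longrightarrow> b j = (\<Sum>i<n'. scale (N i j) (b' i))"
  shows "left_inverse_matrix type_ring n' n N M"
proof -
  interpret vector_space scale by fact
  have "(\<Sum>j<n. N i j * M j l) = (if i = l then 1 else 0)" if "i < n'" "l < n'" for i l
  proof -
    have "(\<Sum>i<n'. scale (if i = l then 1 else 0) (b' i)) = (\<Sum>i<n'. if i = l then b' i else 0)"
      by (rule sum.cong) auto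
    then have "(\<Sum>i<n'. scale (if i = l then 1 else 0) (b' i)) = b' l" using that by simp
    also have "\<dots> = (\<Sum>j<n. scale (M j l) (b j))" using M that by simp
    also have "\<dots> = (\<Sum>i<n'. scale (\<Sum>j<n. N i j * M j l) (b' i))"
      by (rule sum_scale_linear_combination[OF vs N])
    finally have "(\<Sum>i<n'. scale ((\<Sum>j<n. N i j * M j l) - (if i = l then 1 else 0)) (b' i)) = 0"
      by (simp add: scale_left_diff_distrib sum_subtractf)
    moreover have "\<forall>i<n'. x i = 0" if "(\<Sum>i<n'. scale (x i) (b' i)) = 0" for x
      using b' that unfolding is_basis_iff[OF vs] by blast
    ultimately have "(\<Sum>j<n. N i j * M j l) - (if i = l then 1 else 0) = 0"
      using \<open>i < n'\<close> by meson
    then show ?thesis by simp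
  qed
  then show ?thesis by (simp add: left_inverse_matrix_def)
qed

lemma card_of_nat_image:
  assumes "CHAR('k::field) = 0 \<or> CHAR('k) > d"
  shows "card ((of_nat :: nat \<Rightarrow> 'k) ` {..d}) = Suc d"
proof -
  have "i = j" if "i \<le> j" "j \<le> d" "(of_nat i :: 'k) = of_nat j" for i j
  proof -
    have "(of_nat (j - i) :: 'k) = 0" using that by (simp add: of_nat_diff)
    then have "CHAR('k) dvd j - i" by (simp add: of_nat_eq_0_iff_char_dvd)
    then show ?thesis using assms that
      by (metis diff_is_0_eq diff_le_self dvd_imp_le dual_order.trans dvd_0_left_iff gr0I leD
          le_antisym)
  qed
  then have "inj_on (of_nat :: nat \<Rightarrow> 'k) {..d}"
    by (intro inj_onI) (metis atMost_iff nat_le_linear)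
  then show ?thesis by (simp add: card_image)
qed

lemma field_extensionD:
  assumes "field_extension h L"
  shows "field L" "cring L" "h \<in> ring_hom type_ring L"
  using assms by (auto simp: field_extension_def field_def domain_def)

text \<open>The polynomials of a form in two bases agree up to a linear substitution as functions on
  \<open>k\<^sup>n\<close>. Since \<open>k\<close> has more than \<open>d\<close> elements they agree as polynomials, hence also over every
  extension field.\<close>

lemma coordinates_change:
  fixes scale :: "'k::field \<Rightarrow> 'v::ab_group_add \<Rightarrow> 'v"
  assumes vs: "vector_space scale" and char: "CHAR('k) = 0 \<or> CHAR('k) > d"
    and c: "coordinates scale d V \<phi> n b p" and c': "coordinates scale d V \<phi> n' b' p'"
    and ext: "field_extension h L"
  obtains U U' where "inverse_linear L n' n U U'"
    "\<And>y. y \<in> vecs L n' \<Longrightarrow> eval_over h L p (U y) = eval_over h L p' y"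
proof -
  note L = field_extensionD[OF ext]
  interpret L: plain_cring L unfolding plain_cring_def by (rule L(2))
  have b: "is_basis scale V n b" and p: "homogeneous n d p"
    and \<phi>: "\<And>x. \<phi> (\<Sum>i<n. scale (x i) (b i)) = eval_over id type_ring p x"
    using c by (auto simp: coordinates_def)
  have b': "is_basis scale V n' b'" and p': "homogeneous n' d p'"
    and \<phi>': "\<And>x. \<phi> (\<Sum>i<n'. scale (x i) (b' i)) = eval_over id type_ring p' x"
    using c' by (auto simp: coordinates_def)
  obtain M where M: "\<And>j. j < n' \<Longrightarrow> b' j = (\<Sum>i<n. scale (M i j) (b i))"
    by (rule basis_expand[OF vs b b']) blast
  obtain N where N: "\<And>j. j < n \<Longrightarrow> b j = (\<Sum>i<n'. scale (N i j) (b' i))"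
    by (rule basis_expand[OF vs b' b]) blast
  let ?M = "\<lambda>i j. h (M i j)" and ?N = "\<lambda>i j. h (N i j)"
  have hc: "h a \<in> carrier L" for a using L(3) by (simp add: ring_hom_type_ring_iff)
  have inv: "inverse_linear L n' n (mat_apply L n' n ?M) (mat_apply L n n' ?N)"
    using L.inverse_matrices_inverse_linear
      left_inverse_matrix_hom[OF cring_type_ring L(2,3) change_of_basis_left_inverse[OF vs b' M N]]
      left_inverse_matrix_hom[OF cring_type_ring L(2,3) change_of_basis_left_inverse[OF vs b N M]]
    by blast
  have "eval_over h L p (mat_apply L n' n ?M y) = eval_over h L p' y" if y: "y \<in> vecs L n'" for y
  proof -
    have "h 1 \<otimes>\<^bsub>L\<^esub> eval_over (\<lambda>a. h (id a)) L p (\<lambda>i. \<Oplus>\<^bsub>L\<^esub>j\<in>{..<n'}. h (M i j) \<otimes>\<^bsub>L\<^esub> y j) =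
        eval_over (\<lambda>a. h (id a)) L p' y"
    proof (rule linear_substitution_identity_transfer[OF p p' id_ring_hom L(2,3),
        where S = "of_nat ` {..d}"])
      show "1 * eval_over id type_ring p (\<lambda>i. \<Sum>j<n'. M i j * x j) = eval_over id type_ring p' x" for x
        by (simp add: sum_scale_linear_combination[OF vs M] flip: \<phi> \<phi>')
    qed (use card_of_nat_image[OF char] vecs_closed[OF y] in auto)
    moreover have "eval_over h L p (mat_apply L n' n ?M y) =
        eval_over h L p (\<lambda>i. \<Oplus>\<^bsub>L\<^esub>j\<in>{..<n'}. h (M i j) \<otimes>\<^bsub>L\<^esub> y j)"
      by (rule eval_over_cong[OF L(2,3) p])
        (use vecs_closed[OF y] hc in \<open>auto simp: mat_apply_def intro!: L.finsum_closed\<close>)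
    moreover have "eval_over h L p (\<lambda>i. \<Oplus>\<^bsub>L\<^esub>j\<in>{..<n'}. h (M i j) \<otimes>\<^bsub>L\<^esub> y j) \<in> carrier L"
      by (rule eval_over_closed[OF L(2,3) p])
        (use vecs_closed[OF y] hc in \<open>auto intro!: L.finsum_closed\<close>)
    moreover have "h 1 = \<one>\<^bsub>L\<^esub>" using L(3) by (simp add: ring_hom_type_ring_iff)
    ultimately show ?thesis by simp
  qed
  with inv show thesis using that by blast
qed

text \<open>\<open>D_over\<close> and \<open>G_over\<close> allow a different basis for every element; these lemmas show that any
  fixed basis gives the same sets.\<close>

lemma D_over_iff:
  fixes scale :: "'k::field \<Rightarrow> 'v::ab_group_add \<Rightarrow> 'v"
  assumes vs: "vector_space scale" and char: "CHAR('k) = 0 \<or> CHAR('k) > d"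
    and c: "coordinates scale d V \<phi> n b p" and ext: "field_extension h L"
  shows "a \<in> D_over scale h L d V \<phi> \<longleftrightarrow> a \<in> Units L \<and> (\<exists>x\<in>vecs L n. eval_over h L p x = a)"
proof -
  have "\<exists>x\<in>vecs L n. eval_over h L p x = a"
    if c': "coordinates scale d V \<phi> n' b' p'" and x: "x \<in> vecs L n'" "eval_over h L p' x = a"
    for n' b' p' x
  proof -
    obtain U U' where U: "inverse_linear L n' n U U'"
        "\<And>y. y \<in> vecs L n' \<Longrightarrow> eval_over h L p (U y) = eval_over h L p' y"
      using coordinates_change[OF vs char c c' ext] by blast
    then show ?thesis
      using x by (intro bexI[of _ "U x"]) (auto simp: inverse_linear_def linear_over_def)
  qed
  then show ?thesis using c unfolding D_over_def by blast
qed

lemma G_over_iff: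
  fixes scale :: "'k::field \<Rightarrow> 'v::ab_group_add \<Rightarrow> 'v"
  assumes vs: "vector_space scale" and char: "CHAR('k) = 0 \<or> CHAR('k) > d"
    and c: "coordinates scale d V \<phi> n b p" and ext: "field_extension h L"
  shows "a \<in> G_over scale h L d V \<phi> \<longleftrightarrow> a \<in> Units L \<and>
    isomorphic_over L n (\<lambda>x. a \<otimes>\<^bsub>L\<^esub> eval_over h L p x) (eval_over h L p)"
proof -
  note iso = isomorphic_over_iff[OF field_extensionD(2)[OF ext]]
  have "isomorphic_over L n (\<lambda>x. a \<otimes>\<^bsub>L\<^esub> eval_over h L p x) (eval_over h L p)"
    if c': "coordinates scale d V \<phi> n' b' p'"
      and T: "isomorphic_over L n' (\<lambda>x. a \<otimes>\<^bsub>L\<^esub> eval_over h L p' x) (eval_over h L p')"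
    for n' b' p'
  proof -
    obtain U U' where U: "inverse_linear L n' n U U'"
        "\<And>y. y \<in> vecs L n' \<Longrightarrow> eval_over h L p (U y) = eval_over h L p' y"
      using coordinates_change[OF vs char c c' ext] by blast
    obtain T T' where T: "inverse_linear L n' n' T T'"
        "\<And>x. x \<in> vecs L n' \<Longrightarrow> a \<otimes>\<^bsub>L\<^esub> eval_over h L p' (T x) = eval_over h L p' x"
      using T unfolding iso by blast
    have "inverse_linear L n n (\<lambda>x. U (T (U' x))) (\<lambda>x. U (T' (U' x)))"
      using inverse_linear_comp[OF inverse_linear_comp[OF inverse_linear_sym[OF U(1)] T(1)] U(1)] .
    moreover have "a \<otimes>\<^bsub>L\<^esub> eval_over h L p (U (T (U' x))) = eval_over h L p x"
      if x: "x \<in> vecs L n" for x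
    proof -
      have "U' x \<in> vecs L n'" "T (U' x) \<in> vecs L n'" "U (U' x) = x"
        using U(1) T(1) x by (auto simp: inverse_linear_def linear_over_def)
      then show ?thesis using U(2)[of "T (U' x)"] U(2)[of "U' x"] T(2)[of "U' x"] by simp
    qed
    ultimately show ?thesis unfolding iso by blast
  qed
  then show ?thesis using c unfolding G_over_def by blast
qed

section \<open>Nondegenerate forms take nonzero values\<close>

text \<open>Each step of the polarization expands \<open>\<theta> (c u + v, \<dots>, c u + v, w\<^sub>1, \<dots>)\<close> in powers of \<open>c\<close>.
  Only the two lowest coefficients matter: the linear one contains the value of \<open>\<theta>\<close> with one entry
  \<open>v\<close> replaced by \<open>u\<close>, the constant one is needed for the induction.\<close>

lemma symmetric_multilinear_expand:
  fixes scale :: "'k::field \<Rightarrow> 'v::ab_group_add \<Rightarrow> 'v"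
  assumes \<theta>: "symmetric_multilinear scale d V \<theta>"
    and V: "u \<in> V" "v \<in> V" "\<And>c. scale c u + v \<in> V"
    and "set ws \<subseteq> V" "length ws + m = d"
  shows "\<exists>P. degree P \<le> m \<and> (\<forall>c. \<theta> (replicate m (scale c u + v) @ ws) = poly P c) \<and>
    coeff P 0 = \<theta> (replicate m v @ ws) \<and>
    coeff P 1 = of_nat m * \<theta> (replicate (m - 1) v @ u # ws)"
  using assms(5,6)
proof (induct m arbitrary: ws)
  case 0
  then show ?case by (intro exI[of _ "[:\<theta> ws:]"]) simp
next
  case (Suc m)
  have sym: "\<theta> xs = \<theta> ys" if "length ys = d" "set ys \<subseteq> V" "mset xs = mset ys" for xs ys
    using \<theta> that unfolding symmetric_multilinear_def by blast
  obtain P where P: "degree P \<le> m" "\<And>c. \<theta> (replicate m (scale c u + v) @ u # ws) = poly P c"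
      "coeff P 0 = \<theta> (replicate m v @ u # ws)"
    using Suc(1)[of "u # ws"] Suc(2,3) V(1) by auto
  obtain Q where Q: "degree Q \<le> m" "\<And>c. \<theta> (replicate m (scale c u + v) @ v # ws) = poly Q c"
      "coeff Q 0 = \<theta> (replicate m v @ v # ws)"
      "coeff Q 1 = of_nat m * \<theta> (replicate (m - 1) v @ u # v # ws)"
    using Suc(1)[of "v # ws"] Suc(2,3) V(2) by auto
  have "\<theta> (replicate (Suc m) (scale c u + v) @ ws) = poly (pCons 0 P + Q) c" for c
  proof -
    let ?r = "replicate m (scale c u + v) @ ws"
    have in_V: "set (v # ?r) \<subseteq> V" "length (v # ?r) = d" using V Suc(2,3) by auto
    have multi: "\<And>vs j c u v. length vs = d \<and> set vs \<subseteq> V \<and> j < d \<and> u \<in> V \<and> v \<in> V \<Longrightarrow>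
        \<theta> (vs[j := scale c u + v]) = c * \<theta> (vs[j := u]) + \<theta> (vs[j := v])"
      using \<theta> unfolding symmetric_multilinear_def by blast
    have "\<theta> ((scale c u + v) # ?r) = c * \<theta> (u # ?r) + \<theta> (v # ?r)"
      using multi[of "v # ?r" 0 u v c] in_V V by auto
    also have "\<theta> (u # ?r) = \<theta> (replicate m (scale c u + v) @ u # ws)"
      by (rule sym) (use in_V V in auto)
    also have "\<theta> (v # ?r) = \<theta> (replicate m (scale c u + v) @ v # ws)"
      by (rule sym) (use in_V V in auto)
    finally show ?thesis using P(2) Q(2) by simp
  qed
  moreover have "coeff (pCons 0 P + Q) 0 = \<theta> (replicate (Suc m) v @ ws)"
    using Q(3) by (simp add: replicate_app_Cons_same)
  moreover have "coeff (pCons 0 P + Q) 1 = of_nat (Suc m) * \<theta> (replicate m v @ u # ws)"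
  proof (cases m)
    case (Suc k)
    have "\<theta> (replicate k v @ u # v # ws) = \<theta> (replicate m v @ u # ws)"
      by (rule sym) (use Suc Suc.prems V in auto)
    then show ?thesis using P(3) Q(4) Suc by (simp add: algebra_simps)
  qed (use P(3) Q(4) in simp)
  moreover have "degree (pCons 0 P + Q) \<le> Suc m"
    using P(1) Q(1) by (intro degree_add_le) (auto intro: order.trans[OF degree_pCons_le])
  ultimately show ?case by (intro exI[of _ "pCons 0 P + Q"]) simp
qed

text \<open>If \<open>\<phi>\<close> vanished on \<open>V\<close>, then so would \<open>\<theta>\<close>: entries \<open>v\<close> are replaced by arbitrary vectors one at a
  time. A polynomial in \<open>c\<close> of degree \<open>m \<le> d\<close> that vanishes on \<open>0, \<dots>, d\<close> is zero, and the
  factor \<open>m\<close> in its linear coefficient is invertible by the assumption on the characteristic.\<close>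

lemma nondegenerate_nonzero_value:
  fixes scale :: "'k::field \<Rightarrow> 'v::ab_group_add \<Rightarrow> 'v"
  assumes vs: "vector_space scale" and V: "module.subspace scale V"
    and char: "CHAR('k) = 0 \<or> CHAR('k) > d" and "d > 0"
    and nondeg: "nondegenerate scale d V \<phi>" and "V \<noteq> {0}"
  obtains v where "v \<in> V" "\<phi> v \<noteq> 0"
proof (rule ccontr)
  interpret vector_space scale by fact
  assume "\<not> thesis"
  then have zero: "\<phi> v = 0" if "v \<in> V" for v
    using that \<open>\<And>v. v \<in> V \<Longrightarrow> \<phi> v \<noteq> 0 \<Longrightarrow> thesis\<close> by blast
  obtain \<theta> where \<theta>: "symmetric_multilinear scale d V \<theta>" "\<And>v. v \<in> V \<Longrightarrow> \<phi> v = \<theta> (replicate d v)"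
    and nd: "\<And>v. v \<in> V \<Longrightarrow> (\<And>vs. length vs = d - 1 \<Longrightarrow> set vs \<subseteq> V \<Longrightarrow> \<theta> (v # vs) = 0) \<Longrightarrow> v = 0"
    using nondeg unfolding nondegenerate_def by blast
  have polar: "\<theta> (replicate (d - length ws) v @ ws) = 0"
    if "v \<in> V" "set ws \<subseteq> V" "length ws \<le> d" for v ws
    using that
  proof (induct ws arbitrary: v)
    case Nil
    then show ?case using \<theta>(2) zero by simp
  next
    case (Cons u ws)
    let ?m = "d - length ws"
    have in_V: "scale c u + v \<in> V" for c
      using V Cons by (simp add: subspace_def)
    obtain P where P: "degree P \<le> ?m" "\<And>c. \<theta> (replicate ?m (scale c u + v) @ ws) = poly P c"
        "coeff P 1 = of_nat ?m * \<theta> (replicate (?m - 1) v @ u # ws)"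
      using symmetric_multilinear_expand[OF \<theta>(1) _ _ in_V, of ws ?m] Cons by auto
    have root: "poly P c = 0" for c
      using Cons(1)[OF in_V, of c] Cons(3,4) P(2) by simp
    have "P = 0"
    proof (rule ccontr)
      assume "P \<noteq> 0"
      then have "card ((of_nat :: nat \<Rightarrow> 'k) ` {..d}) \<le> degree P"
        using card_mono[OF poly_roots_finite, of P "of_nat ` {..d}"] root card_poly_roots_bound[of P]
        by fastforce
      then show False using P(1) card_of_nat_image[OF char] by simp
    qed
    moreover have "(of_nat ?m :: 'k) \<noteq> 0"
    proof -
      have "0 < ?m" "?m \<le> d" using Cons(4) by auto
      then have "\<not> CHAR('k) dvd ?m" using char by (auto dest: dvd_imp_le)
      then show ?thesis by (simp only: of_nat_eq_0_iff_char_dvd) simp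
    qed
    ultimately show ?case using P(3) by simp
  qed
  have "v = 0" if "v \<in> V" for v
  proof (rule nd[OF that])
    fix vs assume "length vs = d - 1" "set vs \<subseteq> V"
    then show "\<theta> (v # vs) = 0"
      using polar[of v "v # vs"] that \<open>d > 0\<close> by simp
  qed
  moreover have "0 \<in> V" using V by (rule subspace_0)
  ultimately show False using \<open>V \<noteq> {0}\<close> by blast
qed

section \<open>Direct sums\<close>

text \<open>The summands are numbered from 1 and coordinates from 0: coordinate \<open>j\<close> of the \<open>i\<close>-th summand
  becomes coordinate \<open>offset ns i + j\<close> of the direct sum.\<close>

definition offset :: "(nat \<Rightarrow> nat) \<Rightarrow> nat \<Rightarrow> nat" where
  "offset ns i = (\<Sum>j\<in>{1..<i}. ns j)"

abbreviation total_dim :: "(nat \<Rightarrow> nat) \<Rightarrow> nat \<Rightarrow> nat" where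
  "total_dim ns r \<equiv> offset ns (Suc r)"

definition block :: "(nat \<Rightarrow> nat) \<Rightarrow> nat \<Rightarrow> (nat \<Rightarrow> 'a) \<Rightarrow> nat \<Rightarrow> 'a" where
  "block ns i x = (\<lambda>j\<in>{..<ns i}. x (offset ns i + j))"

text \<open>The converse of \<open>block\<close>; it is also used for vectors of \<open>V\<close> in place of scalars, to concatenate
  bases.\<close>

definition join_blocks :: "(nat \<Rightarrow> nat) \<Rightarrow> nat \<Rightarrow> (nat \<Rightarrow> nat \<Rightarrow> 'a) \<Rightarrow> nat \<Rightarrow> 'a" where
  "join_blocks ns r y = (\<lambda>t\<in>{..<total_dim ns r}.
     case inv_into (SIGMA i:{1..r}. {..<ns i}) (\<lambda>(i, j). offset ns i + j) t of (i, j) \<Rightarrow> y i j)"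

lemma offset_Suc: "1 \<le> i \<Longrightarrow> offset ns (Suc i) = offset ns i + ns i"
  by (simp add: offset_def atLeastLessThanSuc)

lemma offset_mono: "i \<le> i' \<Longrightarrow> offset ns i \<le> offset ns i'"
  unfolding offset_def by (rule sum_mono2) auto

lemma offset_add_less:
  assumes "1 \<le> i" "i < i'" "j < ns i"
  shows "offset ns i + j < offset ns i'"
  using offset_mono[of "Suc i" i' ns] offset_Suc[OF assms(1), of ns] assms by simp

lemma offset_less_total: "i \<in> {1..r} \<Longrightarrow> j < ns i \<Longrightarrow> offset ns i + j < total_dim ns r"
  by (rule offset_add_less) auto

lemma bij_betw_offset:
  "bij_betw (\<lambda>(i, j). offset ns i + j) (SIGMA i:{1..r}. {..<ns i}) {..<total_dim ns r}"
proof (rule bij_betwI')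
  fix p q assume pq: "p \<in> (SIGMA i:{1..r}. {..<ns i})" "q \<in> (SIGMA i:{1..r}. {..<ns i})"
  obtain i j i' j' where [simp]: "p = (i, j)" "q = (i', j')" by fastforce
  show "(case p of (i, j) \<Rightarrow> offset ns i + j) = (case q of (i, j) \<Rightarrow> offset ns i + j) \<longleftrightarrow> p = q"
    using pq offset_add_less[of i i' j ns] offset_add_less[of i' i j' ns]
    by (cases i i' rule: linorder_cases) auto
next
  fix p assume "p \<in> (SIGMA i:{1..r}. {..<ns i})"
  then show "(case p of (i, j) \<Rightarrow> offset ns i + j) \<in> {..<total_dim ns r}"
    using offset_less_total by auto
next
  fix t assume "t \<in> {..<total_dim ns r}"
  then have "\<exists>i\<in>{1..r}. \<exists>j<ns i. t = offset ns i + j"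
  proof (induct r)
    case 0
    then show ?case by (simp add: offset_def)
  next
    case (Suc r)
    show ?case
    proof (cases "t < total_dim ns r")
      case True
      then show ?thesis using Suc(1) by force
    next
      case False
      then show ?thesis using Suc(2) offset_Suc[of "Suc r" ns]
        by (intro bexI[of _ "Suc r"] exI[of _ "t - total_dim ns r"]) auto
    qed
  qed
  then show "\<exists>p\<in>(SIGMA i:{1..r}. {..<ns i}). t = (case p of (i, j) \<Rightarrow> offset ns i + j)" by force
qed

lemma total_cases:
  assumes "t < total_dim ns r"
  obtains i j where "i \<in> {1..r}" "j < ns i" "t = offset ns i + j"
proof -
  have "t \<in> (\<lambda>(i, j). offset ns i + j) ` (SIGMA i:{1..r}. {..<ns i})"
    using bij_betw_offset[of ns r] assms by (simp add: bij_betw_def)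
  then show thesis using that by auto
qed

lemma sum_total:
  "(\<Sum>t<total_dim ns r. f t) = (\<Sum>i\<in>{1..r}. \<Sum>j<ns i. f (offset ns i + j))"
  using sum.reindex_bij_betw[OF bij_betw_offset[of ns r], of f]
  by (simp add: sum.Sigma split_def)

lemma join_offset:
  assumes "i \<in> {1..r}" "j < ns i"
  shows "join_blocks ns r y (offset ns i + j) = y i j"
proof -
  have "inv_into (SIGMA i:{1..r}. {..<ns i}) (\<lambda>(i, j). offset ns i + j) (offset ns i + j) = (i, j)"
    using inv_into_f_f[OF bij_betw_imp_inj_on[OF bij_betw_offset[of ns r]], of "(i, j)"] assms
    by simp
  then show ?thesis using offset_less_total[where ns = ns, OF assms] by (simp add: join_blocks_def)
qed

lemma block_apply: "j < ns i \<Longrightarrow> block ns i x j = x (offset ns i + j)"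
  by (simp add: block_def)

lemma block_vecs: "x \<in> vecs L (total_dim ns r) \<Longrightarrow> i \<in> {1..r} \<Longrightarrow> block ns i x \<in> vecs L (ns i)"
  unfolding block_def restrict_vecs by (blast intro: vecs_closed offset_less_total)

lemma join_vecs:
  assumes "\<And>i. i \<in> {1..r} \<Longrightarrow> y i \<in> vecs L (ns i)"
  shows "join_blocks ns r y \<in> vecs L (total_dim ns r)"
proof -
  have "join_blocks ns r y t \<in> carrier L" if "t < total_dim ns r" for t
    using that
  proof (rule total_cases)
    fix i j assume "i \<in> {1..r}" "j < ns i" "t = offset ns i + j"
    then show ?thesis using vecs_closed[OF assms] by (simp add: join_offset)
  qed
  moreover have "join_blocks ns r y \<in> extensional {..<total_dim ns r}" by (simp add: join_blocks_def)
  ultimately show ?thesis by (auto simp: vecs_def PiE_iff)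
qed

lemma block_join:
  assumes "i \<in> {1..r}" "y i \<in> vecs L (ns i)"
  shows "block ns i (join_blocks ns r y) = y i"
  unfolding block_def using join_offset[OF assms(1), where ns = ns and y = y] restrict_vecs_id[OF assms(2)]
  by (simp cong: restrict_cong)

lemma vecs_total_eqI:
  assumes "x \<in> vecs L (total_dim ns r)" "y \<in> vecs L (total_dim ns r)"
    and "\<And>i j. i \<in> {1..r} \<Longrightarrow> j < ns i \<Longrightarrow> x (offset ns i + j) = y (offset ns i + j)"
  shows "x = y"
  using assms(1,2) by (rule vecs_eqI) (elim total_cases, use assms(3) in auto)

lemma join_inverse_linear:
  assumes L: "cring L"
    and T: "\<And>i. i \<in> {1..r} \<Longrightarrow> inverse_linear L (ns i) (ns i) (T i) (T' i)"
  shows "inverse_linear L (total_dim ns r) (total_dim ns r)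
    (\<lambda>x. join_blocks ns r (\<lambda>i. T i (block ns i x)))
    (\<lambda>x. join_blocks ns r (\<lambda>i. T' i (block ns i x)))"
proof -
  interpret L: cring L by fact
  have lin: "linear_over L (total_dim ns r) (total_dim ns r) (\<lambda>x. join_blocks ns r (\<lambda>i. T i (block ns i x)))"
    if T: "\<And>i. i \<in> {1..r} \<Longrightarrow> linear_over L (ns i) (ns i) (T i)" for T
  proof -
    have Tc: "T i x \<in> vecs L (ns i)" if "i \<in> {1..r}" "x \<in> vecs L (ns i)" for i x
      using T that by (auto simp: linear_over_def)
    have joinc: "join_blocks ns r (\<lambda>i. T i (block ns i x)) \<in> vecs L (total_dim ns r)"
      if "x \<in> vecs L (total_dim ns r)" for x
      using that Tc block_vecs by (blast intro: join_vecs)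
    have "join_blocks ns r (\<lambda>i. T i (block ns i (\<lambda>t\<in>{..<total_dim ns r}. c \<otimes>\<^bsub>L\<^esub> x t \<oplus>\<^bsub>L\<^esub> y t))) =
        (\<lambda>t\<in>{..<total_dim ns r}. c \<otimes>\<^bsub>L\<^esub> join_blocks ns r (\<lambda>i. T i (block ns i x)) t \<oplus>\<^bsub>L\<^esub>
           join_blocks ns r (\<lambda>i. T i (block ns i y)) t)"
      if c: "c \<in> carrier L" and x: "x \<in> vecs L (total_dim ns r)" and y: "y \<in> vecs L (total_dim ns r)"
      for c x y
    proof (rule vecs_total_eqI[of _ L])
      show "join_blocks ns r (\<lambda>i. T i (block ns i (\<lambda>t\<in>{..<total_dim ns r}. c \<otimes>\<^bsub>L\<^esub> x t \<oplus>\<^bsub>L\<^esub> y t)))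
          \<in> vecs L (total_dim ns r)"
        by (rule joinc) (use c vecs_closed[OF x] vecs_closed[OF y] in auto)
      show "(\<lambda>t\<in>{..<total_dim ns r}. c \<otimes>\<^bsub>L\<^esub> join_blocks ns r (\<lambda>i. T i (block ns i x)) t \<oplus>\<^bsub>L\<^esub>
          join_blocks ns r (\<lambda>i. T i (block ns i y)) t) \<in> vecs L (total_dim ns r)"
        using c vecs_closed[OF joinc[OF x]] vecs_closed[OF joinc[OF y]] by auto
    next
      fix i j assume ij: "i \<in> {1..r}" "j < ns i"
      have "block ns i (\<lambda>t\<in>{..<total_dim ns r}. c \<otimes>\<^bsub>L\<^esub> x t \<oplus>\<^bsub>L\<^esub> y t) =
          (\<lambda>j\<in>{..<ns i}. c \<otimes>\<^bsub>L\<^esub> block ns i x j \<oplus>\<^bsub>L\<^esub> block ns i y j)"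
        using offset_less_total[OF ij(1), of _ ns] by (auto simp: block_def)
      then have "T i (block ns i (\<lambda>t\<in>{..<total_dim ns r}. c \<otimes>\<^bsub>L\<^esub> x t \<oplus>\<^bsub>L\<^esub> y t)) =
          (\<lambda>j\<in>{..<ns i}. c \<otimes>\<^bsub>L\<^esub> T i (block ns i x) j \<oplus>\<^bsub>L\<^esub> T i (block ns i y) j)"
        using T[OF ij(1)] c block_vecs[OF x ij(1)] block_vecs[OF y ij(1)]
        unfolding linear_over_def by simp
      then show "join_blocks ns r (\<lambda>i. T i (block ns i (\<lambda>t\<in>{..<total_dim ns r}. c \<otimes>\<^bsub>L\<^esub> x t \<oplus>\<^bsub>L\<^esub> y t)))
            (offset ns i + j) =
          (\<lambda>t\<in>{..<total_dim ns r}. c \<otimes>\<^bsub>L\<^esub> join_blocks ns r (\<lambda>i. T i (block ns i x)) t \<oplus>\<^bsub>L\<^esub>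
             join_blocks ns r (\<lambda>i. T i (block ns i y)) t) (offset ns i + j)"
        using ij offset_less_total[where ns = ns, OF ij] by (simp add: join_offset)
    qed
    then show ?thesis using joinc by (auto simp: linear_over_def)
  qed
  have inv: "join_blocks ns r (\<lambda>i. T' i (block ns i (join_blocks ns r (\<lambda>i. T i (block ns i x))))) = x"
    if T: "\<And>i. i \<in> {1..r} \<Longrightarrow> inverse_linear L (ns i) (ns i) (T i) (T' i)"
      and x: "x \<in> vecs L (total_dim ns r)" for T T' x
  proof -
    have Tx: "T i (block ns i x) \<in> vecs L (ns i)" "T' i (T i (block ns i x)) = block ns i x"
      if "i \<in> {1..r}" for i
      using T[OF that] block_vecs[OF x that] by (auto simp: inverse_linear_def linear_over_def)
    have b: "block ns i (join_blocks ns r (\<lambda>i. T i (block ns i x))) = T i (block ns i x)"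
      if "i \<in> {1..r}" for i
      using that Tx(1)[OF that] by (rule block_join[where y = "\<lambda>i. T i (block ns i x)"])
    show ?thesis
    proof (rule vecs_total_eqI[OF _ x])
      show "join_blocks ns r (\<lambda>i. T' i (block ns i (join_blocks ns r (\<lambda>i. T i (block ns i x)))))
          \<in> vecs L (total_dim ns r)"
        by (rule join_vecs) (simp only: b Tx(2) block_vecs[OF x])
    qed (simp add: join_offset b Tx(2) block_apply)
  qed
  show ?thesis unfolding inverse_linear_def
    using lin[of T] lin[of T'] inv[of T T'] inv[of T' T] T inverse_linear_sym[OF T]
    by (auto simp: inverse_linear_def)
qed

definition prod_poly :: "(nat \<Rightarrow> nat) \<Rightarrow> (nat \<Rightarrow> nat) \<Rightarrow> nat \<Rightarrow> (nat \<Rightarrow> 'k::field mpoly) \<Rightarrow> 'k mpoly" where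
  "prod_poly ns s r ps =
     (\<Prod>i\<in>{1..r}. eval_over Const type_ring (ps i) (\<lambda>j. Var (offset ns i + j)) ^ s i)"

lemma homogeneous_prod_poly:
  assumes "\<And>i. i \<in> {1..r} \<Longrightarrow> homogeneous (ns i) (ds i) (ps i)"
  shows "homogeneous (total_dim ns r) (\<Sum>i\<in>{1..r}. ds i * s i) (prod_poly ns s r ps)"
  unfolding prod_poly_def
proof (rule homogeneous_prod, rule homogeneous_power)
  fix i assume i: "i \<in> {1..r}"
  show "homogeneous (total_dim ns r) (ds i)
      (eval_over Const type_ring (ps i) (\<lambda>j. Var (offset ns i + j)))"
    using homogeneous_eval_over[OF assms[OF i], of "total_dim ns r" _ "\<lambda>a. a"]
      offset_less_total[OF i, of _ ns] by simp
qed

lemma eval_prod_poly: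
  assumes L: "cring L" and h: "h \<in> ring_hom type_ring L"
    and ps: "\<And>i. i \<in> {1..r} \<Longrightarrow> homogeneous (ns i) (ds i) (ps i)"
    and x: "\<And>t. t < total_dim ns r \<Longrightarrow> x t \<in> carrier L"
  shows "eval_over h L (prod_poly ns s r ps) x =
    (\<Otimes>\<^bsub>L\<^esub>i\<in>{1..r}. eval_over h L (ps i) (block ns i x) [^]\<^bsub>L\<^esub> s i)"
proof -
  interpret L: cring L by fact
  let ?x = "\<lambda>t. if t < total_dim ns r then x t else \<zero>\<^bsub>L\<^esub>"
  interpret E: mpoly_eval L h ?x by (rule mpoly_evalI) (use L h x in auto)
  have ev: "eval_over h L (eval_over Const type_ring (ps i) (\<lambda>j. Var (offset ns i + j))) ?x =
      eval_over h L (ps i) (block ns i x)" if i: "i \<in> {1..r}" for i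
  proof -
    have "eval_over h L (eval_over Const type_ring (ps i) (\<lambda>j. Var (offset ns i + j))) ?x =
        eval_over h L (ps i) (\<lambda>j. ?x (offset ns i + j))"
      using eval_over_natural[OF cring_type_ring L E.eval_ring_hom Const_hom ps[OF i]] by simp
    also have "\<dots> = eval_over h L (ps i) (block ns i x)"
      by (rule eval_over_cong[OF L h ps[OF i]])
        (use x offset_less_total[OF i, of _ ns] in \<open>auto simp: block_apply\<close>)
    finally show ?thesis .
  qed
  have pow: "eval_over h L (p ^ k) ?x = eval_over h L p ?x [^]\<^bsub>L\<^esub> k" for p k
    by (induct k) (auto simp: E.eval_mult L.m_comm)
  have "eval_over h L (prod_poly ns s r ps) x = eval_over h L (prod_poly ns s r ps) ?x"
    by (rule eval_over_cong[OF L h homogeneous_prod_poly[OF ps]]) (use x in auto)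
  also have "\<dots> = eval_over h L (finprod type_ring
      (\<lambda>i. eval_over Const type_ring (ps i) (\<lambda>j. Var (offset ns i + j)) ^ s i) {1..r}) ?x"
    by (simp only: finprod_type_ring prod_poly_def)
  also have "\<dots> = (\<Otimes>\<^bsub>L\<^esub>i\<in>{1..r}. ((\<lambda>p. eval_over h L p ?x) \<circ>
      (\<lambda>i. eval_over Const type_ring (ps i) (\<lambda>j. Var (offset ns i + j)) ^ s i)) i)"
    by (rule E.eval.hom_finprod) simp
  also have "\<dots> = (\<Otimes>\<^bsub>L\<^esub>i\<in>{1..r}. eval_over h L (ps i) (block ns i x) [^]\<^bsub>L\<^esub> s i)"
  proof (rule L.finprod_cong')
    show "(\<lambda>i. eval_over h L (ps i) (block ns i x) [^]\<^bsub>L\<^esub> s i) \<in> {1..r} \<rightarrow> carrier L"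
      using eval_over_closed[OF L h ps] x offset_less_total
      by (auto simp: block_apply intro!: L.nat_pow_closed)
  qed (simp_all only: o_apply pow ev)
  finally show ?thesis .
qed

text \<open>A linear relation between the joined vectors has one component in each summand, all of which
  vanish because the sum is direct.\<close>

lemma is_basis_join:
  fixes scale :: "'k::field \<Rightarrow> 'v::ab_group_add \<Rightarrow> 'v"
  assumes vs: "vector_space scale" and sum: "direct_sum scale r W V"
    and bs: "\<And>i. i \<in> {1..r} \<Longrightarrow> is_basis scale (W i) (ns i) (bs i)"
  shows "is_basis scale V (total_dim ns r) (join_blocks ns r bs)"
proof -
  let ?u = "\<lambda>x i. \<Sum>j<ns i. scale (x (offset ns i + j)) (bs i j)"
  have comb: "(\<Sum>t<total_dim ns r. scale (x t) (join_blocks ns r bs t)) = (\<Sum>i\<in>{1..r}. ?u x i)" for x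
    by (simp add: sum_total join_offset)
  have W: "W i = range (\<lambda>x. \<Sum>j<ns i. scale (x j) (bs i j))" if "i \<in> {1..r}" for i
    using bs[OF that] by (simp add: is_basis_iff[OF vs])
  have uW: "?u x i \<in> W i" if "i \<in> {1..r}" for x i
    unfolding W[OF that] by (rule rangeI)
  have V: "V = {\<Sum>i\<in>{1..r}. u i | u. \<forall>i\<in>{1..r}. u i \<in> W i}"
    and ind: "\<And>u. (\<And>i. i \<in> {1..r} \<Longrightarrow> u i \<in> W i) \<Longrightarrow> (\<Sum>i\<in>{1..r}. u i) = 0 \<Longrightarrow>
      (\<And>i. i \<in> {1..r} \<Longrightarrow> u i = 0)"
    using sum by (auto simp: direct_sum_def)
  have "x t = 0" if x: "(\<Sum>i\<in>{1..r}. ?u x i) = 0" and t: "t < total_dim ns r" for x t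
  proof -
    obtain i j where ij: "i \<in> {1..r}" "j < ns i" "t = offset ns i + j"
      using total_cases[OF t] by blast
    have "?u x i = 0" using ind[of "?u x"] uW x ij(1) by blast
    moreover have ind_i: "\<forall>j<ns i. y j = 0" if "(\<Sum>j<ns i. scale (y j) (bs i j)) = 0" for y
      using bs[OF ij(1)] that unfolding is_basis_iff[OF vs] by blast
    ultimately show ?thesis using ind_i[of "\<lambda>j. x (offset ns i + j)"] ij(2,3) by simp
  qed
  moreover have "v \<in> range (\<lambda>x. \<Sum>i\<in>{1..r}. ?u x i)" if v: "v \<in> V" for v
  proof -
    obtain u where u: "v = (\<Sum>i\<in>{1..r}. u i)" "\<And>i. i \<in> {1..r} \<Longrightarrow> u i \<in> W i"
      using v unfolding V by blast
    have "\<exists>x. u i = (\<Sum>j<ns i. scale (x j) (bs i j))" if "i \<in> {1..r}" for i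
      using u(2)[OF that] unfolding W[OF that] by blast
    then obtain x where x: "\<And>i. i \<in> {1..r} \<Longrightarrow> u i = (\<Sum>j<ns i. scale (x i j) (bs i j))" by metis
    have "?u (join_blocks ns r x) i = u i" if "i \<in> {1..r}" for i
      using x that by (simp add: join_offset)
    then have "v = (\<Sum>i\<in>{1..r}. ?u (join_blocks ns r x) i)" unfolding u(1) by simp
    then show ?thesis by blast
  qed
  moreover have "(\<Sum>i\<in>{1..r}. ?u x i) \<in> V" for x
    unfolding V using uW by blast
  ultimately show ?thesis unfolding is_basis_iff[OF vs] comb by blast
qed

lemma coordinates_join:
  fixes scale :: "'k::field \<Rightarrow> 'v::ab_group_add \<Rightarrow> 'v"
  assumes vs: "vector_space scale" and sum: "direct_sum scale r W V"
    and \<phi>: "\<And>u. (\<And>i. i \<in> {1..r} \<Longrightarrow> u i \<in> W i) \<Longrightarrow>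
      \<phi> (\<Sum>i\<in>{1..r}. u i) = (\<Prod>i\<in>{1..r}. \<phi>s i (u i) ^ s i)"
    and c: "\<And>i. i \<in> {1..r} \<Longrightarrow> coordinates scale (ds i) (W i) (\<phi>s i) (ns i) (bs i) (ps i)"
  shows "coordinates scale (\<Sum>i\<in>{1..r}. ds i * s i) V \<phi> (total_dim ns r) (join_blocks ns r bs)
    (prod_poly ns s r ps)"
proof -
  have b: "is_basis scale (W i) (ns i) (bs i)" and p: "homogeneous (ns i) (ds i) (ps i)"
    and ev: "\<And>x. \<phi>s i (\<Sum>j<ns i. scale (x j) (bs i j)) = eval_over id type_ring (ps i) x"
    if "i \<in> {1..r}" for i
    using c[OF that] by (auto simp: coordinates_def)
  have "\<phi> (\<Sum>t<total_dim ns r. scale (x t) (join_blocks ns r bs t)) =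
      eval_over id type_ring (prod_poly ns s r ps) x" for x
  proof -
    let ?u = "\<lambda>i. \<Sum>j<ns i. scale (block ns i x j) (bs i j)"
    have "?u i \<in> W i" if "i \<in> {1..r}" for i
      using b[OF that] by (auto simp: is_basis_iff[OF vs])
    then have "\<phi> (\<Sum>i\<in>{1..r}. ?u i) = (\<Prod>i\<in>{1..r}. \<phi>s i (?u i) ^ s i)" by (rule \<phi>)
    also have "\<dots> = (\<Prod>i\<in>{1..r}. eval_over id type_ring (ps i) (block ns i x) ^ s i)"
      by (rule prod.cong) (simp_all only: ev)
    also have "\<dots> = eval_over id type_ring (prod_poly ns s r ps) x"
      using eval_prod_poly[where ns = ns and ps = ps and ds = ds and x = x and r = r and s = s,
          OF cring_type_ring id_ring_hom p] by simp
    finally show ?thesis by (simp add: sum_total join_offset block_apply)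
  qed
  then show ?thesis
    using is_basis_join[OF vs sum b] homogeneous_prod_poly[OF p] by (simp add: coordinates_def)
qed

text \<open>Isomorphisms between the summands and their multiples combine to one between the sum and
  its multiple.\<close>

lemma isomorphic_over_prod_poly:
  assumes L: "cring L" and h: "h \<in> ring_hom type_ring L"
    and ps: "\<And>i. i \<in> {1..r} \<Longrightarrow> homogeneous (ns i) (ds i) (ps i)"
    and a: "\<And>i. i \<in> {1..r} \<Longrightarrow> a i \<in> carrier L"
    and iso: "\<And>i. i \<in> {1..r} \<Longrightarrow>
      isomorphic_over L (ns i) (\<lambda>x. a i \<otimes>\<^bsub>L\<^esub> eval_over h L (ps i) x) (eval_over h L (ps i))"
  shows "isomorphic_over L (total_dim ns r)
    (\<lambda>x. (\<Otimes>\<^bsub>L\<^esub>i\<in>{1..r}. a i [^]\<^bsub>L\<^esub> s i) \<otimes>\<^bsub>L\<^esub> eval_over h L (prod_poly ns s r ps) x)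
    (eval_over h L (prod_poly ns s r ps))"
proof -
  interpret L: cring L by fact
  have "\<exists>T T'. inverse_linear L (ns i) (ns i) T T' \<and>
      (\<forall>x\<in>vecs L (ns i). a i \<otimes>\<^bsub>L\<^esub> eval_over h L (ps i) (T x) = eval_over h L (ps i) x)"
    if "i \<in> {1..r}" for i
    using iso[OF that] unfolding isomorphic_over_iff[OF L] .
  then obtain T T' where T: "\<And>i. i \<in> {1..r} \<Longrightarrow> inverse_linear L (ns i) (ns i) (T i) (T' i)"
    and ev: "\<And>i x. i \<in> {1..r} \<Longrightarrow> x \<in> vecs L (ns i) \<Longrightarrow>
      a i \<otimes>\<^bsub>L\<^esub> eval_over h L (ps i) (T i x) = eval_over h L (ps i) x"
    by metis
  let ?U = "\<lambda>x. join_blocks ns r (\<lambda>i. T i (block ns i x))"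
  have "(\<Otimes>\<^bsub>L\<^esub>i\<in>{1..r}. a i [^]\<^bsub>L\<^esub> s i) \<otimes>\<^bsub>L\<^esub> eval_over h L (prod_poly ns s r ps) (?U x) =
      eval_over h L (prod_poly ns s r ps) x" if x: "x \<in> vecs L (total_dim ns r)" for x
  proof -
    have Tx: "T i (block ns i x) \<in> vecs L (ns i)" if "i \<in> {1..r}" for i
      using T[OF that] block_vecs[OF x that] by (auto simp: inverse_linear_def linear_over_def)
    have Ux: "?U x \<in> vecs L (total_dim ns r)" by (rule join_vecs) (rule Tx)
    have evc: "eval_over h L (ps i) y \<in> carrier L" if "i \<in> {1..r}" "y \<in> vecs L (ns i)" for i y
      by (rule eval_over_closed[OF L h ps[OF that(1)]]) (rule vecs_closed[OF that(2)])
    have bU: "block ns i (?U x) = T i (block ns i x)" if "i \<in> {1..r}" for i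
      using block_join[OF that, of "\<lambda>i. T i (block ns i x)"] Tx that by blast
    have "eval_over h L (prod_poly ns s r ps) (?U x) =
        (\<Otimes>\<^bsub>L\<^esub>i\<in>{1..r}. eval_over h L (ps i) (block ns i (?U x)) [^]\<^bsub>L\<^esub> s i)"
      by (rule eval_prod_poly[OF L h ps]) (use vecs_closed[OF Ux] in auto)
    also have "\<dots> = (\<Otimes>\<^bsub>L\<^esub>i\<in>{1..r}. eval_over h L (ps i) (T i (block ns i x)) [^]\<^bsub>L\<^esub> s i)"
      by (rule L.finprod_cong') (use bU evc Tx in auto)
    finally have "(\<Otimes>\<^bsub>L\<^esub>i\<in>{1..r}. a i [^]\<^bsub>L\<^esub> s i) \<otimes>\<^bsub>L\<^esub>
          eval_over h L (prod_poly ns s r ps) (?U x) =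
        (\<Otimes>\<^bsub>L\<^esub>i\<in>{1..r}. a i [^]\<^bsub>L\<^esub> s i) \<otimes>\<^bsub>L\<^esub>
        (\<Otimes>\<^bsub>L\<^esub>i\<in>{1..r}. eval_over h L (ps i) (T i (block ns i x)) [^]\<^bsub>L\<^esub> s i)" by simp
    also have "\<dots> = (\<Otimes>\<^bsub>L\<^esub>i\<in>{1..r}. a i [^]\<^bsub>L\<^esub> s i \<otimes>\<^bsub>L\<^esub>
        eval_over h L (ps i) (T i (block ns i x)) [^]\<^bsub>L\<^esub> s i)"
      by (rule L.finprod_multf[symmetric]) (use a evc Tx in auto)
    also have "\<dots> = (\<Otimes>\<^bsub>L\<^esub>i\<in>{1..r}. eval_over h L (ps i) (block ns i x) [^]\<^bsub>L\<^esub> s i)"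
    proof (rule L.finprod_cong')
      fix i assume i: "i \<in> {1..r}"
      show "a i [^]\<^bsub>L\<^esub> s i \<otimes>\<^bsub>L\<^esub> eval_over h L (ps i) (T i (block ns i x)) [^]\<^bsub>L\<^esub> s i =
          eval_over h L (ps i) (block ns i x) [^]\<^bsub>L\<^esub> s i"
        using ev[OF i block_vecs[OF x i]] L.nat_pow_distrib[OF a[OF i] evc[OF i Tx[OF i]], of "s i"]
        by simp
    qed (use evc block_vecs[OF x] in auto)
    also have "\<dots> = eval_over h L (prod_poly ns s r ps) x"
      by (rule eval_prod_poly[OF L h ps, symmetric]) (use vecs_closed[OF x] in auto)
    finally show ?thesis .
  qed
  then show ?thesis
    unfolding isomorphic_over_iff[OF L]
    using join_inverse_linear[where ns = ns and T = T and T' = T' and r = r, OF L T] by blast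
qed

section \<open>Rational function fields\<close>

lemma single_eq_Const_mult_Vars:
  "Poly_Mapping.single m c =
     Const c * (\<Prod>i\<in>Poly_Mapping.keys m. Var i ^ Poly_Mapping.lookup m i)"
proof -
  have pow: "(Var i ^ k :: 'a mpoly) = Poly_Mapping.single (Poly_Mapping.single i k) 1" for i k
    by (induct k) (auto simp: mult_single single_add[symmetric])
  have "(\<Prod>i\<in>A. Poly_Mapping.single (Poly_Mapping.single i (Poly_Mapping.lookup m i)) (1::'a)) =
      Poly_Mapping.single (\<Sum>i\<in>A. Poly_Mapping.single i (Poly_Mapping.lookup m i)) 1"
    if "finite A" for A
    using that by (induct A) (auto simp: mult_single)
  moreover have "(\<Sum>i\<in>Poly_Mapping.keys m. Poly_Mapping.single i (Poly_Mapping.lookup m i)) = m"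
    by (rule poly_mapping_eqI) (auto simp: lookup_sum lookup_single when_def in_keys_iff)
  ultimately show ?thesis by (simp only: pow finite_keys) (simp add: mult_single)
qed

text \<open>This makes renaming of variables injective: the renaming by a left inverse undoes it.\<close>

lemma mpoly_hom_id:
  fixes f :: "'k::comm_ring_1 mpoly \<Rightarrow> 'k mpoly"
  assumes f: "f \<in> ring_hom type_ring type_ring"
    and "\<And>c. f (Const c) = Const c" "\<And>i. f (Var i) = Var i"
  shows "f p = p"
proof (induct p rule: mpoly_induct)
  case (single m c)
  have mult: "f (a * b) = f a * f b" and one: "f 1 = 1" for a b
    using f by (auto simp: ring_hom_type_ring_iff)
  have pow: "f (a ^ k) = f a ^ k" for a k
    by (induct k) (auto simp: mult one)
  have prod: "f (prod g A) = (\<Prod>i\<in>A. f (g i))" for g :: "nat \<Rightarrow> 'k mpoly" and A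
    by (induct A rule: infinite_finite_induct) (auto simp: mult one)
  show ?case
    unfolding single_eq_Const_mult_Vars[of m c] by (simp only: mult prod pow assms)
qed (use f in \<open>simp add: ring_hom_type_ring_iff\<close>)

lemma Fract_hom: "(\<lambda>p :: 'a::idom. Fract p 1) \<in> ring_hom type_ring type_ring"
  by (simp add: ring_hom_type_ring_iff One_fract_def)

lemma const_ratfun_hom: "const_ratfun \<in> ring_hom type_ring type_ring"
  using ring_hom_trans[OF Const_hom Fract_hom] by (simp add: comp_def const_ratfun_def[abs_def])

text \<open>The value at the generic point is the polynomial itself, so it is zero only for the zero form.\<close>

lemma eval_over_Vars: "eval_over const_ratfun type_ring p var_ratfun = Fract p 1"
  if "homogeneous n d p" for p :: "'k::field mpoly"
proof -
  interpret E: mpoly_eval "type_ring :: 'k mpoly ring" Const Var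
    by (rule mpoly_evalI) (auto intro: Const_hom)
  have "eval_over Const type_ring p Var = p"
    by (rule mpoly_hom_id[OF E.eval_ring_hom]) (rule E.eval_const E.eval_var)+
  then show ?thesis
    using eval_over_natural[OF cring_type_ring cring_type_ring Fract_hom Const_hom that, of Var]
    by (simp add: const_ratfun_def[abs_def] var_ratfun_def[abs_def])
qed

lemma inverse_type_ring [simp]: "x \<noteq> 0 \<Longrightarrow> inv\<^bsub>type_ring\<^esub> x = inverse (x :: 'a::field)"
proof -
  assume x: "x \<noteq> 0"
  interpret cring "type_ring :: 'a ring" ..
  show ?thesis using comm_inv_char[of x "inverse x"] x by simp
qed

lemma ratfun_field_simps:
  "x \<otimes>\<^bsub>ratfun_field m\<^esub> y = x * y" "x \<oplus>\<^bsub>ratfun_field m\<^esub> y = x + y"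
  "\<one>\<^bsub>ratfun_field m\<^esub> = 1" "\<zero>\<^bsub>ratfun_field m\<^esub> = 0"
  "carrier (ratfun_field m) =
     generate_field type_ring (range const_ratfun \<union> var_ratfun ` {..<m})"
  by (simp_all add: ratfun_field_def ring_of_type_algebra_def)

lemma field_ratfun_field: "field (ratfun_field m)"
  unfolding ratfun_field_def by (rule field.generate_field_is_field) auto

lemma const_ratfun_closed [simp]: "const_ratfun c \<in> carrier (ratfun_field m)"
  by (auto simp: ratfun_field_simps intro: generate_field.incl)

lemma var_ratfun_closed [simp]: "i < m \<Longrightarrow> var_ratfun i \<in> carrier (ratfun_field m)"
  by (auto simp: ratfun_field_simps intro: generate_field.incl)

lemma field_extension_ratfun_field: "field_extension const_ratfun (ratfun_field m)"
  using const_ratfun_hom unfolding field_extension_def ring_hom_type_ring_iff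
  by (simp add: ratfun_field_simps(1-4) field_ratfun_field)

lemma cring_ratfun_field: "cring (ratfun_field m)"
  by (rule field_extensionD(2)[OF field_extension_ratfun_field])

lemma ratfun_field_inclusion: "(\<lambda>x. x) \<in> ring_hom (ratfun_field m) type_ring"
  by (rule ring_hom_memI) (auto simp: ratfun_field_simps(1-4))

text \<open>Inside \<open>ratfun_field m\<close> one computes as in the ambient field type, where ordinary algebra is
  available; only membership in the subfield remains to be tracked.\<close>

lemma eval_over_ratfun_field:
  assumes "homogeneous n d p" "\<And>i. i < n \<Longrightarrow> x i \<in> carrier (ratfun_field m)"
  shows "eval_over const_ratfun (ratfun_field m) p x = eval_over const_ratfun type_ring p x"
  using eval_over_natural[OF cring_ratfun_field cring_type_ring ratfun_field_inclusion
      field_extensionD(3)[OF field_extension_ratfun_field] assms] .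

lemma pow_ratfun_field: "x [^]\<^bsub>ratfun_field m\<^esub> (k::nat) = x ^ k"
  by (induct k) (simp_all add: nat_pow_def ratfun_field_simps(1-4) mult.commute)

lemma finprod_ratfun_field:
  assumes "\<And>i. i \<in> A \<Longrightarrow> f i \<in> carrier (ratfun_field m)"
  shows "finprod (ratfun_field m) f A = prod f A"
proof -
  interpret I: ring_hom_cring "ratfun_field m" type_ring "\<lambda>x. x"
    using cring_ratfun_field cring_type_ring ratfun_field_inclusion
    by (auto simp: ring_hom_cring_def ring_hom_cring_axioms_def)
  show ?thesis using I.hom_finprod[of f A] assms by (simp add: comp_def Pi_def)
qed

lemma finsum_ratfun_field:
  assumes "\<And>i. i \<in> A \<Longrightarrow> f i \<in> carrier (ratfun_field m)"
  shows "finsum (ratfun_field m) f A = sum f A"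
proof -
  interpret I: ring_hom_cring "ratfun_field m" type_ring "\<lambda>x. x"
    using cring_ratfun_field cring_type_ring ratfun_field_inclusion
    by (auto simp: ring_hom_cring_def ring_hom_cring_axioms_def)
  show ?thesis using I.hom_finsum[of f A] assms by (simp add: comp_def Pi_def)
qed

text \<open>The value of \<open>\<sigma>\<close> on a fraction does not depend on its representation, because \<open>f\<close> respects
  cross multiplication and keeps denominators nonzero.\<close>

lemma fract_hom_extension:
  fixes f :: "'a::idom \<Rightarrow> 'b::idom"
  assumes f: "f \<in> ring_hom type_ring type_ring" and nz: "\<And>a. a \<noteq> 0 \<Longrightarrow> f a \<noteq> 0"
  obtains \<sigma> where "\<sigma> \<in> ring_hom type_ring type_ring"
    "\<And>a b. b \<noteq> 0 \<Longrightarrow> \<sigma> (Fract a b) = Fract (f a) (f b)"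
proof -
  have f': "f (a * b) = f a * f b" "f (a + b) = f a + f b" "f 1 = 1" for a b
    using f by (auto simp: ring_hom_type_ring_iff)
  define \<sigma> where "\<sigma> q = (THE r. \<exists>a b. b \<noteq> 0 \<and> q = Fract a b \<and> r = Fract (f a) (f b))" for q
  have \<sigma>: "\<sigma> (Fract a b) = Fract (f a) (f b)" if "b \<noteq> 0" for a b
    unfolding \<sigma>_def
  proof (rule the_equality)
    show "\<exists>a' b'. b' \<noteq> 0 \<and> Fract a b = Fract a' b' \<and> Fract (f a) (f b) = Fract (f a') (f b')"
      using that by blast
  next
    fix r assume "\<exists>a' b'. b' \<noteq> 0 \<and> Fract a b = Fract a' b' \<and> r = Fract (f a') (f b')"
    then obtain a' b' where r: "b' \<noteq> 0" "a * b' = a' * b" "r = Fract (f a') (f b')"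
      using \<open>b \<noteq> 0\<close> by (auto simp: eq_fract)
    have "f a' * f b = f a * f b'" using r(2) by (metis f'(1))
    then show "r = Fract (f a) (f b)" using r that nz by (simp add: eq_fract)
  qed
  have "\<sigma> (x * y) = \<sigma> x * \<sigma> y" "\<sigma> (x + y) = \<sigma> x + \<sigma> y" for x y
    by (cases x, cases y, simp add: \<sigma> nz f')+
  moreover have "\<sigma> 1 = 1" using \<sigma>[of 1 1] by (simp add: One_fract_def f')
  ultimately show thesis using that[of \<sigma>] \<sigma> by (simp add: ring_hom_type_ring_iff)
qed

text \<open>Renaming the indeterminates along an injection is an endomorphism of the rational function
  field in all indeterminates. In this way the generic points of the summands become blocks of
  the generic point of the direct sum.\<close>

lemma rename_ratfun:
  assumes inj: "inj \<rho>"
  obtains \<sigma> :: "'k::field ratfun \<Rightarrow> 'k ratfun"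
  where "\<sigma> \<in> ring_hom type_ring type_ring" "\<And>c. \<sigma> (const_ratfun c) = const_ratfun c"
    "\<And>i. \<sigma> (var_ratfun i) = var_ratfun (\<rho> i)"
    "\<And>m m'. \<rho> ` {..<m} \<subseteq> {..<m'} \<Longrightarrow> \<sigma> \<in> ring_hom (ratfun_field m) (ratfun_field m')"
proof -
  let ?f = "\<lambda>\<rho> p :: 'k mpoly. eval_over Const type_ring p (\<lambda>i. Var (\<rho> i))"
  have E: "mpoly_eval (type_ring :: 'k mpoly ring) Const (\<lambda>i. Var (\<rho> i))" for \<rho>
    by (rule mpoly_evalI) (auto intro: Const_hom)
  note hom = mpoly_eval.eval_ring_hom[OF E]
    and const = mpoly_eval.eval_const[OF E] and var = mpoly_eval.eval_var[OF E]
  have left_inv: "?f (inv_into UNIV \<rho>) (?f \<rho> p) = p" for p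
  proof (rule mpoly_hom_id)
    show "(\<lambda>p. ?f (inv_into UNIV \<rho>) (?f \<rho> p)) \<in> ring_hom type_ring type_ring"
      using ring_hom_trans[OF hom[of \<rho>] hom[of "inv_into UNIV \<rho>"]] by (simp only: comp_def)
    show "?f (inv_into UNIV \<rho>) (?f \<rho> (Const c)) = Const c" for c by (simp only: const)
    show "?f (inv_into UNIV \<rho>) (?f \<rho> (Var i)) = Var i" for i by (simp only: var inv_into_f_f[OF inj UNIV_I])
  qed
  have "?f \<rho> p \<noteq> 0" if "p \<noteq> 0" for p
  proof
    assume "?f \<rho> p = 0"
    then have "p = ?f (inv_into UNIV \<rho>) 0" using left_inv[of p] by simp
    also have "\<dots> = 0" by (simp add: eval_over_def)
    finally show False using that by simp
  qed
  then obtain \<sigma> where \<sigma>: "\<sigma> \<in> ring_hom type_ring type_ring"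
    and F: "\<And>a b. b \<noteq> 0 \<Longrightarrow> \<sigma> (Fract a b) = Fract (?f \<rho> a) (?f \<rho> b)"
    using fract_hom_extension[OF hom[of \<rho>]] by blast
  have one: "?f \<rho> 1 = 1" using const[where c = 1] by simp
  have \<sigma>c: "\<sigma> (const_ratfun c) = const_ratfun c" for c
    unfolding const_ratfun_def by (subst F) (simp_all only: const one, simp)
  have \<sigma>v: "\<sigma> (var_ratfun i) = var_ratfun (\<rho> i)" for i
    unfolding var_ratfun_def by (subst F) (simp_all only: var one, simp)
  have \<sigma>': "\<sigma> (x * y) = \<sigma> x * \<sigma> y" "\<sigma> (x + y) = \<sigma> x + \<sigma> y" "\<sigma> 1 = 1" for x y
    using \<sigma> by (auto simp: ring_hom_type_ring_iff)
  have "\<sigma> 0 + \<sigma> 0 = \<sigma> 0 + 0" by (simp only: \<sigma>'(2)[symmetric] add_0_right)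
  then have \<sigma>0: "\<sigma> 0 = 0" by (simp only: add_left_cancel)
  have \<sigma>_minus: "\<sigma> (- x) = - \<sigma> x" for x
    using \<sigma>'(2)[of "- x" x] \<sigma>0 by (simp add: eq_neg_iff_add_eq_0)
  have \<sigma>_inv: "\<sigma> (inverse x) = inverse (\<sigma> x)" "\<sigma> x \<noteq> 0" if "x \<noteq> 0" for x
  proof -
    have "\<sigma> (inverse x) * \<sigma> x = 1" using that \<sigma>' by (metis left_inverse)
    then show "\<sigma> (inverse x) = inverse (\<sigma> x)" "\<sigma> x \<noteq> 0"
      using inverse_unique[of "\<sigma> x" "\<sigma> (inverse x)"] by (auto simp: mult.commute)
  qed
  have "\<sigma> \<in> ring_hom (ratfun_field m) (ratfun_field m')" if \<rho>: "\<rho> ` {..<m} \<subseteq> {..<m'}" for m m'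
  proof (rule ring_hom_memI)
    fix x :: "'k ratfun" assume "x \<in> carrier (ratfun_field m)"
    then show "\<sigma> x \<in> carrier (ratfun_field m')" unfolding ratfun_field_simps(5)
    proof (induct rule: generate_field.induct)
      case one
      then show ?case using generate_field.one[of type_ring] \<sigma>' by simp
    next
      case (incl h)
      then show ?case using \<sigma>c \<sigma>v \<rho> by (intro generate_field.incl) auto
    next
      case (a_inv h)
      then show ?case using generate_field.a_inv[OF a_inv(2)] by (simp add: \<sigma>_minus)
    next
      case (m_inv h)
      then show ?case using generate_field.m_inv[OF m_inv(2)] \<sigma>_inv by simp
    next
      case (eng_add h1 h2)
      then show ?case using generate_field.eng_add[OF eng_add(2,4)] by (simp add: \<sigma>')
    next
      case (eng_mult h1 h2)
      then show ?case using generate_field.eng_mult[OF eng_mult(2,4)] by (simp add: \<sigma>')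
    qed
  qed (simp_all add: ratfun_field_simps(1-4) \<sigma>')
  with \<sigma> \<sigma>c \<sigma>v show thesis using that by blast
qed

text \<open>The matrix of the isomorphism is renamed together with the factor \<open>a\<close>. The identity between the
  forms is only known at points over \<open>ratfun_field m\<close>; as these include the points with coordinates
  \<open>0, \<dots>, d\<close>, it is an identity of polynomials and survives the renaming.\<close>

lemma isomorphic_over_rename:
  fixes p :: "'k::field mpoly" and \<sigma> :: "'k ratfun \<Rightarrow> 'k ratfun"
  assumes char: "CHAR('k) = 0 \<or> CHAR('k) > d" and p: "homogeneous n d p"
    and \<sigma>: "\<sigma> \<in> ring_hom type_ring type_ring" "\<And>c. \<sigma> (const_ratfun c) = const_ratfun c"
    and \<sigma>m: "\<sigma> \<in> ring_hom (ratfun_field m) (ratfun_field m')"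
    and a: "a \<in> carrier (ratfun_field m)"
    and iso: "isomorphic_over (ratfun_field m) n
      (\<lambda>x. a \<otimes>\<^bsub>ratfun_field m\<^esub> eval_over const_ratfun (ratfun_field m) p x)
      (eval_over const_ratfun (ratfun_field m) p)"
  shows "isomorphic_over (ratfun_field m') n
      (\<lambda>x. \<sigma> a \<otimes>\<^bsub>ratfun_field m'\<^esub> eval_over const_ratfun (ratfun_field m') p x)
      (eval_over const_ratfun (ratfun_field m') p)"
proof -
  let ?K = "ratfun_field m :: 'k ratfun ring" and ?K' = "ratfun_field m' :: 'k ratfun ring"
  interpret K: plain_cring ?K unfolding plain_cring_def by (rule cring_ratfun_field)
  interpret K': plain_cring ?K' unfolding plain_cring_def by (rule cring_ratfun_field)
  obtain T T' where T: "inverse_linear ?K n n T T'"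
    and ev: "\<And>x. x \<in> vecs ?K n \<Longrightarrow>
      a * eval_over const_ratfun ?K p (T x) = eval_over const_ratfun ?K p x"
    using iso unfolding isomorphic_over_iff[OF cring_ratfun_field] ratfun_field_simps(1) by blast
  obtain M N where NM: "left_inverse_matrix ?K n n N M" and MN: "left_inverse_matrix ?K n n M N"
    and TM: "\<And>x. x \<in> vecs ?K n \<Longrightarrow> T x = mat_apply ?K n n M x"
    using K.inverse_linear_matrices[OF T] by blast
  have Mc: "M i j \<in> carrier ?K" if "i < n" "j < n" for i j
    using NM that by (auto simp: left_inverse_matrix_def)
  let ?M = "\<lambda>i j. \<sigma> (M i j)" and ?N = "\<lambda>i j. \<sigma> (N i j)"
  have Mc': "?M i j \<in> carrier ?K'" if "i < n" "j < n" for i j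
    using Mc[OF that] ring_hom_closed[OF \<sigma>m] by blast
  have inv: "inverse_linear ?K' n n (mat_apply ?K' n n ?M) (mat_apply ?K' n n ?N)"
    by (rule K'.inverse_matrices_inverse_linear; rule left_inverse_matrix_hom)
      (rule cring_ratfun_field \<sigma>m NM MN)+
  have "\<sigma> a * eval_over const_ratfun ?K' p (mat_apply ?K' n n ?M y) =
      eval_over const_ratfun ?K' p y" if y: "y \<in> vecs ?K' n" for y
  proof -
    note yc = vecs_closed[OF y]
    let ?S = "const_ratfun ` of_nat ` {..d} :: 'k ratfun set"
    have "\<sigma> a \<otimes>\<^bsub>type_ring\<^esub> eval_over (\<lambda>c. \<sigma> (const_ratfun c)) type_ring p
        (\<lambda>i. \<Oplus>\<^bsub>type_ring\<^esub>j\<in>{..<n}. \<sigma> (M i j) \<otimes>\<^bsub>type_ring\<^esub> y j) =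
      eval_over (\<lambda>c. \<sigma> (const_ratfun c)) type_ring p y"
    proof (rule linear_substitution_identity_transfer[OF p p const_ratfun_hom cring_type_ring \<sigma>(1),
          where S = ?S])
      have "inj (const_ratfun :: 'k \<Rightarrow> 'k ratfun)"
      proof (rule injI)
        fix x y :: 'k assume "const_ratfun x = const_ratfun y"
        then have "Const x = Const y" by (simp add: const_ratfun_def eq_fract)
        then show "x = y" by (metis lookup_single_eq)
      qed
      then show "d < card ?S"
        using card_of_nat_image[OF char] by (simp add: card_image inj_on_subset)
    next
      fix x :: "nat \<Rightarrow> 'k ratfun" assume x: "\<And>j. x j \<in> ?S"
      have xc: "x j \<in> carrier ?K" for j using x[of j] by (elim imageE) simp
      have "a * eval_over const_ratfun type_ring p (\<lambda>i. \<Sum>j<n. M i j * x j) =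
          a * eval_over const_ratfun type_ring p (mat_apply ?K n n M x)"
      proof -
        have "(\<Oplus>\<^bsub>?K\<^esub>j\<in>{..<n}. M i j \<otimes>\<^bsub>?K\<^esub> x j) = (\<Sum>j<n. M i j \<otimes>\<^bsub>?K\<^esub> x j)" if "i < n" for i
          by (rule finsum_ratfun_field) (use Mc[OF that] xc in auto)
        then have M_sum: "(\<Sum>j<n. M i j * x j) = mat_apply ?K n n M x i" if "i < n" for i
          using that by (simp add: mat_apply_def ratfun_field_simps(1))
        have "eval_over const_ratfun type_ring p (\<lambda>i. \<Sum>j<n. M i j * x j) =
            eval_over const_ratfun type_ring p (mat_apply ?K n n M x)"
          by (rule eval_over_cong[OF cring_type_ring const_ratfun_hom p]) (simp_all add: M_sum)
        then show ?thesis by simp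
      qed
      also have "mat_apply ?K n n M x = mat_apply ?K n n M (restrict x {..<n})"
        unfolding mat_apply_def
        by (intro restrict_ext K.finsum_cong') (use Mc xc in auto)
      also have "\<dots> = T (restrict x {..<n})" using TM xc by simp
      also have "a * eval_over const_ratfun type_ring p \<dots> =
          a * eval_over const_ratfun ?K p (T (restrict x {..<n}))"
      proof -
        have Tx: "T (restrict x {..<n}) \<in> vecs ?K n"
          using T xc by (auto simp: inverse_linear_def linear_over_def)
        show ?thesis by (simp only: eval_over_ratfun_field[OF p vecs_closed[OF Tx]])
      qed
      also have "\<dots> = eval_over const_ratfun ?K p (restrict x {..<n})" using ev xc by simp
      also have "\<dots> = eval_over const_ratfun type_ring p (restrict x {..<n})"
        using eval_over_ratfun_field[OF p, of "restrict x {..<n}" m] xc by simp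
      also have "\<dots> = eval_over const_ratfun type_ring p x"
        by (rule eval_over_cong[OF cring_type_ring const_ratfun_hom p]) auto
      finally show "a * eval_over const_ratfun type_ring p (\<lambda>i. \<Sum>j<n. M i j * x j) =
          eval_over const_ratfun type_ring p x" .
    qed auto
    then have eq: "\<sigma> a * eval_over const_ratfun type_ring p (\<lambda>i. \<Sum>j<n. \<sigma> (M i j) * y j) =
        eval_over const_ratfun type_ring p y" by (simp add: \<sigma>(2))
    have app: "mat_apply ?K' n n ?M y \<in> vecs ?K' n"
      using Mc' yc by (rule K'.mat_apply_closed)
    have "(\<Oplus>\<^bsub>?K'\<^esub>j\<in>{..<n}. ?M i j \<otimes>\<^bsub>?K'\<^esub> y j) = (\<Sum>j<n. ?M i j \<otimes>\<^bsub>?K'\<^esub> y j)" if "i < n" for i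
      by (rule finsum_ratfun_field) (use Mc'[OF that] yc in auto)
    then have M_sum: "mat_apply ?K' n n ?M y i = (\<Sum>j<n. \<sigma> (M i j) * y j)" if "i < n" for i
      using that by (simp add: mat_apply_def ratfun_field_simps(1))
    have "eval_over const_ratfun type_ring p (mat_apply ?K' n n ?M y) =
        eval_over const_ratfun type_ring p (\<lambda>i. \<Sum>j<n. \<sigma> (M i j) * y j)"
      by (rule eval_over_cong[OF cring_type_ring const_ratfun_hom p]) (simp_all add: M_sum)
    then show ?thesis
      using eq eval_over_ratfun_field[OF p, of y m'] yc
        eval_over_ratfun_field[OF p, of "mat_apply ?K' n n ?M y" m'] vecs_closed[OF app] by simp
  qed
  with inv show ?thesis
    unfolding isomorphic_over_iff[OF cring_ratfun_field] ratfun_field_simps(1) by blast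
qed

section \<open>Values and similarity factors over all extension fields\<close>

text \<open>Points over \<open>K\<close> are lifted to \<open>L\<close> by \<open>f\<close>, and \<open>g\<close> maps the identity that holds there back
  to \<open>K\<close>.\<close>

lemma isomorphic_over_hom_image:
  assumes L: "cring L" and K: "cring K" and g: "g \<in> ring_hom L K"
    and f: "\<And>x. x \<in> carrier K \<Longrightarrow> f x \<in> carrier L \<and> g (f x) = x"
    and h: "h \<in> ring_hom type_ring L" and p: "homogeneous n d p" and a: "a \<in> carrier L"
    and iso: "isomorphic_over L n (\<lambda>x. a \<otimes>\<^bsub>L\<^esub> eval_over h L p x) (eval_over h L p)"
  shows "isomorphic_over K n (\<lambda>x. g a \<otimes>\<^bsub>K\<^esub> eval_over (\<lambda>c. g (h c)) K p x)
    (eval_over (\<lambda>c. g (h c)) K p)"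
proof -
  interpret L: plain_cring L unfolding plain_cring_def by (rule L)
  interpret K: plain_cring K unfolding plain_cring_def by (rule K)
  let ?h = "\<lambda>c. g (h c)"
  have gh: "?h \<in> ring_hom type_ring K"
    using ring_hom_trans[OF h g] by (simp add: comp_def)
  obtain T T' where T: "inverse_linear L n n T T'"
    and ev: "\<And>x. x \<in> vecs L n \<Longrightarrow> a \<otimes>\<^bsub>L\<^esub> eval_over h L p (T x) = eval_over h L p x"
    using iso unfolding isomorphic_over_iff[OF L] by blast
  obtain M N where NM: "left_inverse_matrix L n n N M" and MN: "left_inverse_matrix L n n M N"
    and TM: "\<And>x. x \<in> vecs L n \<Longrightarrow> T x = mat_apply L n n M x"
    using L.inverse_linear_matrices[OF T] by blast
  have Mc: "M i j \<in> carrier L" if "i < n" "j < n" for i j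
    using NM that by (auto simp: left_inverse_matrix_def)
  let ?M = "\<lambda>i j. g (M i j)" and ?N = "\<lambda>i j. g (N i j)"
  have inv: "inverse_linear K n n (mat_apply K n n ?M) (mat_apply K n n ?N)"
    by (rule K.inverse_matrices_inverse_linear; rule left_inverse_matrix_hom) (rule L K g NM MN)+
  have "g a \<otimes>\<^bsub>K\<^esub> eval_over ?h K p (mat_apply K n n ?M x) = eval_over ?h K p x"
    if x: "x \<in> vecs K n" for x
  proof -
    let ?y = "\<lambda>i\<in>{..<n}. f (x i)"
    have xf: "f (x i) \<in> carrier L" "g (f (x i)) = x i" if "i < n" for i
      using f vecs_closed[OF x that] by auto
    have y: "?y \<in> vecs L n" using xf by simp
    have My: "mat_apply L n n M ?y \<in> vecs L n"
      by (rule L.mat_apply_closed) (use Mc xf in auto)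
    have "g (a \<otimes>\<^bsub>L\<^esub> eval_over h L p (mat_apply L n n M ?y)) = g (eval_over h L p ?y)"
      using ev[OF y] TM[OF y] by simp
    moreover have "g (a \<otimes>\<^bsub>L\<^esub> eval_over h L p (mat_apply L n n M ?y)) =
        g a \<otimes>\<^bsub>K\<^esub> eval_over ?h K p (\<lambda>i. g (mat_apply L n n M ?y i))"
      using ring_hom_mult[OF g a] eval_over_closed[OF L h p] vecs_closed[OF My]
        eval_over_natural[OF L K g h p] by simp
    moreover have "eval_over ?h K p (\<lambda>i. g (mat_apply L n n M ?y i)) =
        eval_over ?h K p (mat_apply K n n ?M x)"
    proof (rule eval_over_cong[OF K gh p])
      fix i assume i: "i < n"
      have "g (mat_apply L n n M ?y i) = mat_apply K n n ?M (\<lambda>j. g (?y j)) i"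
        by (rule mat_apply_hom[OF L K g]) (use Mc xf i in auto)
      also have "\<dots> = mat_apply K n n ?M x i"
        using i Mc ring_hom_closed[OF g] vecs_closed[OF x] xf
        by (auto simp: mat_apply_def intro!: K.finsum_cong')
      finally show "g (mat_apply L n n M ?y i) = mat_apply K n n ?M x i" .
      show "mat_apply K n n ?M x i \<in> carrier K"
        using vecs_closed[OF K.mat_apply_closed[of n n ?M x], of i] i Mc ring_hom_closed[OF g]
          vecs_closed[OF x] by auto
    qed
    moreover have "g (eval_over h L p ?y) = eval_over ?h K p (\<lambda>i. g (?y i))"
      by (rule eval_over_natural[OF L K g h p]) (use xf in auto)
    moreover have "eval_over ?h K p (\<lambda>i. g (?y i)) = eval_over ?h K p x"
      by (rule eval_over_cong[OF K gh p]) (use xf vecs_closed[OF x] in auto)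
    ultimately show ?thesis by simp
  qed
  with inv show ?thesis unfolding isomorphic_over_iff[OF K] by blast
qed

text \<open>A type with at least as many elements as the rational function field carries isomorphic
  copies of its subfields. Hypotheses on extension fields with carrier in that type apply to these
  copies and can be pulled back.\<close>

lemma ratfun_field_copy:
  fixes f :: "'k::field ratfun \<Rightarrow> 'u"
  assumes f: "inj f"
  obtains h :: "'k \<Rightarrow> 'u" and L g where "field_extension h L" "g \<in> ring_hom L (ratfun_field m)"
    "\<And>c. g (h c) = const_ratfun c" "f \<in> ring_hom (ratfun_field m) L" "\<And>x. g (f x) = x"
proof -
  let ?K = "ratfun_field m :: 'k ratfun ring"
  let ?L = "image_ring f ?K"
  have fh: "f \<in> ring_hom ?K ?L"
    using inj_imp_image_ring_iso[OF inj_on_subset[OF f]] by (auto simp: ring_iso_def)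
  have gh: "inv_into UNIV f \<in> ring_hom ?L ?K"
    using inj_imp_image_ring_inv_iso[OF f] by (auto simp: ring_iso_def)
  have gf: "inv_into UNIV f (f x) = x" for x using f by simp
  have "field ?L"
    using field.inj_imp_image_ring_is_field[OF field_ratfun_field inj_on_subset[OF f]] by blast
  moreover have "f \<circ> const_ratfun \<in> ring_hom type_ring ?L"
    by (rule ring_hom_trans[OF field_extensionD(3)[OF field_extension_ratfun_field] fh])
  ultimately have "field_extension (f \<circ> const_ratfun) ?L" by (simp add: field_extension_def)
  then show thesis using that[OF _ gh _ fh] gf by simp
qed

lemma ring_hom_Units:
  assumes "f \<in> ring_hom K L" "a \<in> Units K"
  shows "f a \<in> Units L"
proof -
  obtain b where b: "a \<in> carrier K" "b \<in> carrier K" "a \<otimes>\<^bsub>K\<^esub> b = \<one>\<^bsub>K\<^esub>" "b \<otimes>\<^bsub>K\<^esub> a = \<one>\<^bsub>K\<^esub>"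
    using assms(2) by (auto simp: Units_def)
  then have "f a \<otimes>\<^bsub>L\<^esub> f b = \<one>\<^bsub>L\<^esub>" "f b \<otimes>\<^bsub>L\<^esub> f a = \<one>\<^bsub>L\<^esub>"
    by (metis assms(1) ring_hom_mult ring_hom_one)+
  then show ?thesis using b ring_hom_closed[OF assms(1)] unfolding Units_def by blast
qed

lemma D_over_ratfun_field:
  fixes scale :: "'k::field \<Rightarrow> 'v::ab_group_add \<Rightarrow> 'v" and f :: "'k ratfun \<Rightarrow> 'u"
  assumes f: "inj f" and vs: "vector_space scale" and char: "CHAR('k) = 0 \<or> CHAR('k) > d"
    and c: "coordinates scale d V \<phi> n b p"
    and D: "\<And>(h :: 'k \<Rightarrow> 'u) L. field_extension h L \<Longrightarrow> D_over scale h L d V \<phi> = Units L"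
  shows "D_over scale const_ratfun (ratfun_field m) d V \<phi> = Units (ratfun_field m)"
proof (intro equalityI subsetI)
  fix a assume a: "a \<in> Units (ratfun_field m :: 'k ratfun ring)"
  obtain h :: "'k \<Rightarrow> 'u" and L g where ext: "field_extension h L"
    and g: "g \<in> ring_hom L (ratfun_field m)" "\<And>c. g (h c) = const_ratfun c"
    and fh: "f \<in> ring_hom (ratfun_field m) L" and gf: "\<And>x. g (f x) = x"
    using ratfun_field_copy[OF f] by metis
  have "f a \<in> D_over scale h L d V \<phi>" using D[OF ext] ring_hom_Units[OF fh a] by simp
  then obtain x where x: "x \<in> vecs L n" "eval_over h L p x = f a"
    using D_over_iff[OF vs char c ext] by blast
  note L = field_extensionD[OF ext]
  have p: "homogeneous n d p" using c by (simp add: coordinates_def)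
  let ?y = "\<lambda>i\<in>{..<n}. g (x i)"
  have xc: "g (x i) \<in> carrier (ratfun_field m)" if "i < n" for i
    using ring_hom_closed[OF g(1) vecs_closed[OF x(1) that]] .
  have "a = g (eval_over h L p x)" using x(2) gf by simp
  also have "\<dots> = eval_over const_ratfun (ratfun_field m) p (\<lambda>i. g (x i))"
    using eval_over_natural[OF L(2) cring_ratfun_field g(1) L(3) p] vecs_closed[OF x(1)] g(2)
    by simp
  also have "\<dots> = eval_over const_ratfun (ratfun_field m) p ?y"
    by (rule eval_over_cong[OF cring_ratfun_field
          field_extensionD(3)[OF field_extension_ratfun_field] p]) (use xc in auto)
  finally have "eval_over const_ratfun (ratfun_field m) p ?y = a" by simp
  moreover have "?y \<in> vecs (ratfun_field m) n" using xc by simp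
  ultimately show "a \<in> D_over scale const_ratfun (ratfun_field m) d V \<phi>"
    using a D_over_iff[OF vs char c field_extension_ratfun_field] by blast
qed (simp add: D_over_def)

lemma G_over_ratfun_field:
  fixes scale :: "'k::field \<Rightarrow> 'v::ab_group_add \<Rightarrow> 'v" and f :: "'k ratfun \<Rightarrow> 'u"
  assumes f: "inj f" and vs: "vector_space scale" and char: "CHAR('k) = 0 \<or> CHAR('k) > d"
    and c: "coordinates scale d V \<phi> n b p"
    and G: "\<And>(h :: 'k \<Rightarrow> 'u) L. field_extension h L \<Longrightarrow> G_over scale h L d V \<phi> = Units L"
  shows "G_over scale const_ratfun (ratfun_field m) d V \<phi> = Units (ratfun_field m)"
proof (intro equalityI subsetI)
  fix a assume a: "a \<in> Units (ratfun_field m :: 'k ratfun ring)"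
  obtain h :: "'k \<Rightarrow> 'u" and L g where ext: "field_extension h L"
    and g: "g \<in> ring_hom L (ratfun_field m)" "\<And>c. g (h c) = const_ratfun c"
    and fh: "f \<in> ring_hom (ratfun_field m) L" and gf: "\<And>x. g (f x) = x"
    using ratfun_field_copy[OF f] by metis
  note L = field_extensionD[OF ext]
  have p: "homogeneous n d p" using c by (simp add: coordinates_def)
  have "f a \<in> G_over scale h L d V \<phi>" using G[OF ext] ring_hom_Units[OF fh a] by simp
  then have "f a \<in> carrier L"
    "isomorphic_over L n (\<lambda>x. f a \<otimes>\<^bsub>L\<^esub> eval_over h L p x) (eval_over h L p)"
    using G_over_iff[OF vs char c ext] by (auto simp: Units_def)
  from isomorphic_over_hom_image[OF L(2) cring_ratfun_field g(1), where f = f, OF _ L(3) p this]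
  have "isomorphic_over (ratfun_field m) n
      (\<lambda>x. a \<otimes>\<^bsub>ratfun_field m\<^esub> eval_over const_ratfun (ratfun_field m) p x)
      (eval_over const_ratfun (ratfun_field m) p)"
    using ring_hom_closed[OF fh] gf g(2) by simp
  then show "a \<in> G_over scale const_ratfun (ratfun_field m) d V \<phi>"
    using a G_over_iff[OF vs char c field_extension_ratfun_field] by blast
qed (simp add: G_over_def)

text \<open>Let \<open>E\<close> be the product of the \<open>\<phi>\<^sub>i(v\<^sub>i) ^ s\<^sub>i\<close> over \<open>i \<noteq> i\<^sub>0\<close> for vectors \<open>v\<^sub>i\<close> with \<open>\<phi>\<^sub>i(v\<^sub>i) \<noteq> 0\<close>. To
  represent \<open>a\<close>, take the \<open>v\<^sub>i\<close> and in the block of \<open>i\<^sub>0\<close> a point with value \<open>a / E\<close>.\<close>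

lemma D_over_direct_sum:
  fixes scale :: "'k::field \<Rightarrow> 'v::ab_group_add \<Rightarrow> 'v"
  assumes vs: "vector_space scale" and char: "CHAR('k) = 0 \<or> CHAR('k) > (\<Sum>i\<in>{1..r}. ds i * s i)"
    and c: "\<And>i. i \<in> {1..r} \<Longrightarrow> coordinates scale (ds i) (W i) (\<phi>s i) (ns i) (bs i) (ps i)"
    and cV: "coordinates scale (\<Sum>i\<in>{1..r}. ds i * s i) V \<phi> (total_dim ns r) b (prod_poly ns s r ps)"
    and ext: "field_extension h L" and i0: "i0 \<in> {1..r}" "s i0 = 1"
    and nz: "\<And>i. i \<in> {1..r} \<Longrightarrow> \<exists>v\<in>W i. \<phi>s i v \<noteq> 0"
    and D: "D_over scale h L (ds i0) (W i0) (\<phi>s i0) = Units L"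
  shows "D_over scale h L (\<Sum>i\<in>{1..r}. ds i * s i) V \<phi> = Units L"
proof (intro equalityI subsetI)
  fix a assume a: "a \<in> Units L"
  note L = field_extensionD[OF ext]
  interpret L: field L by (rule L(1))
  interpret h: ring_hom_cring "type_ring :: 'k ring" L h
    using L by (auto simp: ring_hom_cring_def ring_hom_cring_axioms_def)
  have hc [simp]: "h e \<in> carrier L" for e by (rule h.hom_closed) simp
  have h1: "h 1 = \<one>\<^bsub>L\<^esub>" using h.hom_one by simp
  have hm: "h (x * y) = h x \<otimes>\<^bsub>L\<^esub> h y" for x y using h.hom_mult[of x y] by simp
  have ac: "a \<in> carrier L" using a by auto
  have p: "homogeneous (ns i) (ds i) (ps i)" if "i \<in> {1..r}" for i
    using c[OF that] by (simp add: coordinates_def)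
  have "\<exists>y e. y \<in> vecs L (ns i) \<and> e \<noteq> 0 \<and> eval_over h L (ps i) y = h e" if i: "i \<in> {1..r}" for i
  proof -
    obtain v where v: "v \<in> W i" "\<phi>s i v \<noteq> 0" using nz[OF i] by blast
    have b: "is_basis scale (W i) (ns i) (bs i)"
      and ev: "\<And>x. \<phi>s i (\<Sum>j<ns i. scale (x j) (bs i j)) = eval_over id type_ring (ps i) x"
      using c[OF i] by (auto simp: coordinates_def)
    obtain x where "v = (\<Sum>j<ns i. scale (x j) (bs i j))"
      using b v(1) unfolding is_basis_iff[OF vs] by blast
    then have "h (\<phi>s i v) = eval_over h L (ps i) (\<lambda>j. h (x j))"
      using ev eval_over_natural[OF cring_type_ring L(2,3) id_ring_hom p[OF i], of x] by simp
    also have "\<dots> = eval_over h L (ps i) (\<lambda>j\<in>{..<ns i}. h (x j))"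
      by (rule eval_over_cong[OF L(2,3) p[OF i]]) auto
    finally show ?thesis
      using v(2) by (intro exI[of _ "\<lambda>j\<in>{..<ns i}. h (x j)"] exI[of _ "\<phi>s i v"]) auto
  qed
  then obtain y e where y: "\<And>i. i \<in> {1..r} \<Longrightarrow> y i \<in> vecs L (ns i)"
    and e: "\<And>i. i \<in> {1..r} \<Longrightarrow> e i \<noteq> 0"
    and ev: "\<And>i. i \<in> {1..r} \<Longrightarrow> eval_over h L (ps i) (y i) = h (e i)" by metis
  let ?R = "{1..r} - {i0}"
  define E where "E = (\<Prod>i\<in>?R. e i ^ s i)"
  have E: "E \<noteq> 0" using e unfolding E_def by (simp add: prod_zero_iff)
  have "inverse E \<in> Units type_ring"
    using E by (auto simp: Units_def intro!: exI[of _ E])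
  then have "a \<otimes>\<^bsub>L\<^esub> h (inverse E) \<in> Units L"
    using a ring_hom_Units[OF L(3)] by blast
  moreover have char0: "CHAR('k) = 0 \<or> CHAR('k) > ds i0"
  proof -
    have "ds i0 * s i0 \<le> (\<Sum>i\<in>{1..r}. ds i * s i)"
      by (rule member_le_sum[OF i0(1)]) auto
    then show ?thesis using char i0(2) by auto
  qed
  ultimately obtain x0 where x0: "x0 \<in> vecs L (ns i0)"
    "eval_over h L (ps i0) x0 = a \<otimes>\<^bsub>L\<^esub> h (inverse E)"
    using D D_over_iff[OF vs char0 c[OF i0(1)] ext] by blast
  define x where "x i = (if i = i0 then x0 else y i)" for i
  have x: "x i \<in> vecs L (ns i)" if "i \<in> {1..r}" for i
    using x0 y that by (simp add: x_def)
  have jc: "join_blocks ns r x \<in> vecs L (total_dim ns r)" by (rule join_vecs) (rule x)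
  have "eval_over h L (prod_poly ns s r ps) (join_blocks ns r x) =
      (\<Otimes>\<^bsub>L\<^esub>i\<in>{1..r}. eval_over h L (ps i) (block ns i (join_blocks ns r x)) [^]\<^bsub>L\<^esub> s i)"
    by (rule eval_prod_poly[OF L(2,3) p]) (use vecs_closed[OF jc] in auto)
  also have "\<dots> = (\<Otimes>\<^bsub>L\<^esub>i\<in>insert i0 ?R. eval_over h L (ps i) (x i) [^]\<^bsub>L\<^esub> s i)"
  proof (rule L.finprod_cong')
    show "(\<lambda>i. eval_over h L (ps i) (x i) [^]\<^bsub>L\<^esub> s i) \<in> insert i0 ?R \<rightarrow> carrier L"
      using eval_over_closed[OF L(2,3) p] vecs_closed[OF x] i0(1) by (auto intro!: L.nat_pow_closed)
    show "eval_over h L (ps i) (block ns i (join_blocks ns r x)) [^]\<^bsub>L\<^esub> s i =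
        eval_over h L (ps i) (x i) [^]\<^bsub>L\<^esub> s i" if "i \<in> insert i0 ?R" for i
      using block_join[of i r x L ns] x that i0(1) by auto
  qed (use i0(1) in auto)
  also have "\<dots> = eval_over h L (ps i0) (x i0) [^]\<^bsub>L\<^esub> s i0 \<otimes>\<^bsub>L\<^esub>
      (\<Otimes>\<^bsub>L\<^esub>i\<in>?R. eval_over h L (ps i) (x i) [^]\<^bsub>L\<^esub> s i)"
    by (rule L.finprod_insert)
      (use eval_over_closed[OF L(2,3) p] vecs_closed[OF x] i0(1) in \<open>auto intro!: L.nat_pow_closed\<close>)
  also have "(\<Otimes>\<^bsub>L\<^esub>i\<in>?R. eval_over h L (ps i) (x i) [^]\<^bsub>L\<^esub> s i) = h E"
  proof -
    have pow: "h (u ^ k) = h u [^]\<^bsub>L\<^esub> k" for u k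
      by (induct k) (auto simp: h1 hm L.m_comm)
    have "h (finprod type_ring (\<lambda>i. e i ^ s i) ?R) =
        (\<Otimes>\<^bsub>L\<^esub>i\<in>?R. (h \<circ> (\<lambda>i. e i ^ s i)) i)"
      by (rule h.hom_finprod) auto
    then have "h E = (\<Otimes>\<^bsub>L\<^esub>i\<in>?R. (h \<circ> (\<lambda>i. e i ^ s i)) i)" by (simp add: E_def)
    also have "\<dots> = (\<Otimes>\<^bsub>L\<^esub>i\<in>?R. eval_over h L (ps i) (x i) [^]\<^bsub>L\<^esub> s i)"
      by (rule L.finprod_cong') (auto simp: pow ev x_def)
    finally show ?thesis by simp
  qed
  also have "eval_over h L (ps i0) (x i0) [^]\<^bsub>L\<^esub> s i0 \<otimes>\<^bsub>L\<^esub> h E = a"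
  proof -
    have "eval_over h L (ps i0) (x i0) [^]\<^bsub>L\<^esub> s i0 = a \<otimes>\<^bsub>L\<^esub> h (inverse E)"
      using x0(2) i0(2) ac by (simp add: x_def)
    moreover have "h (inverse E) \<otimes>\<^bsub>L\<^esub> h E = \<one>\<^bsub>L\<^esub>"
      using E by (simp add: h1 flip: hm)
    ultimately show ?thesis using ac by (simp add: L.m_assoc)
  qed
  finally show "a \<in> D_over scale h L (\<Sum>i\<in>{1..r}. ds i * s i) V \<phi>"
    using a jc D_over_iff[OF vs char cV ext] by blast
qed (simp add: D_over_def)

lemma G_over_direct_sum:
  fixes scale :: "'k::field \<Rightarrow> 'v::ab_group_add \<Rightarrow> 'v"
  assumes vs: "vector_space scale" and char: "CHAR('k) = 0 \<or> CHAR('k) > (\<Sum>i\<in>{1..r}. ds i * s i)"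
    and c: "\<And>i. i \<in> {1..r} \<Longrightarrow> coordinates scale (ds i) (W i) (\<phi>s i) (ns i) (bs i) (ps i)"
    and cV: "coordinates scale (\<Sum>i\<in>{1..r}. ds i * s i) V \<phi> (total_dim ns r) b (prod_poly ns s r ps)"
    and ext: "field_extension h L" and i0: "i0 \<in> {1..r}" "s i0 = 1"
    and G: "G_over scale h L (ds i0) (W i0) (\<phi>s i0) = Units L"
  shows "G_over scale h L (\<Sum>i\<in>{1..r}. ds i * s i) V \<phi> = Units L"
proof (intro equalityI subsetI)
  fix a assume a: "a \<in> Units L"
  note L = field_extensionD[OF ext]
  interpret L: field L by (rule L(1))
  have ac: "a \<in> carrier L" using a by auto
  have p: "homogeneous (ns i) (ds i) (ps i)" if "i \<in> {1..r}" for i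
    using c[OF that] by (simp add: coordinates_def)
  have char0: "CHAR('k) = 0 \<or> CHAR('k) > ds i0"
  proof -
    have "ds i0 * s i0 \<le> (\<Sum>i\<in>{1..r}. ds i * s i)"
      by (rule member_le_sum[OF i0(1)]) auto
    then show ?thesis using char i0(2) by auto
  qed
  let ?a = "\<lambda>i. if i0 = i then a else \<one>\<^bsub>L\<^esub>"
  have "isomorphic_over L (ns i) (\<lambda>x. ?a i \<otimes>\<^bsub>L\<^esub> eval_over h L (ps i) x) (eval_over h L (ps i))"
    if i: "i \<in> {1..r}" for i
  proof (cases "i0 = i")
    case True
    then show ?thesis using G a G_over_iff[OF vs char0 c[OF i0(1)] ext] by auto
  next
    case False
    have "\<one>\<^bsub>L\<^esub> \<otimes>\<^bsub>L\<^esub> eval_over h L (ps i) x = eval_over h L (ps i) x" if "x \<in> vecs L (ns i)" for x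
      using eval_over_closed[OF L(2,3) p[OF i]] vecs_closed[OF that] by simp
    then show ?thesis using False inverse_linear_id[of L "ns i"]
      unfolding isomorphic_over_iff[OF L(2)] by auto
  qed
  then have "isomorphic_over L (total_dim ns r)
      (\<lambda>x. (\<Otimes>\<^bsub>L\<^esub>i\<in>{1..r}. ?a i [^]\<^bsub>L\<^esub> s i) \<otimes>\<^bsub>L\<^esub> eval_over h L (prod_poly ns s r ps) x)
      (eval_over h L (prod_poly ns s r ps))"
    by (intro isomorphic_over_prod_poly[OF L(2,3) p]) (use ac in auto)
  moreover have "(\<Otimes>\<^bsub>L\<^esub>i\<in>{1..r}. ?a i [^]\<^bsub>L\<^esub> s i) = a"
  proof -
    have "(\<Otimes>\<^bsub>L\<^esub>i\<in>{1..r}. ?a i [^]\<^bsub>L\<^esub> s i) = (\<Otimes>\<^bsub>L\<^esub>i\<in>{1..r}. ?a i)"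
      by (rule L.finprod_cong') (use ac i0(2) in auto)
    also have "\<dots> = a"
      using L.finprod_singleton[OF i0(1), of "\<lambda>_. a"] ac by simp
    finally show ?thesis .
  qed
  ultimately show "a \<in> G_over scale h L (\<Sum>i\<in>{1..r}. ds i * s i) V \<phi>"
    using a G_over_iff[OF vs char cV ext] by simp
qed (simp add: G_over_def)

section \<open>Multiplicativity of direct sums\<close>

text \<open>The exponent 1 gives the multiplicative and the exponent 2 the Jordan multiplicative forms. The
  identity is stated in the ambient field type instead of the subfield record.\<close>

definition power_multiplicative ::
    "nat \<Rightarrow> ('k::field, 'v::ab_group_add) scaling \<Rightarrow> nat \<Rightarrow> 'v set \<Rightarrow> ('v \<Rightarrow> 'k) \<Rightarrow> bool" where
  "power_multiplicative e scale d V \<phi> \<longleftrightarrow> (\<exists>n b p. coordinates scale d V \<phi> n b p \<and>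
     (\<exists>z\<in>vecs (ratfun_field (2 * n)) n.
        eval_over const_ratfun type_ring p var_ratfun ^ e *
        eval_over const_ratfun type_ring p (\<lambda>i. var_ratfun (n + i)) =
        eval_over const_ratfun type_ring p z))"

definition strongly_power_multiplicative ::
    "nat \<Rightarrow> ('k::field, 'v::ab_group_add) scaling \<Rightarrow> nat \<Rightarrow> 'v set \<Rightarrow> ('v \<Rightarrow> 'k) \<Rightarrow> bool" where
  "strongly_power_multiplicative e scale d V \<phi> \<longleftrightarrow> (\<exists>n b p. coordinates scale d V \<phi> n b p \<and>
     isomorphic_over (ratfun_field n) n
       (\<lambda>x. eval_over const_ratfun type_ring p var_ratfun ^ e \<otimes>\<^bsub>ratfun_field n\<^esub>
          eval_over const_ratfun (ratfun_field n) p x)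
       (eval_over const_ratfun (ratfun_field n) p))"

lemma eval_ratfun_field_at_vars:
  assumes p: "homogeneous n d p" and m: "\<And>i. i < n \<Longrightarrow> \<rho> i < m"
  shows "eval_over const_ratfun (ratfun_field m) p (\<lambda>i\<in>{..<n}. var_ratfun (\<rho> i)) =
    eval_over const_ratfun type_ring p (\<lambda>i. var_ratfun (\<rho> i))"
proof -
  have "eval_over const_ratfun (ratfun_field m) p (\<lambda>i\<in>{..<n}. var_ratfun (\<rho> i)) =
      eval_over const_ratfun type_ring p (\<lambda>i\<in>{..<n}. var_ratfun (\<rho> i))"
    by (rule eval_over_ratfun_field[OF p]) (use m in auto)
  also have "\<dots> = eval_over const_ratfun type_ring p (\<lambda>i. var_ratfun (\<rho> i))"
    by (rule eval_over_cong[OF cring_type_ring const_ratfun_hom p]) auto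
  finally show ?thesis .
qed

lemma eval_at_vars_closed:
  assumes p: "homogeneous n d p" and m: "\<And>i. i < n \<Longrightarrow> \<rho> i < m"
  shows "eval_over const_ratfun type_ring p (\<lambda>i. var_ratfun (\<rho> i)) \<in> carrier (ratfun_field m)"
proof -
  have "eval_over const_ratfun (ratfun_field m) p (\<lambda>i\<in>{..<n}. var_ratfun (\<rho> i)) \<in>
      carrier (ratfun_field m)"
    by (rule eval_over_closed[OF cring_ratfun_field
          field_extensionD(3)[OF field_extension_ratfun_field] p]) (use m in simp)
  then show ?thesis by (simp only: eval_ratfun_field_at_vars[where \<rho> = \<rho>, OF p m])
qed

lemma power_closed_ratfun_field:
  "x \<in> carrier (ratfun_field m) \<Longrightarrow> x ^ k \<in> carrier (ratfun_field m)"
  unfolding pow_ratfun_field[of m x k, symmetric]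
  by (rule monoid.nat_pow_closed[OF ring.is_monoid[OF cring.axioms(1)[OF cring_ratfun_field]]])

lemma multiplicative_iff:
  "multiplicative scale d V \<phi> \<longleftrightarrow> power_multiplicative 1 scale d V \<phi>"
  "jordan_multiplicative scale d V \<phi> \<longleftrightarrow> power_multiplicative 2 scale d V \<phi>"
proof -
  have at_X: "eval_over const_ratfun (ratfun_field (2 * n)) p (\<lambda>i\<in>{..<n}. var_ratfun i) =
        eval_over const_ratfun type_ring p var_ratfun"
    and at_Y: "eval_over const_ratfun (ratfun_field (2 * n)) p (\<lambda>i\<in>{..<n}. var_ratfun (n + i)) =
        eval_over const_ratfun type_ring p (\<lambda>i. var_ratfun (n + i))"
    and at_z: "z \<in> vecs (ratfun_field (2 * n)) n \<Longrightarrow>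
      eval_over const_ratfun (ratfun_field (2 * n)) p z = eval_over const_ratfun type_ring p z"
    if "coordinates scale d V \<phi> n b p" for n b p z
  proof -
    have p: "homogeneous n d p" using that by (simp add: coordinates_def)
    show "eval_over const_ratfun (ratfun_field (2 * n)) p (\<lambda>i\<in>{..<n}. var_ratfun i) =
        eval_over const_ratfun type_ring p var_ratfun"
      by (rule eval_ratfun_field_at_vars[OF p]) simp
    show "eval_over const_ratfun (ratfun_field (2 * n)) p (\<lambda>i\<in>{..<n}. var_ratfun (n + i)) =
        eval_over const_ratfun type_ring p (\<lambda>i. var_ratfun (n + i))"
      by (rule eval_ratfun_field_at_vars[OF p]) simp
    show "z \<in> vecs (ratfun_field (2 * n)) n \<Longrightarrow>
        eval_over const_ratfun (ratfun_field (2 * n)) p z = eval_over const_ratfun type_ring p z"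
      by (rule eval_over_ratfun_field[OF p]) (rule vecs_closed)
  qed
  show "multiplicative scale d V \<phi> \<longleftrightarrow> power_multiplicative 1 scale d V \<phi>"
    unfolding multiplicative_def power_multiplicative_def Let_def
    by (intro iff_exI conj_cong refl bex_cong)
      (simp only: at_X at_Y at_z ratfun_field_simps(1) power_one_right)
  show "jordan_multiplicative scale d V \<phi> \<longleftrightarrow> power_multiplicative 2 scale d V \<phi>"
    unfolding jordan_multiplicative_def power_multiplicative_def Let_def
    by (intro iff_exI conj_cong refl bex_cong)
      (simp only: at_X at_Y at_z ratfun_field_simps(1) pow_ratfun_field)
qed

lemma strongly_multiplicative_iff:
  "strongly_multiplicative scale d V \<phi> \<longleftrightarrow> strongly_power_multiplicative 1 scale d V \<phi>"
  "strongly_jordan_multiplicative scale d V \<phi> \<longleftrightarrow> strongly_power_multiplicative 2 scale d V \<phi>"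
proof -
  have at_X: "eval_over const_ratfun (ratfun_field n) p (\<lambda>i\<in>{..<n}. var_ratfun i) =
      eval_over const_ratfun type_ring p var_ratfun"
    if "coordinates scale d V \<phi> n b p" for n b p
  proof -
    have "homogeneous n d p" using that by (simp add: coordinates_def)
    then show ?thesis by (rule eval_ratfun_field_at_vars) simp
  qed
  show "strongly_multiplicative scale d V \<phi> \<longleftrightarrow> strongly_power_multiplicative 1 scale d V \<phi>"
    unfolding strongly_multiplicative_def strongly_power_multiplicative_def Let_def
    by (intro iff_exI conj_cong refl) (simp only: at_X power_one_right)
  show "strongly_jordan_multiplicative scale d V \<phi> \<longleftrightarrow>
      strongly_power_multiplicative 2 scale d V \<phi>"
    unfolding strongly_jordan_multiplicative_def strongly_power_multiplicative_def Let_def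
    by (intro iff_exI conj_cong refl) (simp only: at_X pow_ratfun_field)
qed

lemma eval_over_zero:
  assumes "homogeneous n d p" "d > 0"
  shows "eval_over const_ratfun type_ring p (\<lambda>i. 0) = 0"
proof -
  have "(\<Prod>i\<in>Poly_Mapping.keys m. (0 :: 'a ratfun) ^ Poly_Mapping.lookup m i) = 0"
    if m: "m \<in> Poly_Mapping.keys p" for m
  proof -
    have "Poly_Mapping.keys m \<noteq> {}" using assms m by (force simp: homogeneous_def)
    then obtain i where "i \<in> Poly_Mapping.keys m" by blast
    then have "\<exists>i\<in>Poly_Mapping.keys m. (0 :: 'a ratfun) ^ Poly_Mapping.lookup m i = 0"
      by (intro bexI[of _ i]) (auto simp: in_keys_iff)
    then show ?thesis by (simp add: prod_zero)
  qed
  then show ?thesis unfolding eval_over_type_ring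
    by (intro sum.neutral ballI) (simp only: mult_zero_right)
qed

lemma power_multiplicative_if_all_values:
  fixes scale :: "'k::field \<Rightarrow> 'v::ab_group_add \<Rightarrow> 'v"
  assumes vs: "vector_space scale" and char: "CHAR('k) = 0 \<or> CHAR('k) > d" and "d > 0"
    and c: "coordinates scale d V \<phi> n b p"
    and D: "D_over scale const_ratfun (ratfun_field (2 * n)) d V \<phi> = Units (ratfun_field (2 * n))"
  shows "power_multiplicative e scale d V \<phi>"
proof -
  let ?K = "ratfun_field (2 * n) :: 'k ratfun ring"
  interpret K: field ?K by (rule field_ratfun_field)
  have p: "homogeneous n d p" using c by (simp add: coordinates_def)
  define a where "a = eval_over const_ratfun type_ring p var_ratfun ^ e *
    eval_over const_ratfun type_ring p (\<lambda>i. var_ratfun (n + i))"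
  have "eval_over const_ratfun type_ring p var_ratfun \<in> carrier ?K"
    by (rule eval_at_vars_closed[OF p]) simp
  moreover have "eval_over const_ratfun type_ring p (\<lambda>i. var_ratfun (n + i)) \<in> carrier ?K"
    by (rule eval_at_vars_closed[OF p]) simp
  ultimately have a: "a \<in> carrier ?K"
    using K.m_closed[OF power_closed_ratfun_field] by (simp add: a_def ratfun_field_simps(1))
  have "\<exists>z\<in>vecs ?K n. eval_over const_ratfun type_ring p z = a"
    \<comment> \<open>the value 0 is not a unit, but a form of positive degree takes it at 0\<close>
  proof (cases "a = 0")
    case True
    have "eval_over const_ratfun type_ring p (\<lambda>i\<in>{..<n}. 0) =
        eval_over const_ratfun type_ring p (\<lambda>i. 0)"
      by (rule eval_over_cong[OF cring_type_ring const_ratfun_hom p]) auto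
    then show ?thesis
      using True eval_over_zero[OF p \<open>d > 0\<close>] K.zero_closed
      by (intro bexI[of _ "\<lambda>i\<in>{..<n}. 0"]) (simp_all add: ratfun_field_simps(4))
  next
    case False
    then have "a \<in> Units ?K" using a by (simp add: K.field_Units ratfun_field_simps(4))
    then obtain z where z: "z \<in> vecs ?K n" "eval_over const_ratfun ?K p z = a"
      using D D_over_iff[OF vs char c field_extension_ratfun_field] by blast
    then show ?thesis using eval_over_ratfun_field[OF p vecs_closed[OF z(1)]] by auto
  qed
  then obtain z where "z \<in> vecs ?K n" "a = eval_over const_ratfun type_ring p z" by blast
  then show ?thesis using c unfolding power_multiplicative_def a_def by blast
qed

lemma strongly_power_multiplicative_if_all_factors:
  fixes scale :: "'k::field \<Rightarrow> 'v::ab_group_add \<Rightarrow> 'v"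
  assumes vs: "vector_space scale" and char: "CHAR('k) = 0 \<or> CHAR('k) > d" and "e > 0"
    and c: "coordinates scale d V \<phi> n b p"
    and G: "G_over scale const_ratfun (ratfun_field n) d V \<phi> = Units (ratfun_field n)"
  shows "strongly_power_multiplicative e scale d V \<phi>"
proof -
  let ?K = "ratfun_field n :: 'k ratfun ring"
  interpret K: field ?K by (rule field_ratfun_field)
  have p: "homogeneous n d p" using c by (simp add: coordinates_def)
  define a where "a = eval_over const_ratfun type_ring p var_ratfun ^ e"
  have "eval_over const_ratfun type_ring p var_ratfun \<in> carrier ?K"
    by (rule eval_at_vars_closed[OF p]) simp
  then have a: "a \<in> carrier ?K" unfolding a_def by (rule power_closed_ratfun_field)
  have "isomorphic_over ?K n (\<lambda>x. a \<otimes>\<^bsub>?K\<^esub> eval_over const_ratfun ?K p x)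
      (eval_over const_ratfun ?K p)"
  proof (cases "a = 0")
    case True
    then have "Fract p 1 = 0"
      using \<open>e > 0\<close> eval_over_Vars[OF p] by (simp add: a_def)
    then have "p = 0" by (simp add: Zero_fract_def eq_fract)
    then show ?thesis
      using inverse_linear_id[of ?K n] K.r_null[OF a]
      unfolding isomorphic_over_iff[OF cring_ratfun_field] by (auto simp: eval_over_def)
  next
    case False
    then have "a \<in> Units ?K" using a by (simp add: K.field_Units ratfun_field_simps(4))
    then show ?thesis using G G_over_iff[OF vs char c field_extension_ratfun_field] by blast
  qed
  then show ?thesis using c unfolding strongly_power_multiplicative_def a_def by blast
qed

text \<open>The indeterminates of the \<open>i\<close>-th summand are moved to its block and all others beyond the
  \<open>total_dim ns r\<close> indeterminates of the sum, which makes the renaming injective.\<close>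

lemma strongly_power_multiplicative_direct_sum:
  fixes scale :: "'k::field \<Rightarrow> 'v::ab_group_add \<Rightarrow> 'v"
  assumes vs: "vector_space scale" and sum: "direct_sum scale r W V"
    and \<phi>: "\<And>u. (\<And>i. i \<in> {1..r} \<Longrightarrow> u i \<in> W i) \<Longrightarrow>
      \<phi> (\<Sum>i\<in>{1..r}. u i) = (\<Prod>i\<in>{1..r}. \<phi>s i (u i) ^ s i)"
    and char: "\<And>i. i \<in> {1..r} \<Longrightarrow> CHAR('k) = 0 \<or> CHAR('k) > ds i"
    and strong: "\<And>i. i \<in> {1..r} \<Longrightarrow> strongly_power_multiplicative e scale (ds i) (W i) (\<phi>s i)"
  shows "strongly_power_multiplicative e scale (\<Sum>i\<in>{1..r}. ds i * s i) V \<phi>"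
proof -
  have "\<exists>n b p. coordinates scale (ds i) (W i) (\<phi>s i) n b p \<and> isomorphic_over (ratfun_field n) n
       (\<lambda>x. eval_over const_ratfun type_ring p var_ratfun ^ e \<otimes>\<^bsub>ratfun_field n\<^esub>
          eval_over const_ratfun (ratfun_field n) p x) (eval_over const_ratfun (ratfun_field n) p)"
    if "i \<in> {1..r}" for i
    using strong[OF that] unfolding strongly_power_multiplicative_def .
  then obtain ns bs ps where
    c: "\<And>i. i \<in> {1..r} \<Longrightarrow> coordinates scale (ds i) (W i) (\<phi>s i) (ns i) (bs i) (ps i)"
    and iso: "\<And>i. i \<in> {1..r} \<Longrightarrow> isomorphic_over (ratfun_field (ns i)) (ns i)
       (\<lambda>x. eval_over const_ratfun type_ring (ps i) var_ratfun ^ e \<otimes>\<^bsub>ratfun_field (ns i)\<^esub>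
          eval_over const_ratfun (ratfun_field (ns i)) (ps i) x)
       (eval_over const_ratfun (ratfun_field (ns i)) (ps i))"
    by metis
  let ?N = "total_dim ns r" and ?P = "prod_poly ns s r ps"
  let ?K = "ratfun_field ?N :: 'k ratfun ring"
  interpret K: field ?K by (rule field_ratfun_field)
  have p: "homogeneous (ns i) (ds i) (ps i)" if "i \<in> {1..r}" for i
    using c[OF that] by (simp add: coordinates_def)
  have cV: "coordinates scale (\<Sum>i\<in>{1..r}. ds i * s i) V \<phi> ?N (join_blocks ns r bs) ?P"
    by (rule coordinates_join[OF vs sum \<phi> c])
  define w where
    "w i = eval_over const_ratfun type_ring (ps i) (\<lambda>j. var_ratfun (offset ns i + j))" for i
  have w: "w i ^ e \<in> carrier ?K" if "i \<in> {1..r}" for i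
    unfolding w_def using offset_less_total[OF that, of _ ns]
    by (intro power_closed_ratfun_field eval_at_vars_closed[OF p[OF that]])
  have "isomorphic_over ?K (ns i) (\<lambda>x. w i ^ e \<otimes>\<^bsub>?K\<^esub> eval_over const_ratfun ?K (ps i) x)
      (eval_over const_ratfun ?K (ps i))" if i: "i \<in> {1..r}" for i
  proof -
    let ?\<rho> = "\<lambda>j. if j < ns i then offset ns i + j else ?N + j"
    have less: "offset ns i + j < ?N" if "j < ns i" for j
      by (rule offset_less_total[where ns = ns, OF i that])
    have "inj ?\<rho>"
    proof (rule injI)
      fix j j' assume "?\<rho> j = ?\<rho> j'"
      then show "j = j'" using less[of j] less[of j'] by (simp split: if_splits)
    qed
    then obtain \<sigma> :: "'k ratfun \<Rightarrow> 'k ratfun" where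
      \<sigma>: "\<sigma> \<in> ring_hom type_ring type_ring" "\<And>c. \<sigma> (const_ratfun c) = const_ratfun c"
      and \<sigma>v: "\<And>j. \<sigma> (var_ratfun j) = var_ratfun (?\<rho> j)"
      and \<sigma>m: "\<And>m m'. ?\<rho> ` {..<m} \<subseteq> {..<m'} \<Longrightarrow> \<sigma> \<in> ring_hom (ratfun_field m) (ratfun_field m')"
      using rename_ratfun by blast
    have "\<sigma> \<in> ring_hom (ratfun_field (ns i)) ?K"
      by (rule \<sigma>m) (use less in auto)
    from isomorphic_over_rename[OF char[OF i] p[OF i] \<sigma> this _ iso[OF i]]
    have "isomorphic_over ?K (ns i)
        (\<lambda>x. \<sigma> (eval_over const_ratfun type_ring (ps i) var_ratfun ^ e) \<otimes>\<^bsub>?K\<^esub>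
          eval_over const_ratfun ?K (ps i) x) (eval_over const_ratfun ?K (ps i))"
      using power_closed_ratfun_field[OF eval_at_vars_closed[OF p[OF i], of "\<lambda>i. i" "ns i"]] by simp
    moreover have "\<sigma> (eval_over const_ratfun type_ring (ps i) var_ratfun ^ e) = w i ^ e"
    proof -
      have pow: "\<sigma> (x ^ k) = \<sigma> x ^ k" for x k
        using \<sigma>(1) by (induct k) (auto simp: ring_hom_type_ring_iff)
      have "\<sigma> (eval_over const_ratfun type_ring (ps i) var_ratfun) =
          eval_over const_ratfun type_ring (ps i) (\<lambda>j. \<sigma> (var_ratfun j))"
        using eval_over_natural[OF cring_type_ring cring_type_ring \<sigma>(1) const_ratfun_hom p[OF i]]
        by (simp add: \<sigma>(2))
      also have "\<dots> = w i" unfolding w_def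
        by (rule eval_over_cong[OF cring_type_ring const_ratfun_hom p[OF i]]) (auto simp: \<sigma>v)
      finally show ?thesis by (simp only: pow)
    qed
    ultimately show ?thesis by simp
  qed
  then have "isomorphic_over ?K ?N
      (\<lambda>x. (\<Otimes>\<^bsub>?K\<^esub>i\<in>{1..r}. (w i ^ e) [^]\<^bsub>?K\<^esub> s i) \<otimes>\<^bsub>?K\<^esub> eval_over const_ratfun ?K ?P x)
      (eval_over const_ratfun ?K ?P)"
    by (intro isomorphic_over_prod_poly[OF cring_ratfun_field
          field_extensionD(3)[OF field_extension_ratfun_field] p w])
  moreover have "(\<Otimes>\<^bsub>?K\<^esub>i\<in>{1..r}. (w i ^ e) [^]\<^bsub>?K\<^esub> s i) =
      eval_over const_ratfun type_ring ?P var_ratfun ^ e"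
  proof -
    have "(\<Otimes>\<^bsub>?K\<^esub>i\<in>{1..r}. (w i ^ e) [^]\<^bsub>?K\<^esub> s i) = (\<Prod>i\<in>{1..r}. (w i ^ e) ^ s i)"
      unfolding pow_ratfun_field
      by (rule finprod_ratfun_field) (rule power_closed_ratfun_field[OF w])
    also have "\<dots> = (\<Prod>i\<in>{1..r}. w i ^ s i) ^ e"
      by (simp add: prod_power_distrib flip: power_mult) (simp add: mult.commute)
    also have "(\<Prod>i\<in>{1..r}. w i ^ s i) = eval_over const_ratfun type_ring ?P var_ratfun"
    proof -
      have "eval_over const_ratfun type_ring (ps i) (block ns i var_ratfun) = w i"
        if "i \<in> {1..r}" for i unfolding w_def
        by (rule eval_over_cong[OF cring_type_ring const_ratfun_hom p[OF that]])
          (auto simp: block_apply)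
      then show ?thesis
        using eval_prod_poly[where ns = ns and ps = ps and ds = ds and r = r and s = s,
            OF cring_type_ring const_ratfun_hom p] by simp
    qed
    finally show ?thesis .
  qed
  ultimately have "isomorphic_over ?K ?N
      (\<lambda>x. eval_over const_ratfun type_ring ?P var_ratfun ^ e \<otimes>\<^bsub>?K\<^esub> eval_over const_ratfun ?K ?P x)
      (eval_over const_ratfun ?K ?P)" by (simp only:)
  with cV show ?thesis unfolding strongly_power_multiplicative_def by blast
qed

lemma power_multiplicative_direct_sum:
  fixes scale :: "'k::field \<Rightarrow> 'v::ab_group_add \<Rightarrow> 'v"
  assumes vs: "vector_space scale" and sum: "direct_sum scale r W V"
    and \<phi>: "\<And>u. (\<And>i. i \<in> {1..r} \<Longrightarrow> u i \<in> W i) \<Longrightarrow>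
      \<phi> (\<Sum>i\<in>{1..r}. u i) = (\<Prod>i\<in>{1..r}. \<phi>s i (u i) ^ s i)"
    and mult: "\<And>i. i \<in> {1..r} \<Longrightarrow> power_multiplicative e scale (ds i) (W i) (\<phi>s i)"
  shows "power_multiplicative e scale (\<Sum>i\<in>{1..r}. ds i * s i) V \<phi>"
proof -
  let ?ev = "eval_over (const_ratfun :: 'k \<Rightarrow> 'k ratfun) type_ring"
  have "\<exists>n b p z. coordinates scale (ds i) (W i) (\<phi>s i) n b p \<and> z \<in> vecs (ratfun_field (2 * n)) n \<and>
      ?ev p var_ratfun ^ e * ?ev p (\<lambda>i. var_ratfun (n + i)) = ?ev p z"
    if "i \<in> {1..r}" for i
    using mult[OF that] unfolding power_multiplicative_def by blast
  then obtain ns bs ps zs where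
    c: "\<And>i. i \<in> {1..r} \<Longrightarrow> coordinates scale (ds i) (W i) (\<phi>s i) (ns i) (bs i) (ps i)"
    and zs: "\<And>i. i \<in> {1..r} \<Longrightarrow> zs i \<in> vecs (ratfun_field (2 * ns i)) (ns i)"
    and eq: "\<And>i. i \<in> {1..r} \<Longrightarrow>
      ?ev (ps i) var_ratfun ^ e * ?ev (ps i) (\<lambda>j. var_ratfun (ns i + j)) = ?ev (ps i) (zs i)"
    by metis
  let ?N = "total_dim ns r" and ?P = "prod_poly ns s r ps"
  let ?K = "ratfun_field (2 * ?N) :: 'k ratfun ring"
  have p: "homogeneous (ns i) (ds i) (ps i)" if "i \<in> {1..r}" for i
    using c[OF that] by (simp add: coordinates_def)
  have cV: "coordinates scale (\<Sum>i\<in>{1..r}. ds i * s i) V \<phi> ?N (join_blocks ns r bs) ?P"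
    by (rule coordinates_join[OF vs sum \<phi> c])
  let ?Y = "\<lambda>t. var_ratfun (?N + t) :: 'k ratfun"
  have "\<exists>z\<in>vecs ?K (ns i). ?ev (ps i) (block ns i var_ratfun) ^ e * ?ev (ps i) (block ns i ?Y) =
      ?ev (ps i) z" if i: "i \<in> {1..r}" for i
  proof -
    \<comment> \<open>\<open>X\<^sub>i\<close> and \<open>Y\<^sub>i\<close>, at \<open>0, \<dots>, 2 n\<^sub>i - 1\<close>, go to the \<open>i\<close>-th blocks of \<open>X\<close> and of \<open>Y\<close>\<close>
    let ?\<rho> = "\<lambda>j. if j < ns i then offset ns i + j
      else if j < 2 * ns i then ?N + (offset ns i + (j - ns i)) else 2 * ?N + j"
    have less: "offset ns i + j < ?N" if "j < ns i" for j
      by (rule offset_less_total[where ns = ns, OF i that])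
    have less': "offset ns i + (j - ns i) < ?N" if "\<not> j < ns i" "j < 2 * ns i" for j
      by (rule less) (use that in simp)
    have "inj ?\<rho>"
    proof (rule injI)
      fix j j' assume "?\<rho> j = ?\<rho> j'"
      then show "j = j'"
        using less[of j] less[of j'] less'[of j] less'[of j'] by (simp split: if_splits)
    qed
    then obtain \<sigma> :: "'k ratfun \<Rightarrow> 'k ratfun" where
      \<sigma>: "\<sigma> \<in> ring_hom type_ring type_ring" "\<And>c. \<sigma> (const_ratfun c) = const_ratfun c"
      and \<sigma>v: "\<And>j. \<sigma> (var_ratfun j) = var_ratfun (?\<rho> j)"
      and \<sigma>m: "\<And>m m'. ?\<rho> ` {..<m} \<subseteq> {..<m'} \<Longrightarrow> \<sigma> \<in> ring_hom (ratfun_field m) (ratfun_field m')"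
      using rename_ratfun by blast
    have \<sigma>K: "\<sigma> \<in> ring_hom (ratfun_field (2 * ns i)) ?K"
    proof (rule \<sigma>m, rule image_subsetI)
      fix j assume "j \<in> {..<2 * ns i}"
      then have j: "j < 2 * ns i" by simp
      show "?\<rho> j \<in> {..<2 * ?N}"
      proof (cases "j < ns i")
        case True
        then show ?thesis using less[OF True] by simp
      next
        case False
        then have "?\<rho> j = ?N + (offset ns i + (j - ns i))" using j by simp
        then show ?thesis using less'[OF False j] by simp
      qed
    qed
    have mult: "\<sigma> (x * y) = \<sigma> x * \<sigma> y" and one: "\<sigma> 1 = 1" for x y
      using \<sigma>(1) by (auto simp: ring_hom_type_ring_iff)
    have pow: "\<sigma> (x ^ k) = \<sigma> x ^ k" for x k
      by (induct k) (auto simp: mult one)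
    have nat: "\<sigma> (?ev (ps i) x) = ?ev (ps i) y" if "\<And>j. j < ns i \<Longrightarrow> \<sigma> (x j) = y j" for x y
    proof -
      have "\<sigma> (?ev (ps i) x) = ?ev (ps i) (\<lambda>j. \<sigma> (x j))"
        using eval_over_natural[OF cring_type_ring cring_type_ring \<sigma>(1) const_ratfun_hom p[OF i]]
        by (simp add: \<sigma>(2))
      also have "\<dots> = ?ev (ps i) y"
        by (rule eval_over_cong[OF cring_type_ring const_ratfun_hom p[OF i]]) (auto simp: that)
      finally show ?thesis .
    qed
    let ?z = "\<lambda>j\<in>{..<ns i}. \<sigma> (zs i j)"
    have "\<sigma> (?ev (ps i) var_ratfun) = ?ev (ps i) (block ns i var_ratfun)"
      by (rule nat) (simp add: \<sigma>v block_apply)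
    moreover have "\<sigma> (?ev (ps i) (\<lambda>j. var_ratfun (ns i + j))) = ?ev (ps i) (block ns i ?Y)"
      by (rule nat) (simp add: \<sigma>v block_apply)
    moreover have "\<sigma> (?ev (ps i) (zs i)) = ?ev (ps i) ?z"
      by (rule nat) simp
    ultimately have "?ev (ps i) (block ns i var_ratfun) ^ e * ?ev (ps i) (block ns i ?Y) =
        ?ev (ps i) ?z"
      using arg_cong[OF eq[OF i], of \<sigma>] by (simp only: mult pow)
    moreover have "?z \<in> vecs ?K (ns i)"
      using ring_hom_closed[OF \<sigma>K] vecs_closed[OF zs[OF i]] by simp
    ultimately show ?thesis by blast
  qed
  then obtain z where z: "\<And>i. i \<in> {1..r} \<Longrightarrow> z i \<in> vecs ?K (ns i)"
    and ev_z: "\<And>i. i \<in> {1..r} \<Longrightarrow>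
      ?ev (ps i) (block ns i var_ratfun) ^ e * ?ev (ps i) (block ns i ?Y) = ?ev (ps i) (z i)"
    by metis
  have ev_P: "?ev ?P x = (\<Prod>i\<in>{1..r}. ?ev (ps i) (block ns i x) ^ s i)" for x
    using eval_prod_poly[where ns = ns and ps = ps and ds = ds and r = r and s = s and x = x,
        OF cring_type_ring const_ratfun_hom p] by simp
  have pow_comm: "(x ^ k) ^ l = (x ^ l) ^ k" for x :: "'k ratfun" and k l
    by (metis power_mult mult.commute)
  have "?ev ?P var_ratfun ^ e * ?ev ?P ?Y =
      (\<Prod>i\<in>{1..r}. (?ev (ps i) (block ns i var_ratfun) ^ e * ?ev (ps i) (block ns i ?Y)) ^ s i)"
    unfolding ev_P prod_power_distrib prod.distrib[symmetric]
    by (rule prod.cong) (simp_all only: power_mult_distrib pow_comm[of _ e])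
  also have "\<dots> = (\<Prod>i\<in>{1..r}. ?ev (ps i) (block ns i (join_blocks ns r z)) ^ s i)"
  proof (rule prod.cong[OF refl])
    fix i assume i: "i \<in> {1..r}"
    show "(?ev (ps i) (block ns i var_ratfun) ^ e * ?ev (ps i) (block ns i ?Y)) ^ s i =
        ?ev (ps i) (block ns i (join_blocks ns r z)) ^ s i"
      by (simp only: ev_z[OF i] block_join[where ns = ns and y = z, OF i z[OF i]])
  qed
  also have "\<dots> = ?ev ?P (join_blocks ns r z)" by (rule ev_P[symmetric])
  finally have "?ev ?P var_ratfun ^ e * ?ev ?P ?Y = ?ev ?P (join_blocks ns r z)" .
  moreover have "join_blocks ns r z \<in> vecs ?K ?N" by (rule join_vecs) (rule z)
  ultimately show ?thesis using cV unfolding power_multiplicative_def by blast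
qed

theorem lemma2:
  fixes scale :: "'k::field \<Rightarrow> 'v::ab_group_add \<Rightarrow> 'v"
    and r d :: nat
    and ds s :: "nat \<Rightarrow> nat"
    and W :: "nat \<Rightarrow> 'v set" and V :: "'v set"
    and \<phi>s :: "nat \<Rightarrow> 'v \<Rightarrow> 'k" and \<phi> :: "'v \<Rightarrow> 'k"
  \<comment> \<open>Field extensions have their carrier in the type \<open>'u\<close>, which may be any type
      with at least as many elements as the rational function field.\<close>
  assumes universe: "\<exists>f :: 'k ratfun \<Rightarrow> 'u. inj f"
    and vs: "vector_space scale"
    and r: "r \<ge> 1"
    and ds: "\<forall>i\<in>{1..r}. ds i > 0"
    and s: "\<forall>i\<in>{1..r}. s i > 0"
    and d: "d = (\<Sum>i\<in>{1..r}. ds i * s i)"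
    and char: "CHAR('k) = 0 \<or> CHAR('k) > d"
    and forms: "\<forall>i\<in>{1..r}. is_form scale (ds i) (W i) (\<phi>s i)"
    and nondeg: "\<forall>i\<in>{1..r}. nondegenerate scale (ds i) (W i) (\<phi>s i)"
    and sum: "direct_sum scale r W V"
    and \<phi>: "\<forall>u. (\<forall>i\<in>{1..r}. u i \<in> W i) \<longrightarrow>
              \<phi> (\<Sum>i\<in>{1..r}. u i) = (\<Prod>i\<in>{1..r}. \<phi>s i (u i) ^ s i)"
  shows
  \<comment> \<open>The first part excludes \<open>W i = {0}\<close>: the form on it is 0, hence so is \<open>\<phi>\<close>.\<close>
    "((\<forall>i\<in>{1..r}. W i \<noteq> {0}) \<and>
      (\<exists>i0\<in>{1..r}. s i0 = 1 \<and>
         (\<forall>(h :: 'k \<Rightarrow> 'u) L. field_extension h L \<longrightarrow>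
            D_over scale h L (ds i0) (W i0) (\<phi>s i0) = Units L))
      \<longrightarrow>
      (\<forall>(h :: 'k \<Rightarrow> 'u) L. field_extension h L \<longrightarrow>
         D_over scale h L d V \<phi> = Units L) \<and>
      multiplicative scale d V \<phi> \<and>
      jordan_multiplicative scale d V \<phi>)
   \<and> ((\<exists>i0\<in>{1..r}. s i0 = 1 \<and>
         (\<forall>(h :: 'k \<Rightarrow> 'u) L. field_extension h L \<longrightarrow>
            G_over scale h L (ds i0) (W i0) (\<phi>s i0) = Units L))
      \<longrightarrow>
      (\<forall>(h :: 'k \<Rightarrow> 'u) L. field_extension h L \<longrightarrow>
         G_over scale h L d V \<phi> = Units L) \<and>
      strongly_multiplicative scale d V \<phi>)
   \<and> ((\<forall>i\<in>{1..r}. strongly_multiplicative scale (ds i) (W i) (\<phi>s i))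
      \<longrightarrow> strongly_multiplicative scale d V \<phi>)
   \<and> ((\<forall>i\<in>{1..r}. multiplicative scale (ds i) (W i) (\<phi>s i))
      \<longrightarrow> multiplicative scale d V \<phi>)
   \<and> ((\<forall>i\<in>{1..r}. strongly_jordan_multiplicative scale (ds i) (W i) (\<phi>s i))
      \<longrightarrow> strongly_jordan_multiplicative scale d V \<phi>)
   \<and> ((\<forall>i\<in>{1..r}. jordan_multiplicative scale (ds i) (W i) (\<phi>s i))
      \<longrightarrow> jordan_multiplicative scale d V \<phi>)"
proof -
  obtain f :: "'k ratfun \<Rightarrow> 'u" where f: "inj f" using universe by blast
  have \<phi>': "\<phi> (\<Sum>i\<in>{1..r}. u i) = (\<Prod>i\<in>{1..r}. \<phi>s i (u i) ^ s i)"
    if "\<And>i. i \<in> {1..r} \<Longrightarrow> u i \<in> W i" for u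
    using \<phi> that by blast
  have ds_le: "ds i \<le> d" if "i \<in> {1..r}" for i
  proof -
    have "ds i * 1 \<le> ds i * s i" using s that by (intro mult_le_mono2) (simp add: Suc_leI)
    also have "\<dots> \<le> d" unfolding d by (rule member_le_sum[OF that]) auto
    finally show ?thesis by simp
  qed
  then have char_i: "CHAR('k) = 0 \<or> CHAR('k) > ds i" if "i \<in> {1..r}" for i
    using char that by fastforce
  have "1 \<in> {1..r}" using r by simp
  then have "d > 0" using ds_le[of 1] ds by fastforce
  have "\<exists>n b p. coordinates scale (ds i) (W i) (\<phi>s i) n b p" if "i \<in> {1..r}" for i
    using forms that unfolding is_form_def by blast
  then obtain ns bs ps where
    c: "\<And>i. i \<in> {1..r} \<Longrightarrow> coordinates scale (ds i) (W i) (\<phi>s i) (ns i) (bs i) (ps i)"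
    by metis
  have cV: "coordinates scale d V \<phi> (total_dim ns r) (join_blocks ns r bs) (prod_poly ns s r ps)"
    unfolding d by (rule coordinates_join[OF vs sum \<phi>' c])
  have D_mult: "(\<forall>(h :: 'k \<Rightarrow> 'u) L. field_extension h L \<longrightarrow> D_over scale h L d V \<phi> = Units L) \<and>
      power_multiplicative 1 scale d V \<phi> \<and> power_multiplicative 2 scale d V \<phi>"
    if W: "\<forall>i\<in>{1..r}. W i \<noteq> {0}" and i0: "i0 \<in> {1..r}" "s i0 = 1"
      and D: "\<forall>(h :: 'k \<Rightarrow> 'u) L. field_extension h L \<longrightarrow>
        D_over scale h L (ds i0) (W i0) (\<phi>s i0) = Units L" for i0
  proof -
    have nz: "\<exists>v\<in>W i. \<phi>s i v \<noteq> 0" if i: "i \<in> {1..r}" for i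
    proof -
      have "module.subspace scale (W i)" using sum i by (simp add: direct_sum_def)
      then show ?thesis
        using nondegenerate_nonzero_value[OF vs _ char_i[OF i]] ds nondeg W i by metis
    qed
    note D_V = D_over_direct_sum[OF vs char[unfolded d] c cV[unfolded d] _ i0 nz, folded d]
    have "D_over scale h L d V \<phi> = Units L" if "field_extension h L" for h :: "'k \<Rightarrow> 'u" and L
      by (rule D_V[OF _ that]) (use D that in auto)
    moreover have "D_over scale const_ratfun (ratfun_field m) (ds i0) (W i0) (\<phi>s i0) =
        Units (ratfun_field m)" for m
      by (rule D_over_ratfun_field[OF f vs char_i[OF i0(1)] c[OF i0(1)]]) (use D in blast)
    then have "D_over scale const_ratfun (ratfun_field m) d V \<phi> = Units (ratfun_field m)" for m
      by (intro D_V[OF _ field_extension_ratfun_field])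
    then have "power_multiplicative e scale d V \<phi>" for e
      by (rule power_multiplicative_if_all_values[OF vs char \<open>d > 0\<close> cV])
    ultimately show ?thesis by blast
  qed
  have G_mult: "(\<forall>(h :: 'k \<Rightarrow> 'u) L. field_extension h L \<longrightarrow> G_over scale h L d V \<phi> = Units L) \<and>
      strongly_power_multiplicative 1 scale d V \<phi>"
    if i0: "i0 \<in> {1..r}" "s i0 = 1"
      and G: "\<forall>(h :: 'k \<Rightarrow> 'u) L. field_extension h L \<longrightarrow>
        G_over scale h L (ds i0) (W i0) (\<phi>s i0) = Units L" for i0
  proof -
    note G_V = G_over_direct_sum[OF vs char[unfolded d] c cV[unfolded d] _ i0, folded d]
    have "G_over scale h L d V \<phi> = Units L" if "field_extension h L" for h :: "'k \<Rightarrow> 'u" and L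
      by (rule G_V[OF _ that]) (use G that in auto)
    moreover have "G_over scale const_ratfun (ratfun_field m) (ds i0) (W i0) (\<phi>s i0) =
        Units (ratfun_field m)" for m
      by (rule G_over_ratfun_field[OF f vs char_i[OF i0(1)] c[OF i0(1)]]) (use G in blast)
    then have "G_over scale const_ratfun (ratfun_field m) d V \<phi> = Units (ratfun_field m)" for m
      by (intro G_V[OF _ field_extension_ratfun_field])
    then have "strongly_power_multiplicative 1 scale d V \<phi>"
      by (rule strongly_power_multiplicative_if_all_factors[OF vs char zero_less_one cV])
    ultimately show ?thesis by blast
  qed
  have strong: "strongly_power_multiplicative e scale d V \<phi>"
    if "\<forall>i\<in>{1..r}. strongly_power_multiplicative e scale (ds i) (W i) (\<phi>s i)" for e
    unfolding d
    by (rule strongly_power_multiplicative_direct_sum[where ds = ds and \<phi>s = \<phi>s,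
          OF vs sum \<phi>' char_i]) (use that in auto)
  have mult: "power_multiplicative e scale d V \<phi>"
    if "\<forall>i\<in>{1..r}. power_multiplicative e scale (ds i) (W i) (\<phi>s i)" for e
    unfolding d
    by (rule power_multiplicative_direct_sum[where ds = ds and \<phi>s = \<phi>s, OF vs sum \<phi>'])
      (use that in auto)
  show ?thesis
    unfolding multiplicative_iff strongly_multiplicative_iff
  proof (intro conjI[OF _ conjI[OF _ conjI[OF _ conjI[OF _ conjI]]]]; rule impI)
    assume "(\<forall>i\<in>{1..r}. W i \<noteq> {0}) \<and> (\<exists>i0\<in>{1..r}. s i0 = 1 \<and>
      (\<forall>(h :: 'k \<Rightarrow> 'u) L. field_extension h L \<longrightarrow>
         D_over scale h L (ds i0) (W i0) (\<phi>s i0) = Units L))"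
    then show "(\<forall>(h :: 'k \<Rightarrow> 'u) L. field_extension h L \<longrightarrow> D_over scale h L d V \<phi> = Units L) \<and>
        power_multiplicative 1 scale d V \<phi> \<and> power_multiplicative 2 scale d V \<phi>"
      by (elim conjE bexE) (rule D_mult)
  next
    assume "\<exists>i0\<in>{1..r}. s i0 = 1 \<and> (\<forall>(h :: 'k \<Rightarrow> 'u) L. field_extension h L \<longrightarrow>
         G_over scale h L (ds i0) (W i0) (\<phi>s i0) = Units L)"
    then show "(\<forall>(h :: 'k \<Rightarrow> 'u) L. field_extension h L \<longrightarrow> G_over scale h L d V \<phi> = Units L) \<and>
        strongly_power_multiplicative 1 scale d V \<phi>"
      by (elim conjE bexE) (rule G_mult)
  qed (fact strong mult)+
qed

end
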